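(* Let $\dot x=f(x,y)$, $\dot y=g(x,y)$ be a real planar polynomial differential system which is $(\alpha,\beta,\omega)$-weight-homogeneous for some $\alpha,\beta>0$, $\omega\in\mathbb{R}$, and which has a center at the origin. Consider a one-parameter perturbation $$\dot x=f(x,y)+\varepsilon\,Q(x,y,\varepsilon),\qquad \dot y=g(x,y)-\varepsilon\,P(x,y,\varepsilon),$$ where $P(x,y,\varepsilon)$ and $Q(x,y,\varepsilon)$ are real polynomials in $x,y$ of degree at most $d$, depending analytically on the small real parameter $\varepsilon$. Let $M_1$ be the first Poincaré-Pontryagin-Melnikov function of this perturbation. If $M_1$ is not identically zero, then the perturbed system has at most $$\frac{(d+1)(d+4)}{2}-1$$ limit cycles which tend to periodic orbits of the unperturbed system as $\varepsilon$ tends to zero.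
   Context: Weight-homogeneity: the system $\dot x=f(x,y)$, $\dot y=g(x,y)$ is $(\alpha,\beta,\omega)$-weight-homogeneous, with $\alpha,\beta>0$ and $\omega\in\mathbb{R}$, if for all $\rho>0$ and $x,y\in\mathbb{R}$ one has $f(\rho^\alpha x,\rho^\beta y)=\rho^{\omega+\alpha}f(x,y)$ and $g(\rho^\alpha x,\rho^\beta y)=\rho^{\omega+\beta}g(x,y)$. When such a system has a center at the origin, the center is global: the period annulus is $\mathbb{R}^2\setminus\{(0,0)\}$, a union of periodic orbits. First return map and $M_1$: let $\mathbb{R}^+_*=\{(x,0):x>0\}$, identified with $(0,\infty)$. For every compact set $K\subset\mathbb{R}^+_*$ and for $|\varepsilon|$ small enough there is an open interval $\Delta\supset K$ in $\mathbb{R}^+_*$ on which the first return map $\Pi_\varepsilon:\Delta\to\mathbb{R}^+$, $x\mapsto\Pi_\varepsilon(x)$, of the perturbed system is well defined and analytic. The first Poincaré-Pontryagin-Melnikov function $M_1:(0,\infty)\to\mathbb{R}$ is defined by the expansion $\Pi_\varepsilon(x)=x+\varepsilon M_1(x)+o(\varepsilon)$; it is defined on the whole half-axis. Limit cycles of the perturbed system correspond to (isolated) fixed points of $\Pi_\varepsilon$. The statement that at most $N$ limit cycles tend to periodic orbits as $\varepsilon\to0$ means that the cyclicity of the open period annulus $\mathbb{R}^2\setminus\{(0,0)\}$ with respect to the perturbation is at most $N$: for every compact $K\subset\mathbb{R}^+_*$ there is $\varepsilon_0>0$ such that for $0<|\varepsilon|<\varepsilon_0$ the map $\Pi_\varepsilon$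 has at most $N$ fixed points in $K$ corresponding to limit cycles. Nothing is claimed about limit cycles tending to the origin or to infinity. *)

theory Defs
  imports "HOL-Analysis.Analysis" "HOL-Library.Landau_Symbols"
begin

definition poly2 :: "nat \<Rightarrow> (nat \<Rightarrow> nat \<Rightarrow> real) \<Rightarrow> real \<Rightarrow> real \<Rightarrow> real" where
  "poly2 n c x y = (\<Sum>i\<le>n. \<Sum>j\<le>n - i. c i j * x ^ i * y ^ j)"

definition polynomial2 :: "(real \<Rightarrow> real \<Rightarrow> real) \<Rightarrow> bool" where
  "polynomial2 f \<longleftrightarrow> (\<exists>n c. \<forall>x y. f x y = poly2 n c x y)"

(* Only the germ at eps = 0 matters: P is a polynomial in x, y of total degree at most d
   for all small eps, and its coefficients are real analytic functions of eps at 0. *)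
definition analytic_poly2_family :: "nat \<Rightarrow> (real \<Rightarrow> real \<Rightarrow> real \<Rightarrow> real) \<Rightarrow> bool" where
  "analytic_poly2_family d P \<longleftrightarrow>
     (\<exists>c. (\<forall>i j. \<exists>F. (c i j :: real \<Rightarrow> real) has_fps_expansion F) \<and>
          (\<forall>\<^sub>F \<epsilon> in nhds 0. \<forall>x y. P x y \<epsilon> = poly2 d (\<lambda>i j. c i j \<epsilon>) x y))"

definition weight_homogeneous ::
  "real \<Rightarrow> real \<Rightarrow> real \<Rightarrow> (real \<Rightarrow> real \<Rightarrow> real) \<Rightarrow> (real \<Rightarrow> real \<Rightarrow> real) \<Rightarrow> bool" where
  "weight_homogeneous \<alpha> \<beta> \<omega> f g \<longleftrightarrow>
     (\<forall>\<rho>>0. \<forall>x y.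
        f (\<rho> powr \<alpha> * x) (\<rho> powr \<beta> * y) = \<rho> powr (\<omega> + \<alpha>) * f x y \<and>
        g (\<rho> powr \<alpha> * x) (\<rho> powr \<beta> * y) = \<rho> powr (\<omega> + \<beta>) * g x y)"

definition planar_field ::
  "(real \<Rightarrow> real \<Rightarrow> real) \<Rightarrow> (real \<Rightarrow> real \<Rightarrow> real) \<Rightarrow> real \<times> real \<Rightarrow> real \<times> real" where
  "planar_field f g = (\<lambda>(x, y). (f x y, g x y))"

definition perturbed_field ::
  "(real \<Rightarrow> real \<Rightarrow> real) \<Rightarrow> (real \<Rightarrow> real \<Rightarrow> real) \<Rightarrow>
   (real \<Rightarrow> real \<Rightarrow> real \<Rightarrow> real) \<Rightarrow> (real \<Rightarrow> real \<Rightarrow> real \<Rightarrow> real) \<Rightarrow>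
   real \<Rightarrow> real \<times> real \<Rightarrow> real \<times> real" where
  "perturbed_field f g P Q \<epsilon> =
     planar_field (\<lambda>x y. f x y + \<epsilon> * Q x y \<epsilon>) (\<lambda>x y. g x y - \<epsilon> * P x y \<epsilon>)"

definition solution_on ::
  "(real \<times> real \<Rightarrow> real \<times> real) \<Rightarrow> real set \<Rightarrow> (real \<Rightarrow> real \<times> real) \<Rightarrow> bool" where
  "solution_on X I \<gamma> \<longleftrightarrow>
     (\<forall>t\<in>I. (\<gamma> has_vector_derivative X (\<gamma> t)) (at t within I))"

definition periodic_orbit :: "(real \<times> real \<Rightarrow> real \<times> real) \<Rightarrow> (real \<times> real) set \<Rightarrow> bool" where
  "periodic_orbit X C \<longleftrightarrow>
     (\<exists>\<gamma> T. T > 0 \<and> solution_on X UNIV \<gamma> \<and> (\<forall>t. \<gamma> (t + T) = \<gamma> t) \<and>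
            (\<exists>t. \<gamma> t \<noteq> \<gamma> 0) \<and> C = range \<gamma>)"

definition center_at_origin :: "(real \<times> real \<Rightarrow> real \<times> real) \<Rightarrow> bool" where
  "center_at_origin X \<longleftrightarrow>
     X (0, 0) = (0, 0) \<and>
     (\<exists>U. open U \<and> (0, 0) \<in> U \<and>
          (\<forall>p\<in>U - {(0, 0)}. \<exists>C. periodic_orbit X C \<and> p \<in> C \<and> C \<subseteq> U - {(0, 0)}))"

definition limit_cycle :: "(real \<times> real \<Rightarrow> real \<times> real) \<Rightarrow> (real \<times> real) set \<Rightarrow> bool" where
  "limit_cycle X C \<longleftrightarrow>
     periodic_orbit X C \<and>
     (\<exists>U. open U \<and> C \<subseteq> U \<and> (\<forall>C'. periodic_orbit X C' \<and> C' \<subseteq> U \<longrightarrow> C' = C))"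

(* The graph of the (partial) first return map to the open half-axis {(x, 0). x > 0}. *)
definition first_return :: "(real \<times> real \<Rightarrow> real \<times> real) \<Rightarrow> real \<Rightarrow> real \<Rightarrow> bool" where
  "first_return X x x' \<longleftrightarrow>
     x > 0 \<and> x' > 0 \<and>
     (\<exists>\<gamma> T. T > 0 \<and> solution_on X {0..T} \<gamma> \<and> \<gamma> 0 = (x, 0) \<and> \<gamma> T = (x', 0) \<and>
            (\<forall>t\<in>{0<..<T}. \<gamma> t \<notin> {0<..} \<times> {0}))"

definition return_map :: "(real \<times> real \<Rightarrow> real \<times> real) \<Rightarrow> real \<Rightarrow> real" where
  "return_map X x = (THE x'. first_return X x x')"

definition melnikov1 :: "(real \<Rightarrow> real \<times> real \<Rightarrow> real \<times> real) \<Rightarrow> real \<Rightarrow> real" where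
  "melnikov1 X x =
     (THE m. (\<lambda>\<epsilon>. return_map (X \<epsilon>) x - (x + \<epsilon> * m)) \<in> o[at 0](\<lambda>\<epsilon>. \<epsilon>))"

end

theory Submission
  imports Defs "HOL-Complex_Analysis.Complex_Analysis"
begin

text \<open>
  In the coordinates \<open>x = exp (\<alpha> v) cos \<phi>\<close>, \<open>y = exp (\<beta> v) (\<sigma> sin \<phi>)\<close> the unperturbed system has the form
  \<open>dv/d\<phi> = A \<phi> / B \<phi>\<close>: the denominator \<open>B\<close> cannot vanish, since otherwise a weighted ray would be
  invariant, and the integral \<open>H\<close> of \<open>A/B\<close> is \<open>2 \<pi>\<close>-periodic, since otherwise orbits of the center would
  spiral. For the perturbed system \<open>u = v - H \<phi>\<close> satisfies \<open>du/d\<phi> = \<epsilon> G \<epsilon> \<phi> u\<close> with \<open>G\<close> an explicit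
  quotient of exponential sums in \<open>u\<close>. Picard iteration with complex initial value shows that the
  return map is \<open>u + \<epsilon> Z \<epsilon> u\<close>, where \<open>Z \<epsilon>\<close> is holomorphic near a given real interval and converges there
  uniformly to an exponential sum \<open>M\<close>, which up to a positive factor is the Melnikov function in the
  variable \<open>u = ln x / \<alpha>\<close>. At most
  \<open>(d + 1) (d + 4) / 2\<close> distinct exponents occur in \<open>M\<close>, and the functions \<open>Z \<epsilon>\<close> inherit from \<open>M\<close> the bound
  on the number of zeros by Rolle's theorem and the convergence of derivatives.
\<close>

section \<open>Zeros of functions close to an exponential sum\<close>

text \<open>The obstacle is that \<open>M\<close> may have multiple zeros, each of which can split
  into several zeros of \<open>Z \<epsilon>\<close>. Counting zeros of \<open>M\<close> is therefore
  not enough: Rolle has to be run on \<open>Z \<epsilon>\<close> itself, with as many derivatives as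
  there are exponents. This is why the initial values are complex: uniform convergence on a complex
  neighbourhood controls all derivatives through Cauchy's estimate. Weight-homogeneity enters by
  making the unperturbed slope independent of \<open>v\<close>. Subtracting its integral
  \<open>H\<close> leaves a right-hand side of order \<epsilon>, so the displacement can be divided
  by \<epsilon>, and every monomial \<open>x ^ i * y ^ j\<close> becomes one exponential in
  \<open>u\<close> whose coefficient depends on the angle only. The constant: the exponents are
  parametrized by the pairs \<open>(i, j)\<close> with 0 < i + j \<le> d + 1, and there are
  (d+2)(d+3)/2 - 1 = (d+1)(d+4)/2 of them. An exponential sum with N distinct exponents and some
  nonzero coefficient has at most N - 1 real zeros, whence the final -1. That \<open>M_1\<close> is
  not identically zero is used to obtain one nonzero coefficient.\<close>

lemma rolle_finite_zeros:
  fixes F F' :: "real \<Rightarrow> real"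
  assumes der: "\<And>u. u \<in> {a..b} \<Longrightarrow> (F has_real_derivative F' u) (at u)"
    and Z: "finite Z" "Z \<subseteq> {a..b}" "\<And>u. u \<in> Z \<Longrightarrow> F u = 0" "card Z = Suc n"
  shows "\<exists>W. finite W \<and> W \<subseteq> {a..b} \<and> (\<forall>u\<in>W. F' u = 0 \<and> u < Max Z) \<and> card W = n"
  using Z
proof (induction n arbitrary: Z)
  case 0
  then show ?case by (intro exI[of _ "{}"]) auto
next
  case (Suc n)
  define m where "m = Max Z"
  define Z0 where "Z0 = Z - {m}"
  have ne: "Z \<noteq> {}" using Suc.prems by auto
  have m: "m \<in> Z" unfolding m_def using Suc.prems ne by (intro Max_in) auto
  have c: "card Z0 = Suc n" using Suc.prems m unfolding Z0_def by auto
  have f0: "finite Z0" "Z0 \<noteq> {}" using Suc.prems(1) c by (simp add: Z0_def) (use c in auto)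

  obtain W where W: "finite W" "W \<subseteq> {a..b}" "\<And>u. u \<in> W \<Longrightarrow> F' u = 0 \<and> u < Max Z0" "card W = n"
    using Suc.IH[of Z0] Suc.prems c f0 unfolding Z0_def by blast
  define p where "p = Max Z0"
  have p: "p \<in> Z0" unfolding p_def using f0 by (intro Max_in) auto
  have pm: "p < m"
  proof -
    have "p \<le> m" unfolding m_def using p Suc.prems by (intro Max_ge) (auto simp: Z0_def)
    moreover have "p \<noteq> m" using p by (auto simp: Z0_def)
    ultimately show ?thesis by simp
  qed
  have pz: "p \<in> Z" using p by (auto simp: Z0_def)
  have ab: "a \<le> p" "m \<le> b" using pz m Suc.prems by auto
  have "\<exists>z>p. z < m \<and> F' z = 0"
  proof -
    have "\<exists>l z. z > p \<and> z < m \<and> DERIV F z :> l \<and> F m - F p = (m - p) * l"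
    proof (rule MVT)
      show "continuous_on {p..m} F"
        using der ab by (meson DERIV_continuous atLeastAtMost_iff continuous_at_imp_continuous_on order_trans)
      show "F differentiable (at x)" if "p < x" "x < m" for x
        using der[of x] that ab by (auto simp: real_differentiable_def intro!: exI)
    qed (use pm in auto)
    then obtain l z where z: "z > p" "z < m" "DERIV F z :> l" "F m - F p = (m - p) * l" by blast
    have "l = 0" using z pm Suc.prems(3)[OF pz] Suc.prems(3)[OF m] by auto
    moreover have "l = F' z" using z der[of z] ab by (auto intro: DERIV_unique)
    ultimately show ?thesis using z by auto
  qed
  then obtain z where z: "z > p" "z < m" "F' z = 0" by auto
  \<comment> \<open>This is the purpose of the clause \<open>u < Max Z\<close> in the induction: the
    old points lie below \<open>p = Max Z0\<close>, the new one lies strictly between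
    \<open>p\<close> and \<open>m\<close>.\<close>
  have "z \<notin> W" using W(3)[of z] z unfolding p_def by auto
  then show ?case
    using W z ab pm
    by (intro exI[of _ "insert z W"]) (force simp: p_def m_def)
qed

lemma zeros_after_first_order_operator:
  fixes F F' :: "real \<Rightarrow> real"
  assumes der: "\<And>u. u \<in> {a..b} \<Longrightarrow> (F has_real_derivative F' u) (at u)"
    and Z: "finite Z" "Z \<subseteq> {a..b}" "\<And>u. u \<in> Z \<Longrightarrow> F u = 0" "card Z = Suc n"
  shows "\<exists>W. finite W \<and> W \<subseteq> {a..b} \<and> (\<forall>u\<in>W. F' u - \<mu> * F u = 0) \<and> card W = n"
proof -
  have d: "((\<lambda>u. exp (-\<mu> * u) * F u) has_real_derivative exp (-\<mu> * u) * (F' u - \<mu> * F u)) (at u)"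
    if "u \<in> {a..b}" for u
    using der[OF that] by (auto intro!: derivative_eq_intros simp: algebra_simps)
  have "\<exists>W. finite W \<and> W \<subseteq> {a..b} \<and>
    (\<forall>u\<in>W. exp (-\<mu> * u) * (F' u - \<mu> * F u) = 0 \<and> u < Max Z) \<and> card W = n"
    by (rule rolle_finite_zeros[OF d Z(1,2) _ Z(4)]) (auto simp: Z(3))
  then show ?thesis by auto
qed

text \<open>Cauchy's estimate on circles of one fixed radius \<open>r\<close> around the points of
  \<open>K\<close>: a bound for \<open>f n - g\<close> on the compact \<open>r\<close>-thickening
  \<open>K'\<close> of \<open>K\<close>, divided by \<open>r\<close>, bounds the difference of the
  derivatives. Asking for \<open>e * r / 2\<close> there leaves \<open>e / 2 < e\<close>.\<close>

lemma uniform_limit_deriv_on_compact: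
  fixes f :: "'i \<Rightarrow> complex \<Rightarrow> complex"
  assumes S: "open S"
    and lim: "\<And>K. compact K \<Longrightarrow> K \<subseteq> S \<Longrightarrow> uniform_limit K f g F"
    and hol: "\<forall>\<^sub>F n in F. f n holomorphic_on S" and g: "g holomorphic_on S"
    and K: "compact K" "K \<subseteq> S"
  shows "uniform_limit K (\<lambda>n. deriv (f n)) (deriv g) F"
proof -
  obtain r where r: "r > 0" "(\<Union>x\<in>K. cball x r) \<subseteq> S"
    using compact_subset_open_imp_cball_epsilon_subset[OF K(1) S K(2)] by blast
  define K' where "K' = {x + y | x y. x \<in> K \<and> y \<in> cball 0 r}"
  have K'c: "compact K'"
    unfolding K'_def by (intro compact_sums K) auto
  have K'mem: "z \<in> K'" if "x \<in> K" "dist x z \<le> r" for x z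
  proof -
    have "z = x + (z - x)" "z - x \<in> cball 0 r" using that by (auto simp: dist_norm norm_minus_commute)
    then show ?thesis unfolding K'_def using that by blast
  qed
  have K'S: "K' \<subseteq> S"
  proof
    fix z assume "z \<in> K'"
    then obtain x y where "z = x + y" "x \<in> K" "y \<in> cball 0 r" by (auto simp: K'_def)
    then have "z \<in> cball x r" "x \<in> K" by (auto simp: dist_norm)
    then show "z \<in> S" using r by blast
  qed
  show ?thesis
  proof (rule uniform_limitI)
    fix e :: real assume e: "e > 0"
    have "\<forall>\<^sub>F n in F. \<forall>z\<in>K'. dist (f n z) (g z) < e * r / 2"
      using uniform_limitD[OF lim[OF K'c K'S], of "e * r / 2"] e r by auto
    then show "\<forall>\<^sub>F n in F. \<forall>z\<in>K. dist (deriv (f n) z) (deriv g z) < e"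
      using hol
    proof eventually_elim
      case (elim n)
      show ?case
      proof
        fix z assume z: "z \<in> K"
        have cb: "cball z r \<subseteq> S" using r z by auto
        have h: "(\<lambda>w. f n w - g w) holomorphic_on S" using elim g by (auto intro!: holomorphic_intros)
        have "norm ((deriv ^^ 1) (\<lambda>w. f n w - g w) z) \<le> fact 1 * (e * r / 2) / r ^ 1"
        proof (rule Cauchy_inequality)
          show "(\<lambda>w. f n w - g w) holomorphic_on ball z r"
            using h cb ball_subset_cball holomorphic_on_subset by blast
          show "continuous_on (cball z r) (\<lambda>w. f n w - g w)"
            using h cb holomorphic_on_subset holomorphic_on_imp_continuous_on by blast
          show "norm (f n x - g x) \<le> e * r / 2" if "norm (z - x) = r" for x
            using elim(1) K'mem[OF z, of x] that by (force simp: dist_norm)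
        qed (use r in auto)
        also have "\<dots> = e / 2" using r by auto
        also have "\<dots> < e" using e by auto
        finally have "norm (deriv (\<lambda>w. f n w - g w) z) < e" by simp
        moreover have "deriv (\<lambda>w. f n w - g w) z = deriv (f n) z - deriv g z"
          using z K elim(2) g S by (intro deriv_diff) (auto intro: holomorphic_on_imp_differentiable_at)
        ultimately show "dist (deriv (f n) z) (deriv g z) < e" by (simp add: dist_norm)
      qed
    qed
  qed
qed

text \<open>Indexed by the set of its exponents, which are therefore distinct;
  \<open>card \<Lambda>\<close> is the number that Rolle's argument consumes. Families with repeated
  exponents are written with \<open>exp_comb\<close>.\<close>

definition exp_sum :: "real set \<Rightarrow> (real \<Rightarrow> real) \<Rightarrow> complex \<Rightarrow> complex" where
  "exp_sum \<Lambda> c z = (\<Sum>k\<in>\<Lambda>. of_real (c k) * exp (of_real k * z))"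

lemma holomorphic_exp_sum: "exp_sum \<Lambda> c holomorphic_on S"
  unfolding exp_sum_def by (intro holomorphic_intros)

lemma deriv_exp_sum:
  "deriv (exp_sum \<Lambda> c) z = exp_sum \<Lambda> (\<lambda>k. k * c k) z"
  unfolding exp_sum_def
  by (rule DERIV_imp_deriv) (auto intro!: derivative_eq_intros sum.cong simp: algebra_simps)

text \<open>
  The operators \<^term>\<open>\<lambda>h z. deriv h z - \<mu> * h z\<close> kill the exponentials one by one and each of them
  costs at most one zero, by Rolle applied to \<^term>\<open>\<lambda>u. exp (-\<mu> * u) * h u\<close>. Applied to the perturbed
  functions themselves, this avoids any discussion of the multiplicities of the zeros of the limit.
\<close>

lemma eventually_few_zeros_near_exp_sum:
  fixes h :: "'i \<Rightarrow> complex \<Rightarrow> complex"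
  assumes S: "open S" "complex_of_real ` {a..b} \<subseteq> S"
    and lim: "\<And>K. compact K \<Longrightarrow> K \<subseteq> S \<Longrightarrow> uniform_limit K h (exp_sum \<Lambda> c) F"
    and hol: "\<forall>\<^sub>F n in F. h n holomorphic_on S"
    and \<Lambda>: "finite \<Lambda>" "k0 \<in> \<Lambda>" "c k0 \<noteq> 0"
  shows "\<forall>\<^sub>F n in F. \<forall>Z. finite Z \<longrightarrow> Z \<subseteq> {a..b} \<longrightarrow> (\<forall>u\<in>Z. Re (h n (of_real u)) = 0) \<longrightarrow>
           card Z \<noteq> card \<Lambda>"
proof -
  \<comment> \<open>The induction runs over the exponents other than \<open>k0\<close>. Removing
    \<mu> multiplies the coefficient of exponent \<open>k\<close> by \<open>k - \<mu>\<close>, which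
    is nonzero for \<open>k = k0\<close>, so the term \<open>k0\<close> survives to the base case.
    There it stands alone and a nonvanishing limit leaves no zero.\<close>
  define L where "L = \<Lambda> - {k0}"
  have L: "finite L" "k0 \<notin> L" "\<Lambda> = insert k0 L" using \<Lambda> by (auto simp: L_def)
  show ?thesis
    using L(1,2) \<Lambda>(3) lim hol unfolding L(3)
  proof (induction L arbitrary: h c rule: finite_induct)
    case empty
    show ?case
    proof (cases "a \<le> b")
      case False
      then show ?thesis by auto
    next
      case True
      \<comment> \<open>A positive lower bound for the modulus of the remaining exponential on
        \<open>{a..b}\<close>: being monotone, it takes its minimum at an endpoint.\<close>
      define m where "m = \<bar>c k0\<bar> * min (exp (k0 * a)) (exp (k0 * b))"
      have m: "m > 0" unfolding m_def using empty by auto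
      have low: "\<bar>c k0 * exp (k0 * u)\<bar> \<ge> m" if "u \<in> {a..b}" for u
      proof -
        have "min (k0 * a) (k0 * b) \<le> k0 * u"
          using that by (cases "k0 \<ge> 0")
            (auto simp: min_le_iff_disj intro: mult_left_mono mult_left_mono_neg)
        then have "min (exp (k0 * a)) (exp (k0 * b)) \<le> exp (k0 * u)"
          by (auto simp: min_le_iff_disj)
        then show ?thesis unfolding m_def abs_mult by (auto intro!: mult_left_mono)
      qed
      have "uniform_limit (complex_of_real ` {a..b}) h (exp_sum {k0} c) F"
        using S by (intro empty) (auto intro!: compact_continuous_image continuous_intros)
      from uniform_limitD[OF this m]
      have "\<forall>\<^sub>F n in F. \<forall>u\<in>{a..b}. dist (h n (of_real u)) (exp_sum {k0} c (of_real u)) < m"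
        by simp
      then show ?thesis
      proof eventually_elim
        case (elim n)
        have "Re (h n (of_real u)) \<noteq> 0" if "u \<in> {a..b}" for u
        proof
          assume 0: "Re (h n (of_real u)) = 0"
          have "\<bar>Re (h n (of_real u)) - Re (exp_sum {k0} c (of_real u))\<bar> < m"
            using elim[rule_format, OF that] abs_Re_le_cmod[of "h n (of_real u) - exp_sum {k0} c (of_real u)"]
            by (simp add: dist_norm)
          moreover have "Re (exp_sum {k0} c (of_real u)) = c k0 * exp (k0 * u)"
            by (simp add: exp_sum_def Re_exp)
          ultimately show False using low[OF that] 0 by auto
        qed
        then have "Z = {}" if "Z \<subseteq> {a..b}" "\<forall>u\<in>Z. Re (h n (of_real u)) = 0" for Z
          using that by blast
        then show ?case by force
      qed
    qed
  next
    case (insert \<mu> L)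
    have mu: "\<mu> \<noteq> k0" "k0 \<notin> L" using insert by auto
    define h' where "h' = (\<lambda>n z. deriv (h n) z - of_real \<mu> * h n z)"
    define c' where "c' = (\<lambda>k. (k - \<mu>) * c k)"
    have fin: "finite (insert k0 L)" using insert by auto
    have mL: "\<mu> \<notin> insert k0 L" using insert mu by auto
    have lim': "deriv (exp_sum (insert \<mu> (insert k0 L)) c) z
        - of_real \<mu> * exp_sum (insert \<mu> (insert k0 L)) c z = exp_sum (insert k0 L) c' z" for z
      unfolding deriv_exp_sum exp_sum_def c'_def sum.insert[OF fin mL]
      by (simp add: sum_distrib_left algebra_simps flip: sum_subtractf)
    have IH: "\<forall>\<^sub>F n in F. \<forall>Z. finite Z \<longrightarrow> Z \<subseteq> {a..b} \<longrightarrow> (\<forall>u\<in>Z. Re (h' n (of_real u)) = 0) \<longrightarrow>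
           card Z \<noteq> card (insert k0 L)"
    proof (rule insert.IH)
      show "k0 \<notin> L" by fact
      show "c' k0 \<noteq> 0" using insert mu by (auto simp: c'_def)
      show "\<forall>\<^sub>F n in F. h' n holomorphic_on S"
        using insert.prems(4)
        by eventually_elim (auto simp: h'_def intro!: holomorphic_intros S)
      fix K :: "complex set" assume K: "compact K" "K \<subseteq> S"
      have "uniform_limit K (\<lambda>n. deriv (h n)) (deriv (exp_sum (insert \<mu> (insert k0 L)) c)) F"
        by (rule uniform_limit_deriv_on_compact[OF S(1) _ insert.prems(4) _ K])
           (use insert.prems(3) in \<open>auto simp: insert_commute intro: holomorphic_exp_sum\<close>)
      moreover have "uniform_limit K h (exp_sum (insert \<mu> (insert k0 L)) c) F"
        using insert.prems(3)[OF K] by (simp add: insert_commute)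
      then have "uniform_limit K (\<lambda>n z. of_real \<mu> * h n z) (\<lambda>z. of_real \<mu> * exp_sum (insert \<mu> (insert k0 L)) c z) F"
        by (intro bounded_linear.uniform_limit[OF bounded_linear_mult_right])
      ultimately have "uniform_limit K (\<lambda>n z. deriv (h n) z - of_real \<mu> * h n z)
          (\<lambda>z. deriv (exp_sum (insert \<mu> (insert k0 L)) c) z - of_real \<mu> * exp_sum (insert \<mu> (insert k0 L)) c z) F"
        by (rule uniform_limit_minus)
      then show "uniform_limit K h' (exp_sum (insert k0 L) c') F"
        unfolding h'_def lim' .
    qed
    show ?case
      using IH insert.prems(4)
    proof eventually_elim
      case (elim n)
      show ?case
      proof (intro allI impI notI)
        fix Z assume Z: "finite Z" "Z \<subseteq> {a..b}" "\<forall>u\<in>Z. Re (h n (of_real u)) = 0"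
          "card Z = card (insert k0 (insert \<mu> L))"
        have "card Z = Suc (card (insert k0 L))"
          using Z(4) fin mL by (simp add: insert_commute)
        \<comment> \<open>Since \<mu> is real, taking real parts along the real axis commutes with
          the operator, so the real Rolle argument applies to \<open>Re (h n u)\<close>.\<close>
        moreover have "((\<lambda>u. Re (h n (of_real u))) has_real_derivative Re (deriv (h n) (of_real u))) (at u)"
          if "u \<in> {a..b}" for u
        proof -
          have "(h n has_field_derivative deriv (h n) (of_real u)) (at (of_real u))"
            using elim(2) S that by (intro holomorphic_derivI) auto
          then have "((\<lambda>u. h n (of_real u)) has_vector_derivative deriv (h n) (of_real u)) (at u)"
            by (rule has_vector_derivative_real_field)
          then show ?thesis
            by (auto simp: has_real_derivative_iff_has_vector_derivative
                intro: bounded_linear.has_vector_derivative[OF bounded_linear_Re])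
        qed
        ultimately obtain W where W: "finite W" "W \<subseteq> {a..b}"
          "\<forall>u\<in>W. Re (deriv (h n) (of_real u)) - \<mu> * Re (h n (of_real u)) = 0" "card W = card (insert k0 L)"
          using zeros_after_first_order_operator[of a b "\<lambda>u. Re (h n (of_real u))" "\<lambda>u. Re (deriv (h n) (of_real u))" Z "card (insert k0 L)" \<mu>] Z
          by auto
        then show False using elim(1)[rule_format, of W] by (auto simp: h'_def)
      qed
    qed
  qed
qed

section \<open>Holomorphic dependence on the initial value\<close>

lemma continuous_on_slice:
  assumes "continuous_on (A \<times> B) (\<lambda>(x, y). h x y)" "x \<in> A"
  shows "continuous_on B (h x)"
  by (rule continuous_on_compose2[OF assms(1), of B "\<lambda>y. (x, y)", simplified])
     (use assms(2) in \<open>auto intro!: continuous_intros\<close>)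

lemma continuous_on_slice2:
  assumes "continuous_on (A \<times> B) (\<lambda>(x, y). h x y)" "y \<in> B"
  shows "continuous_on A (\<lambda>x. h x y)"
  by (rule continuous_on_compose2[OF assms(1), of A "\<lambda>x. (x, y)", simplified])
     (use assms(2) in \<open>auto intro!: continuous_intros\<close>)

text \<open>Leibniz's rule wants the \<open>z\<close>-derivative jointly continuous in
  \<open>(z, t)\<close>, but joint continuity is given for \<open>h\<close> only. Cauchy's formula
  writes the derivative as a circle integral of \<open>h\<close>, and this integral inherits the
  joint continuity.\<close>

lemma holomorphic_on_integral_param:
  fixes h :: "complex \<Rightarrow> real \<Rightarrow> complex"
  assumes U: "open U" and cont: "continuous_on (U \<times> {a..b}) (\<lambda>(z, t). h z t)"
    and hol: "\<And>t. t \<in> {a..b} \<Longrightarrow> (\<lambda>z. h z t) holomorphic_on U"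
  shows "(\<lambda>z. integral {a..b} (h z)) holomorphic_on U"
proof (rule holomorphic_onI)
  fix z0 assume z0: "z0 \<in> U"
  obtain r where r: "r > 0" "cball z0 r \<subseteq> U" using U z0 open_contains_cball by blast
  have br: "ball z0 r \<subseteq> U" using r ball_subset_cball by blast
  define fx where "fx = (\<lambda>w t. 1 / (2 * of_real pi * \<i>) *
      contour_integral (circlepath z0 r) (\<lambda>u. h u t / (u - w)\<^sup>2))"
  have circ: "circlepath z0 r x \<in> cball z0 r" "norm (circlepath z0 r x - z0) = r" for x
    using r by (auto simp: circlepath dist_norm norm_mult)
  have contc: "continuous_on A (\<lambda>x. circlepath z0 r (f x))" if "continuous_on A f" for f :: "'c::topological_space \<Rightarrow> real" and A
    unfolding circlepath by (intro continuous_intros that)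
  have "(\<lambda>z. integral (cbox a b) (h z)) holomorphic_on ball z0 r"
  proof (rule leibniz_rule_holomorphic)
    show "((\<lambda>x. h x t) has_field_derivative fx x t) (at x within ball z0 r)"
      if "x \<in> ball z0 r" "t \<in> cbox a b" for x t
      unfolding fx_def
      by (rule has_field_derivative_at_within, rule Cauchy_derivative_integral_circlepath(2))
         (use hol[of t] that r br in \<open>auto intro: holomorphic_on_subset holomorphic_on_imp_continuous_on\<close>)
    show "h x integrable_on cbox a b" if "x \<in> ball z0 r" for x
      using continuous_on_slice[OF cont, of x] br that by (auto intro!: integrable_continuous_real)
    have "continuous_on (ball z0 r \<times> {a..b})
       (\<lambda>p. integral (cbox 0 1) (\<lambda>x. h (circlepath z0 r x) (snd p) / (circlepath z0 r x - fst p)\<^sup>2 *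
          (2 * of_real pi * \<i> * of_real r * exp (2 * of_real pi * \<i> * of_real x))))"
    proof (rule integral_continuous_on_param)
      have "continuous_on ((ball z0 r \<times> {a..b}) \<times> cbox (0::real) 1)
         (\<lambda>p. h (circlepath z0 r (snd p)) (snd (fst p)))"
        by (rule continuous_on_compose2[OF cont[unfolded split_beta], of _ "\<lambda>p. (circlepath z0 r (snd p), snd (fst p))", simplified])
           (use circ r in \<open>auto intro!: continuous_intros contc\<close>)
      moreover have "circlepath z0 r (snd p) - fst (fst p) \<noteq> 0" if "p \<in> (ball z0 r \<times> {a..b}) \<times> cbox (0::real) 1" for p
        using circ(2)[of "snd p"] that by (auto simp: dist_norm norm_minus_commute)
      ultimately show "continuous_on ((ball z0 r \<times> {a..b}) \<times> cbox 0 1)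
         (\<lambda>(p, x). h (circlepath z0 r x) (snd p) / (circlepath z0 r x - fst p)\<^sup>2 *
          (2 * of_real pi * \<i> * of_real r * exp (2 * of_real pi * \<i> * of_real x)))"
        unfolding split_beta by (intro continuous_intros contc) auto
    qed
    then show "continuous_on (ball z0 r \<times> cbox a b) (\<lambda>(w, t). fx w t)"
      unfolding fx_def contour_integral_integral split_beta
      by (auto simp: vector_derivative_circlepath intro!: continuous_intros)
  qed auto
  then show "(\<lambda>z. integral {a..b} (h z)) field_differentiable at z0 within U"
    using r holomorphic_on_imp_differentiable_at field_differentiable_at_within by fastforce
qed

text \<open>The substitution of \<open>t * s\<close> for \<open>s\<close> turns the moving endpoint
  into a parameter of an integral over the fixed interval from 0 to 1.\<close>

lemma continuous_on_indefinite_integral_param: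
  fixes h :: "real \<Rightarrow> 'a::topological_space \<Rightarrow> 'b::euclidean_space"
  assumes cont: "continuous_on ({0..L} \<times> S) (\<lambda>(t, z). h t z)"
  shows "continuous_on ({0..L} \<times> S) (\<lambda>(t, z). integral {0..t} (\<lambda>s. h s z))"
proof -
  have eq: "integral {0..t} (\<lambda>s. h s z) = t *\<^sub>R integral (cbox 0 1) (\<lambda>s. h (t * s) z)" if "t \<in> {0..L}" for t z
  proof (cases "t = 0")
    case False
    then have "(\<lambda>x. x / t) ` {0..t} = {0..1}" using that by (simp add: image_divide_atLeastAtMost)
    then show ?thesis using integral_stretch_real[of t 0 t "\<lambda>s. h s z"] False that by simp
  qed auto
  have "continuous_on ({0..L} \<times> S) (\<lambda>p. fst p *\<^sub>R integral (cbox 0 1) (\<lambda>s. h (fst p * s) (snd p)))"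
  proof (intro continuous_intros integral_continuous_on_param)
    have m: "t * s \<le> L" if "0 \<le> t" "t \<le> L" "0 \<le> s" "s \<le> 1" for s t :: real
      using mult_left_le[of s t] that by linarith
    show "continuous_on (({0..L} \<times> S) \<times> cbox 0 1) (\<lambda>(p, s). h (fst p * s) (snd p))"
      unfolding split_beta
      by (rule continuous_on_compose2[OF cont[unfolded split_beta], of _ "\<lambda>p. (fst (fst p) * snd p, snd (fst p))", simplified])
         (auto intro!: continuous_intros m)
  qed
  then show ?thesis
    by (rule continuous_on_cong[THEN iffD1, rotated 2]) (auto simp: eq)
qed

lemma norm_diff_le_of_vector_derivative:
  fixes f :: "real \<Rightarrow> 'a::real_normed_vector"
  assumes "\<And>t. t \<in> {0..L} \<Longrightarrow> (f has_vector_derivative f' t) (at t within {0..L})"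
    and "\<And>t. t \<in> {0..L} \<Longrightarrow> norm (f' t) \<le> B" and "t \<in> {0..L}"
  shows "norm (f t - f 0) \<le> B * t"
proof -
  have "norm (f t - f 0) \<le> B * norm (t - 0)"
  proof (rule differentiable_bound[where S = "{0..L}" and f' = "\<lambda>t h. h *\<^sub>R f' t"])
    show "onorm (\<lambda>h. h *\<^sub>R f' x) \<le> B" if "x \<in> {0..L}" for x
      using assms(2)[OF that]
      by (intro onorm_le) (auto simp: mult.commute[of B] intro: mult_left_mono)
  qed (use assms in \<open>auto simp: has_vector_derivative_def\<close>)
  then show ?thesis using assms(3) by simp
qed

section \<open>Picard iteration with complex initial values\<close>

primrec picard :: "(real \<Rightarrow> complex \<Rightarrow> complex) \<Rightarrow> nat \<Rightarrow> real \<Rightarrow> complex \<Rightarrow> complex" where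
  "picard g 0 t z = z"
| "picard g (Suc n) t z = z + integral {0..t} (\<lambda>s. g s (picard g n s z))"

text \<open>\<open>B * L \<le> \<eta>\<close> confines every iterate to the ball of radius \<eta>
  around its initial value, hence to \<Omega>, and \<open>C * L \<le> 1 / 2\<close> makes the
  iteration contract. Convergence is thus uniform in time and initial value together, and the limit
  is holomorphic in the initial value as a uniform limit of holomorphic iterates. Both conditions
  will hold on a full turn because the field carries the factor \<epsilon>.\<close>

lemma holomorphic_flow:
  fixes g :: "real \<Rightarrow> complex \<Rightarrow> complex"
  assumes L: "L \<ge> 0" "\<eta> \<ge> 0" and \<Omega>': "open \<Omega>'" "\<And>z. z \<in> \<Omega>' \<Longrightarrow> cball z \<eta> \<subseteq> \<Omega>"
    and cont: "continuous_on ({0..L} \<times> \<Omega>) (\<lambda>(t, z). g t z)"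
    and hol: "\<And>t. t \<in> {0..L} \<Longrightarrow> g t holomorphic_on \<Omega>"
    and bound: "\<And>t z. t \<in> {0..L} \<Longrightarrow> z \<in> \<Omega> \<Longrightarrow> norm (g t z) \<le> B" "B * L \<le> \<eta>"
    and lip: "\<And>t z w. t \<in> {0..L} \<Longrightarrow> z \<in> \<Omega> \<Longrightarrow> w \<in> \<Omega> \<Longrightarrow> norm (g t z - g t w) \<le> C * norm (z - w)"
      "C * L \<le> 1 / 2" "C \<ge> 0"
    and real: "\<And>t u. t \<in> {0..L} \<Longrightarrow> of_real u \<in> \<Omega> \<Longrightarrow> g t (of_real u) \<in> \<real>"
  obtains U where
    "\<And>z. z \<in> \<Omega>' \<Longrightarrow> U 0 z = z"
    "\<And>t z. t \<in> {0..L} \<Longrightarrow> z \<in> \<Omega>' \<Longrightarrow> norm (U t z - z) \<le> \<eta>"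
    "\<And>t z. t \<in> {0..L} \<Longrightarrow> z \<in> \<Omega>' \<Longrightarrow>
       ((\<lambda>t. U t z) has_vector_derivative g t (U t z)) (at t within {0..L})"
    "\<And>t. t \<in> {0..L} \<Longrightarrow> U t holomorphic_on \<Omega>'"
    "\<And>t u. t \<in> {0..L} \<Longrightarrow> of_real u \<in> \<Omega>' \<Longrightarrow> U t (of_real u) \<in> \<real>"
proof -
  let ?W = "picard g"
  let ?P = "{0..L} \<times> \<Omega>'"
  \<comment> \<open>The three properties go through one induction: the next iterate is an integral
    of \<open>g\<close> along the present one, which must be continuous, stay in \<Omega> and be
    holomorphic in \<open>z\<close>.\<close>
  have inv: "continuous_on ?P (\<lambda>(t, z). ?W n t z) \<and>
    (\<forall>t\<in>{0..L}. \<forall>z\<in>\<Omega>'. norm (?W n t z - z) \<le> \<eta>) \<and>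
    (\<forall>t\<in>{0..L}. ?W n t holomorphic_on \<Omega>')" for n
  proof (induction n)
    case 0
    show ?case using L by (auto simp: split_beta intro!: continuous_intros holomorphic_intros)
  next
    case (Suc n)
    have mem: "?W n t z \<in> \<Omega>" if "t \<in> {0..L}" "z \<in> \<Omega>'" for t z
      using Suc \<Omega>'(2)[of z] that by (auto simp: dist_norm norm_minus_commute subset_iff)
    have c1: "continuous_on ?P (\<lambda>(t, z). g t (?W n t z))"
      using Suc unfolding split_beta
      by (intro continuous_on_compose2[OF cont[unfolded split_beta], of _ "\<lambda>p. (fst p, ?W n (fst p) (snd p))", simplified])
         (auto intro!: continuous_intros simp: mem)
    have "continuous_on ?P (\<lambda>(t, z). ?W (Suc n) t z)"
      using continuous_on_indefinite_integral_param[OF c1]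
      by (auto simp: split_beta intro!: continuous_intros)
    moreover have "norm (?W (Suc n) t z - z) \<le> \<eta>" if "t \<in> {0..L}" "z \<in> \<Omega>'" for t z
    proof -
      have "norm (integral {0..t} (\<lambda>s. g s (?W n s z))) \<le> B * (t - 0)"
        using that mem bound
        by (intro integral_bound continuous_on_subset[OF continuous_on_slice2[OF c1, of z]]) auto
      also have "\<dots> \<le> B * L"
        using that bound(1)[of t z] mem[of t z] bound(1)[OF that(1) mem[OF that]] norm_ge_zero[of "g t (?W n t z)"]
        by (intro mult_left_mono) (auto simp del: norm_ge_zero)
      finally show ?thesis using bound by simp
    qed
    moreover have "?W (Suc n) t holomorphic_on \<Omega>'" if "t \<in> {0..L}" for t
    proof -
      have "(\<lambda>z. integral {0..t} (\<lambda>s. g s (?W n s z))) holomorphic_on \<Omega>'"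
      proof (rule holomorphic_on_integral_param[OF \<Omega>'(1)])
        show "continuous_on (\<Omega>' \<times> {0..t}) (\<lambda>(z, s). g s (?W n s z))"
          unfolding split_beta
          by (rule continuous_on_compose2[OF c1[unfolded split_beta], of _ "\<lambda>p. (snd p, fst p)", simplified])
             (use that in \<open>auto intro!: continuous_intros\<close>)
        show "(\<lambda>z. g s (?W n s z)) holomorphic_on \<Omega>'" if "s \<in> {0..t}" for s
        proof -
          have s: "s \<in> {0..L}" using that \<open>t \<in> {0..L}\<close> by auto
          have "g s \<circ> ?W n s holomorphic_on \<Omega>'"
            by (rule holomorphic_on_compose_gen[OF _ hol[OF s]]) (use Suc s mem in auto)
          then show ?thesis by (simp add: o_def)
        qed
      qed
      then have "(\<lambda>z. ?W (Suc n) t z) holomorphic_on \<Omega>'"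
        unfolding picard.simps by (intro holomorphic_intros)
      then show ?thesis .
    qed
    ultimately show ?case by blast
  qed
  have mem: "?W n t z \<in> \<Omega>" if "t \<in> {0..L}" "z \<in> \<Omega>'" for n t z
    using inv[of n] \<Omega>'(2)[of z] that by (auto simp: dist_norm norm_minus_commute subset_iff)
  have contW: "continuous_on {0..L} (\<lambda>s. g s (?W n s z))" if "z \<in> \<Omega>'" for n z
  proof -
    have "continuous_on {0..L} (\<lambda>s. ?W n s z)"
      using continuous_on_slice2[of "{0..L}" \<Omega>' "?W n" z] inv[of n] that by auto
    then show ?thesis
      by (intro continuous_on_compose2[OF cont[unfolded split_beta], of _ "\<lambda>s. (s, ?W n s z)", simplified])
         (use that mem in \<open>auto intro!: continuous_intros\<close>)
  qed
  \<comment> \<open>The first difference is at most \<eta> by the confinement above, and each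
    further integration gains the factor \<open>C * t \<le> 1 / 2\<close>.\<close>
  have step: "norm (?W (Suc n) t z - ?W n t z) \<le> \<eta> * (1 / 2) ^ n" if "t \<in> {0..L}" "z \<in> \<Omega>'" for n t z
    using that(1)
  proof (induction n arbitrary: t)
    case 0
    show ?case using inv[of 1] 0 that by (simp del: picard.simps(2))
  next
    case (Suc n)
    have i: "(\<lambda>s. g s (?W m s z)) integrable_on {0..t}" for m
      using Suc.prems that(2)
      by (intro integrable_continuous_real continuous_on_subset[OF contW]) auto
    have "?W (Suc (Suc n)) t z - ?W (Suc n) t z =
        integral {0..t} (\<lambda>s. g s (?W (Suc n) s z)) - integral {0..t} (\<lambda>s. g s (?W n s z))"
      by (metis add_diff_cancel_left picard.simps(2))
    also have "\<dots> = integral {0..t} (\<lambda>s. g s (?W (Suc n) s z) - g s (?W n s z))"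
      by (rule integral_diff[symmetric]) (rule i)+
    also have "norm \<dots> \<le> (C * (\<eta> * (1 / 2) ^ n)) * (t - 0)"
    proof (rule integral_bound)
      show "continuous_on {0..t} (\<lambda>s. g s (?W (Suc n) s z) - g s (?W n s z))"
        using Suc.prems that(2)
        by (intro continuous_on_diff continuous_on_subset[OF contW]) auto
      fix s assume s: "s \<in> {0..t}"
      then have s': "s \<in> {0..L}" using Suc.prems by auto
      have "norm (g s (?W (Suc n) s z) - g s (?W n s z)) \<le> C * norm (?W (Suc n) s z - ?W n s z)"
        using lip(1)[OF s' mem mem] s' that by blast
      also have "\<dots> \<le> C * (\<eta> * (1 / 2) ^ n)"
        using Suc.IH[OF s'] lip by (intro mult_left_mono) auto
      finally show "norm (g s (?W (Suc n) s z) - g s (?W n s z)) \<le> C * (\<eta> * (1 / 2) ^ n)" .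
    qed (use Suc in auto)
    also have "\<dots> = (C * t) * (\<eta> * (1 / 2) ^ n)" by simp
    also have "\<dots> \<le> (1 / 2) * (\<eta> * (1 / 2) ^ n)"
    proof (rule mult_right_mono)
      show "C * t \<le> 1 / 2" using lip Suc.prems mult_left_mono[of t L C] by auto
    qed (use L in auto)
    finally show ?case by simp
  qed
  \<comment> \<open>The telescoping series is taken as a function of the pair, so that the M-test
    gives uniform convergence on the whole product, and with it joint continuity and the passage to
    the limit under the integral.\<close>
  define V where "V = (\<lambda>p::real \<times> complex. snd p + (\<Sum>n. ?W (Suc n) (fst p) (snd p) - ?W n (fst p) (snd p)))"
  have ul: "uniform_limit ?P (\<lambda>n p. ?W n (fst p) (snd p)) V sequentially"
  proof -
    have "uniform_limit ?P (\<lambda>n p. \<Sum>i<n. ?W (Suc i) (fst p) (snd p) - ?W i (fst p) (snd p))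
        (\<lambda>p. \<Sum>i. ?W (Suc i) (fst p) (snd p) - ?W i (fst p) (snd p)) sequentially"
      by (rule Weierstrass_m_test[where M = "\<lambda>n. \<eta> * (1 / 2) ^ n"])
         (use step in \<open>auto intro!: summable_mult summable_geometric simp del: picard.simps\<close>)
    then have "uniform_limit ?P (\<lambda>n p. snd p + (\<Sum>i<n. ?W (Suc i) (fst p) (snd p) - ?W i (fst p) (snd p))) V sequentially"
      unfolding V_def by (intro uniform_limit_add uniform_limit_const)
    moreover have "snd p + (\<Sum>i<n. ?W (Suc i) (fst p) (snd p) - ?W i (fst p) (snd p)) = ?W n (fst p) (snd p)" for n p
      by (subst sum_lessThan_telescope) simp
    ultimately show ?thesis by simp
  qed
  define U where "U = (\<lambda>t z. V (t, z))"
  have conv: "(\<lambda>n. ?W n t z) \<longlonglongrightarrow> U t z" if "t \<in> {0..L}" "z \<in> \<Omega>'" for t z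
    using tendsto_uniform_limitI[OF ul, of "(t, z)"] that by (simp add: U_def)
  have near: "norm (U t z - z) \<le> \<eta>" if "t \<in> {0..L}" "z \<in> \<Omega>'" for t z
    by (rule tendsto_upperbound[OF tendsto_norm[OF tendsto_diff[OF conv[OF that] tendsto_const]]])
       (use inv that in auto)
  have memU: "U t z \<in> \<Omega>" if "t \<in> {0..L}" "z \<in> \<Omega>'" for t z
    using near[of t z] \<Omega>'(2)[of z] that by (auto simp: dist_norm norm_minus_commute subset_iff)
  have "continuous_on ?P V"
    by (rule uniform_limit_theorem[OF _ ul]) (use inv in \<open>auto simp: split_beta\<close>)
  then have contU: "continuous_on ?P (\<lambda>(t, z). U t z)" by (simp add: U_def split_beta)
  have ulz: "uniform_limit {0..L} (\<lambda>n t. ?W n t z) (\<lambda>t. U t z) sequentially" if "z \<in> \<Omega>'" for z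
  proof (rule uniform_limitI)
    fix e :: real assume "e > 0"
    from uniform_limitD[OF ul this] show "\<forall>\<^sub>F n in sequentially. \<forall>t\<in>{0..L}. dist (?W n t z) (U t z) < e"
      by eventually_elim (use that in \<open>auto simp: U_def\<close>)
  qed
  have contgU: "continuous_on {0..L} (\<lambda>s. g s (U s z))" if "z \<in> \<Omega>'" for z
    by (rule continuous_on_compose2[OF cont[unfolded split_beta], of _ "\<lambda>s. (s, U s z)", simplified])
       (use that memU in \<open>auto intro!: continuous_intros continuous_on_slice2[OF contU]\<close>)
  have inteq: "U t z = z + integral {0..t} (\<lambda>s. g s (U s z))" if t: "t \<in> {0..L}" and z: "z \<in> \<Omega>'" for t z
  proof (rule LIMSEQ_unique)
    show "(\<lambda>n. ?W (Suc n) t z) \<longlonglongrightarrow> U t z" using conv[OF that] by (rule LIMSEQ_Suc)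
    have "uniform_limit {0..t} (\<lambda>n s. g s (?W n s z)) (\<lambda>s. g s (U s z)) sequentially"
    proof (rule uniform_limitI)
      fix e :: real assume e: "e > 0"
      \<comment> \<open>\<open>C + 1\<close> instead of \<open>C\<close>, because the Lipschitz
        constant may be 0.\<close>
      then have "e / (C + 1) > 0" using lip(3) by simp
      from uniform_limitD[OF ulz[OF z] this]
      show "\<forall>\<^sub>F n in sequentially. \<forall>s\<in>{0..t}. dist (g s (?W n s z)) (g s (U s z)) < e"
      proof eventually_elim
        case (elim n)
        show ?case
        proof
          fix s assume "s \<in> {0..t}"
          then have s: "s \<in> {0..L}" using t by auto
          have "dist (g s (?W n s z)) (g s (U s z)) \<le> C * norm (?W n s z - U s z)"
            using lip(1)[OF s mem memU] s z by (simp add: dist_norm)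
          also have "\<dots> \<le> C * (e / (C + 1))"
            using elim[rule_format, OF s] lip(3) by (intro mult_left_mono) (auto simp: dist_norm)
          also have "\<dots> < e" using e lip(3) by (simp add: field_simps)
          finally show "dist (g s (?W n s z)) (g s (U s z)) < e" .
        qed
      qed
    qed
    then obtain I J where IJ: "\<And>n. ((\<lambda>s. g s (?W n s z)) has_integral I n) {0..t}"
      "((\<lambda>s. g s (U s z)) has_integral J) {0..t}" "I \<longlonglongrightarrow> J"
      by (rule uniform_limit_integral)
         (use t z in \<open>auto intro: continuous_on_subset[OF contW]\<close>)
    have "(\<lambda>n. z + I n) \<longlonglongrightarrow> z + J" by (intro tendsto_intros IJ)
    then show "(\<lambda>n. ?W (Suc n) t z) \<longlonglongrightarrow> z + integral {0..t} (\<lambda>s. g s (U s z))"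
      using integral_unique[OF IJ(1)] integral_unique[OF IJ(2)] by simp
  qed
  show ?thesis
  proof
    show "U 0 z = z" if "z \<in> \<Omega>'" for z using inteq[of 0 z] that L by auto
    show "norm (U t z - z) \<le> \<eta>" if "t \<in> {0..L}" "z \<in> \<Omega>'" for t z by (rule near[OF that])
    show "((\<lambda>t. U t z) has_vector_derivative g t (U t z)) (at t within {0..L})"
      if "t \<in> {0..L}" "z \<in> \<Omega>'" for t z
    proof -
      have "((\<lambda>t. z + integral {0..t} (\<lambda>s. g s (U s z))) has_vector_derivative 0 + g t (U t z)) (at t within {0..L})"
        by (intro has_vector_derivative_add has_vector_derivative_const
            integral_has_vector_derivative contgU that)
      then have *: "((\<lambda>t. z + integral {0..t} (\<lambda>s. g s (U s z))) has_vector_derivative g t (U t z)) (at t within {0..L})"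
        by (simp only: add_0_left)
      show ?thesis
        by (rule has_vector_derivative_transform[OF that(1) _ *]) (use that(2) inteq in blast)
    qed
    show "U t holomorphic_on \<Omega>'" if t: "t \<in> {0..L}" for t
    proof (rule holomorphic_uniform_sequence[OF \<Omega>'(1), of "\<lambda>n. ?W n t"])
      show "?W n t holomorphic_on \<Omega>'" for n using inv t by blast
      fix x assume "x \<in> \<Omega>'"
      then obtain r where r: "r > 0" "cball x r \<subseteq> \<Omega>'" using \<Omega>'(1) open_contains_cball by blast
      have "uniform_limit (cball x r) (\<lambda>n. ?W n t) (U t) sequentially"
      proof (rule uniform_limitI)
        fix e :: real assume "e > 0"
        from uniform_limitD[OF ul this] show "\<forall>\<^sub>F n in sequentially. \<forall>z\<in>cball x r. dist (?W n t z) (U t z) < e"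
          by eventually_elim (use t r in \<open>auto simp: U_def subset_iff\<close>)
      qed
      then show "\<exists>d>0. cball x d \<subseteq> \<Omega>' \<and> uniform_limit (cball x d) (\<lambda>n. ?W n t) (U t) sequentially"
        using r by blast
    qed
    show "U t (of_real u) \<in> \<real>" if t: "t \<in> {0..L}" and u: "of_real u \<in> \<Omega>'" for t u
    proof -
      \<comment> \<open>Since \<open>g\<close> is real on the real axis, a real initial value has
        real iterates, and the limit is real because the real axis is closed.\<close>
      have re: "?W n s (of_real u) \<in> \<real>" if "s \<in> {0..L}" for n s
        using that
      proof (induction n arbitrary: s)
        case (Suc n)
        have "integral {0..s} (\<lambda>r. g r (?W n r (of_real u))) \<in> \<real>"
        proof -
          have "g r (?W n r (of_real u)) = of_real (Re (g r (?W n r (of_real u))))" if "r \<in> {0..s}" for r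
          proof -
            have r: "r \<in> {0..L}" using that Suc.prems by auto
            obtain v where v: "?W n r (of_real u) = of_real v" using Suc.IH[OF r] by (auto elim: Reals_cases)
            have "g r (?W n r (of_real u)) \<in> \<real>"
              using real[OF r, of v] mem[OF r u, of n] unfolding v by simp
            then show ?thesis by simp
          qed
          then have "integral {0..s} (\<lambda>r. g r (?W n r (of_real u)))
              = integral {0..s} (\<lambda>r. of_real (Re (g r (?W n r (of_real u)))))"
            by (intro integral_cong) auto
          also have "\<dots> = of_real (integral {0..s} (\<lambda>r. Re (g r (?W n r (of_real u)))))"
          proof -
            have "continuous_on {0..s} (\<lambda>r. g r (?W n r (of_real u)))"
              by (rule continuous_on_subset[OF contW[OF u]]) (use Suc.prems in auto)
            then have "(\<lambda>r. Re (g r (?W n r (of_real u)))) integrable_on {0..s}"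
              by (intro integrable_continuous_real continuous_intros)
            from integral_linear[OF this bounded_linear_of_real] show ?thesis by (simp add: o_def)
          qed
          finally show ?thesis by simp
        qed
        then show ?case by simp
      qed auto
      show ?thesis
        by (rule Lim_in_closed_set[OF closed_complex_Reals _ _ conv[OF t u]]) (use re t in auto)
    qed
  qed
qed

text \<open>Cauchy's estimate bounds the derivative by \<open>B / r\<close> at the points that keep
  distance \<open>r\<close> inside \<open>T\<close>; convexity of \<open>S\<close> turns this into a
  Lipschitz bound.\<close>

lemma lipschitz_of_bounded_holomorphic:
  fixes h :: "complex \<Rightarrow> complex"
  assumes h: "h holomorphic_on T" "\<And>z. z \<in> T \<Longrightarrow> norm (h z) \<le> B"
    and S: "convex S" "r > 0" "\<And>z. z \<in> S \<Longrightarrow> cball z r \<subseteq> T"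
    and zw: "z \<in> S" "w \<in> S"
  shows "norm (h z - h w) \<le> B / r * norm (z - w)"
proof (rule field_differentiable_bound[OF S(1) _ _ zw])
  fix u assume u: "u \<in> S"
  have b: "ball u r \<subseteq> T" using S(3)[OF u] ball_subset_cball by blast
  have "(h has_field_derivative deriv h u) (at u)"
    by (rule holomorphic_derivI[OF holomorphic_on_subset[OF h(1) b]]) (use S in auto)
  then show "(h has_field_derivative deriv h u) (at u within S)"
    by (rule has_field_derivative_at_within)
  have "norm ((deriv ^^ 1) h u) \<le> fact 1 * B / r ^ 1"
  proof (rule Cauchy_inequality)
    show "norm (h x) \<le> B" if "norm (u - x) = r" for x
      using S(3)[OF u] that h(2)[of x] by (auto simp: dist_norm subset_iff)
    show "continuous_on (cball u r) h"
      using holomorphic_on_imp_continuous_on[OF h(1)] S(3)[OF u] by (rule continuous_on_subset)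
    show "h holomorphic_on ball u r" using h(1) b by (rule holomorphic_on_subset)
  qed (use S in auto)
  then show "norm (deriv h u) \<le> B / r" by simp
qed

text \<open>Generic in the scalar field, so that the real equation and its complex extension are
  given by the same formula; exponents may repeat, as they do when the index is a monomial.\<close>

definition exp_comb :: "'i set \<Rightarrow> ('i \<Rightarrow> real) \<Rightarrow> ('i \<Rightarrow> real) \<Rightarrow> 'a::{real_normed_field,banach} \<Rightarrow> 'a" where
  "exp_comb I e c z = (\<Sum>i\<in>I. of_real (c i) * exp (of_real (e i) * z))"

lemma exp_comb_of_real: "exp_comb I e c (of_real u) = (of_real (exp_comb I e c u) :: complex)"
  by (simp add: exp_comb_def flip: exp_of_real)

lemma holomorphic_exp_comb [holomorphic_intros]: "exp_comb I e c holomorphic_on S"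
  unfolding exp_comb_def by (intro holomorphic_intros)

lemma norm_exp_comb_le:
  fixes z :: complex
  assumes "\<And>i. i \<in> I \<Longrightarrow> \<bar>c i\<bar> \<le> b i" "\<bar>Re z\<bar> \<le> R"
  shows "norm (exp_comb I e c z) \<le> (\<Sum>i\<in>I. b i * exp (\<bar>e i\<bar> * R))"
  unfolding exp_comb_def
proof (rule sum_norm_le)
  fix i assume i: "i \<in> I"
  have "e i * Re z \<le> \<bar>e i\<bar> * \<bar>Re z\<bar>" by (metis abs_ge_self abs_mult)
  also have "\<dots> \<le> \<bar>e i\<bar> * R" using assms by (intro mult_left_mono) auto
  finally have "\<bar>c i\<bar> * exp (e i * Re z) \<le> b i * exp (\<bar>e i\<bar> * R)"
    using assms(1)[OF i] by (intro mult_mono) auto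
  then show "norm (of_real (c i) * exp (of_real (e i) * z)) \<le> b i * exp (\<bar>e i\<bar> * R)"
    by (simp add: norm_mult)
qed

lemma exp_comb_diff: "exp_comb I e c z - exp_comb I e c' z = exp_comb I e (\<lambda>i. c i - c' i) z"
  by (simp add: exp_comb_def algebra_simps flip: sum_subtractf)

text \<open>A solution of an equation of order \<epsilon> moves by O(\<epsilon>), so to first order
  its displacement is \<epsilon> times the integral of the numerator with the state frozen at its
  initial value, the coefficients taken at \<epsilon> = 0 and the denominator replaced by 1.
  \<open>Z\<close> is the displacement divided by \<epsilon>. The conclusion keeps both faces:
  \<open>Z\<close> holomorphic on a complex neighbourhood for counting zeros, and \<open>V\<close> a
  real solution for identifying the return map.\<close>

lemma perturbed_exponential_flow:
  fixes e :: "'i \<Rightarrow> real" and c p q :: "'i \<Rightarrow> real \<Rightarrow> real"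
  assumes I: "finite I" and L: "L \<ge> 0"
    and c: "\<And>i. i \<in> I \<Longrightarrow> isCont (c i) 0"
    and p: "\<And>i. i \<in> I \<Longrightarrow> continuous_on {0..L} (p i)"
    and q: "\<And>i. i \<in> I \<Longrightarrow> continuous_on {0..L} (q i)"
  defines "den \<equiv> \<lambda>\<epsilon> t u. 1 + \<epsilon> * exp_comb I e (\<lambda>i. c i \<epsilon> * q i t) u"
  shows "\<exists>S Z. open S \<and> complex_of_real ` {a..b} \<subseteq> S \<and>
    (\<forall>\<^sub>F \<epsilon> in at 0. Z \<epsilon> holomorphic_on S) \<and>
    uniform_limit S Z (exp_comb I e (\<lambda>i. c i 0 * integral {0..L} (p i))) (at 0) \<and>
    (\<forall>\<^sub>F \<epsilon> in at 0. \<forall>u\<in>{a..b}. \<exists>V. V 0 = u \<and> V L = u + \<epsilon> * Re (Z \<epsilon> (of_real u)) \<and>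
       (\<forall>t\<in>{0..L}. den \<epsilon> t (V t) > 0 \<and>
          (V has_real_derivative \<epsilon> * exp_comb I e (\<lambda>i. c i \<epsilon> * p i t) (V t) / den \<epsilon> t (V t))
            (at t within {0..L})))"
proof -
  \<comment> \<open>Nested rectangles around \<open>{a..b}\<close>: initial values range over
    \<open>R 1\<close>, solutions stay in \<open>R 2\<close>, and the bounds are taken on
    \<open>R 3\<close>, which leaves room for Cauchy's estimate with radius 1/2 on
    \<open>R 2\<close>.\<close>
  define R where "R = (\<lambda>k. {z. a - k < Re z \<and> Re z < b + k \<and> - k < Im z \<and> Im z < k})"
  have openR: "open (R k)" for k
    unfolding R_def by (intro open_Collect_conj open_Collect_less continuous_intros)
  have convR: "convex (R k)" for k
  proof -
    have "R k = {z. Re z > a - k} \<inter> {z. Re z < b + k} \<inter> {z. Im z > - k} \<inter> {z. Im z < k}"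
      by (auto simp: R_def)
    then show ?thesis
      by (auto intro!: convex_Int convex_halfspace_Re_gt convex_halfspace_Re_lt convex_halfspace_Im_gt convex_halfspace_Im_lt)
  qed
  have ballR: "cball z r \<subseteq> R (k + 1)" if "z \<in> R k" "r \<le> 1 / 2" for z k r
  proof
    fix w assume "w \<in> cball z r"
    then have "\<bar>Re (z - w)\<bar> \<le> 1 / 2" "\<bar>Im (z - w)\<bar> \<le> 1 / 2"
      using abs_Re_le_cmod[of "z - w"] abs_Im_le_cmod[of "z - w"] that(2) by (auto simp: dist_norm)
    then show "w \<in> R (k + 1)" using that(1) unfolding R_def abs_le_iff by simp
  qed
  define r where "r = \<bar>a\<bar> + \<bar>b\<bar> + 3"
  have reR: "\<bar>Re z\<bar> \<le> r" if "z \<in> R 3" for z using that by (auto simp: R_def r_def)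
  have R23: "z \<in> R 3" if "z \<in> R 2" for z using that by (auto simp: R_def)
  have R12: "z \<in> R 2" if "z \<in> R 1" for z using that by (auto simp: R_def)
  have bnd: "\<exists>m. \<forall>t\<in>{0..L}. \<bar>f t\<bar> \<le> m" if "continuous_on {0..L} f" for f :: "real \<Rightarrow> real"
    using compact_imp_bounded[OF compact_continuous_image[OF that compact_Icc]]
    by (auto simp: bounded_iff)
  obtain m where m: "\<And>i t. i \<in> I \<Longrightarrow> t \<in> {0..L} \<Longrightarrow> \<bar>p i t\<bar> \<le> m i"
    using bnd[OF p] by metis
  obtain n where n: "\<And>i t. i \<in> I \<Longrightarrow> t \<in> {0..L} \<Longrightarrow> \<bar>q i t\<bar> \<le> n i"
    using bnd[OF q] by metis
  have mn0: "m i \<ge> 0" "n i \<ge> 0" if "i \<in> I" for i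
    using m[OF that, of 0] n[OF that, of 0] L by auto
  define N where "N = (\<lambda>\<epsilon> t z. exp_comb I e (\<lambda>i. c i \<epsilon> * p i t) z :: complex)"
  define N2 where "N2 = (\<lambda>\<epsilon> t z. exp_comb I e (\<lambda>i. c i \<epsilon> * q i t) z :: complex)"
  \<comment> \<open>One bound on \<open>R 3\<close> for both numerator and denominator sums, valid
    as long as each coefficient stays within 1 of its modulus at \<epsilon> = 0; the modulus of an
    exponential involves the real part of \<open>z\<close> only, at most \<open>r\<close>
    there.\<close>
  define K where "K = (\<Sum>i\<in>I. (\<bar>c i 0\<bar> + 1) * m i * exp (\<bar>e i\<bar> * r)) + (\<Sum>i\<in>I. (\<bar>c i 0\<bar> + 1) * n i * exp (\<bar>e i\<bar> * r))"
  have K0: "K \<ge> 0" unfolding K_def by (intro add_nonneg_nonneg sum_nonneg mult_nonneg_nonneg) (auto simp: mn0)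
  define cb where "cb = (\<lambda>\<epsilon>. \<forall>i\<in>I. \<bar>c i \<epsilon>\<bar> \<le> \<bar>c i 0\<bar> + 1)"
  have NK: "norm (N \<epsilon> t z) \<le> K" "norm (N2 \<epsilon> t z) \<le> K" if "cb \<epsilon>" "t \<in> {0..L}" "z \<in> R 3" for \<epsilon> t z
  proof -
    have "norm (N \<epsilon> t z) \<le> (\<Sum>i\<in>I. (\<bar>c i 0\<bar> + 1) * m i * exp (\<bar>e i\<bar> * r))"
      unfolding N_def using that m mn0 by (intro norm_exp_comb_le reR) (auto simp: abs_mult cb_def intro!: mult_mono)
    moreover have "norm (N2 \<epsilon> t z) \<le> (\<Sum>i\<in>I. (\<bar>c i 0\<bar> + 1) * n i * exp (\<bar>e i\<bar> * r))"
      unfolding N2_def using that n mn0 by (intro norm_exp_comb_le reR) (auto simp: abs_mult cb_def intro!: mult_mono)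
    moreover have "0 \<le> (\<Sum>i\<in>I. (\<bar>c i 0\<bar> + 1) * m i * exp (\<bar>e i\<bar> * r))" "0 \<le> (\<Sum>i\<in>I. (\<bar>c i 0\<bar> + 1) * n i * exp (\<bar>e i\<bar> * r))"
      by (auto intro!: sum_nonneg mult_nonneg_nonneg simp: mn0)
    ultimately show "norm (N \<epsilon> t z) \<le> K" "norm (N2 \<epsilon> t z) \<le> K" by (auto simp: K_def)
  qed
  \<comment> \<open>\<open>\<bar>\<epsilon>\<bar> * K \<le> 1 / 2\<close> keeps the denominator at
    modulus at least 1/2, so \<open>G\<close> is bounded by \<open>2 * K\<close> and, by Cauchy with
    radius 1/2, has Lipschitz constant \<open>4 * K\<close>. The next condition is the contraction
    condition of the flow; it also bounds the displacement by 1/2, the margin between rectangles.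
    Finally \<epsilon> \<noteq> 0 allows the division in \<open>Z\<close>.\<close>
  define good where "good = (\<lambda>\<epsilon>. cb \<epsilon> \<and> \<bar>\<epsilon>\<bar> * K \<le> 1 / 2 \<and> 4 * \<bar>\<epsilon>\<bar> * K * L \<le> 1 / 2 \<and> \<epsilon> \<noteq> 0)"
  have ev_good: "\<forall>\<^sub>F \<epsilon> in at 0. good \<epsilon>"
  proof -
    have "\<forall>\<^sub>F \<epsilon> in at 0. \<bar>c i \<epsilon>\<bar> \<le> \<bar>c i 0\<bar> + 1" if "i \<in> I" for i
    proof -
      have "((\<lambda>\<epsilon>. \<bar>c i \<epsilon>\<bar>) \<longlongrightarrow> \<bar>c i 0\<bar>) (at 0)" using c[OF that] by (intro tendsto_intros) (simp add: isCont_def)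
      then have "\<forall>\<^sub>F \<epsilon> in at 0. \<bar>c i \<epsilon>\<bar> < \<bar>c i 0\<bar> + 1" by (rule order_tendstoD) simp
      then show ?thesis by eventually_elim simp
    qed
    then have 1: "\<forall>\<^sub>F \<epsilon> in at 0. cb \<epsilon>" unfolding cb_def using I by (simp add: eventually_ball_finite_distrib)
    have "((\<lambda>\<epsilon>::real. \<bar>\<epsilon>\<bar> * K) \<longlongrightarrow> \<bar>0\<bar> * K) (at 0)" by (intro tendsto_intros)
    then have 2: "\<forall>\<^sub>F \<epsilon> in at (0::real). \<bar>\<epsilon>\<bar> * K < 1 / 2" by (rule order_tendstoD) simp
    have "((\<lambda>\<epsilon>::real. 4 * \<bar>\<epsilon>\<bar> * K * L) \<longlongrightarrow> 4 * \<bar>0\<bar> * K * L) (at 0)" by (intro tendsto_intros)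
    then have 3: "\<forall>\<^sub>F \<epsilon> in at (0::real). 4 * \<bar>\<epsilon>\<bar> * K * L < 1 / 2" by (rule order_tendstoD) simp
    have 4: "\<forall>\<^sub>F \<epsilon> in at (0::real). \<epsilon> \<noteq> 0" by (simp add: eventually_at_filter)
    from 1 2 3 4 show ?thesis unfolding good_def by eventually_elim auto
  qed
  define G where "G = (\<lambda>\<epsilon> t z. N \<epsilon> t z / (1 + of_real \<epsilon> * N2 \<epsilon> t z))"
  have den_ge: "norm (1 + of_real \<epsilon> * N2 \<epsilon> t z) \<ge> 1 / 2" "norm (of_real \<epsilon> * N2 \<epsilon> t z) \<le> \<bar>\<epsilon>\<bar> * K"
    if "good \<epsilon>" "t \<in> {0..L}" "z \<in> R 3" for \<epsilon> t z
  proof -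
    show 1: "norm (of_real \<epsilon> * N2 \<epsilon> t z) \<le> \<bar>\<epsilon>\<bar> * K"
      unfolding norm_mult using NK(2)[of \<epsilon> t z] that by (auto simp: good_def intro!: mult_left_mono)
    have "norm (1::complex) \<le> norm (1 + of_real \<epsilon> * N2 \<epsilon> t z) + norm (of_real \<epsilon> * N2 \<epsilon> t z)"
      using norm_triangle_ineq4[of "1 + of_real \<epsilon> * N2 \<epsilon> t z" "of_real \<epsilon> * N2 \<epsilon> t z"] by simp
    then show "norm (1 + of_real \<epsilon> * N2 \<epsilon> t z) \<ge> 1 / 2" using 1 that by (auto simp: good_def)
  qed
  have GK: "norm (G \<epsilon> t z) \<le> 2 * K" and GN: "norm (G \<epsilon> t z - N \<epsilon> t z) \<le> 2 * \<bar>\<epsilon>\<bar> * K\<^sup>2"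
    if "good \<epsilon>" "t \<in> {0..L}" "z \<in> R 3" for \<epsilon> t z
  proof -
    have N: "norm (N \<epsilon> t z) \<le> K" using NK that by (auto simp: good_def)
    have "norm (G \<epsilon> t z) \<le> K / (1 / 2)"
      unfolding G_def norm_divide by (rule frac_le) (use N K0 den_ge(1)[OF that] in auto)
    then show 1: "norm (G \<epsilon> t z) \<le> 2 * K" by simp
    have nz: "1 + of_real \<epsilon> * N2 \<epsilon> t z \<noteq> 0" using den_ge(1)[OF that] by auto
    have "G \<epsilon> t z - N \<epsilon> t z = - (of_real \<epsilon> * N2 \<epsilon> t z) * G \<epsilon> t z"
      using nz by (simp add: G_def field_simps)
    also have "norm \<dots> \<le> (\<bar>\<epsilon>\<bar> * K) * (2 * K)"
      unfolding norm_mult[of "- _"] norm_minus_cancel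
      by (rule mult_mono) (use 1 K0 den_ge(2)[OF that] in auto)
    finally show "norm (G \<epsilon> t z - N \<epsilon> t z) \<le> 2 * \<bar>\<epsilon>\<bar> * K\<^sup>2" by (simp add: power2_eq_square mult_ac)
  qed
  have holN: "N \<epsilon> t holomorphic_on T" "N2 \<epsilon> t holomorphic_on T" for \<epsilon> t T
    unfolding N_def N2_def by (auto intro: holomorphic_intros)
  have holG: "G \<epsilon> t holomorphic_on R 3" if "good \<epsilon>" "t \<in> {0..L}" for \<epsilon> t
    unfolding G_def using den_ge(1)[OF that] by (intro holomorphic_intros holN) force
  have contN: "continuous_on ({0..L} \<times> UNIV) (\<lambda>p. N \<epsilon> (fst p) (snd p))"
    "continuous_on ({0..L} \<times> UNIV) (\<lambda>p. N2 \<epsilon> (fst p) (snd p))" for \<epsilon>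
    unfolding N_def N2_def exp_comb_def
    by (auto intro!: continuous_intros continuous_on_compose2[OF p] continuous_on_compose2[OF q])
  define flow where "flow = (\<lambda>\<epsilon> U. (\<forall>z\<in>R 1. U 0 z = z) \<and>
    (\<forall>t\<in>{0..L}. \<forall>z\<in>R 1. norm (U t z - z) \<le> 2 * \<bar>\<epsilon>\<bar> * K * L) \<and>
    (\<forall>t\<in>{0..L}. \<forall>z\<in>R 1. ((\<lambda>t. U t z) has_vector_derivative of_real \<epsilon> * G \<epsilon> t (U t z)) (at t within {0..L})) \<and>
    (\<forall>t\<in>{0..L}. U t holomorphic_on R 1) \<and>
    (\<forall>t\<in>{0..L}. \<forall>u. of_real u \<in> R 1 \<longrightarrow> U t (of_real u) \<in> \<real>))"
  have ex_flow: "\<exists>U. flow \<epsilon> U" if g: "good \<epsilon>" for \<epsilon>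
  proof -
    have small: "2 * \<bar>\<epsilon>\<bar> * K * L \<le> 1 / 2" "4 * \<bar>\<epsilon>\<bar> * K * L \<le> 1 / 2" using g K0 L by (auto simp: good_def)
    show ?thesis
    proof (rule holomorphic_flow[OF L _ openR[of 1], of "2 * \<bar>\<epsilon>\<bar> * K * L" "R 2" "\<lambda>t z. of_real \<epsilon> * G \<epsilon> t z" "2 * \<bar>\<epsilon>\<bar> * K" "4 * \<bar>\<epsilon>\<bar> * K"])
      show "cball z (2 * \<bar>\<epsilon>\<bar> * K * L) \<subseteq> R 2" if "z \<in> R 1" for z
        using ballR[OF that small(1)] by simp
      have "continuous_on ({0..L} \<times> R 2) (\<lambda>p. of_real \<epsilon> * G \<epsilon> (fst p) (snd p))"
        unfolding G_def using den_ge(1)[OF g] R23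
        by (intro continuous_intros continuous_on_subset[OF contN(1)] continuous_on_subset[OF contN(2)]) force+
      then show "continuous_on ({0..L} \<times> R 2) (\<lambda>(t, z). of_real \<epsilon> * G \<epsilon> t z)" by (simp add: split_beta)
      show "(\<lambda>z. of_real \<epsilon> * G \<epsilon> t z) holomorphic_on R 2" if "t \<in> {0..L}" for t
        using R23 by (intro holomorphic_intros holomorphic_on_subset[OF holG[OF g that]]) auto
      show b: "norm (of_real \<epsilon> * G \<epsilon> t z) \<le> 2 * \<bar>\<epsilon>\<bar> * K" if "t \<in> {0..L}" "z \<in> R 2" for t z
        using mult_left_mono[OF GK[OF g that(1) R23[OF that(2)]], of "\<bar>\<epsilon>\<bar>"] by (simp add: norm_mult mult_ac)
      show "norm (of_real \<epsilon> * G \<epsilon> t z - of_real \<epsilon> * G \<epsilon> t w) \<le> 4 * \<bar>\<epsilon>\<bar> * K * norm (z - w)"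
        if "t \<in> {0..L}" "z \<in> R 2" "w \<in> R 2" for t z w
      proof -
        have "norm (G \<epsilon> t z - G \<epsilon> t w) \<le> 2 * K / (1 / 2) * norm (z - w)"
          by (rule lipschitz_of_bounded_holomorphic[OF holG[OF g that(1)] _ convR[of 2] _ _ that(2,3)])
             (use GK[OF g that(1)] ballR[of _ 2 "1/2"] in auto)
        then have "\<bar>\<epsilon>\<bar> * norm (G \<epsilon> t z - G \<epsilon> t w) \<le> \<bar>\<epsilon>\<bar> * (2 * K / (1 / 2) * norm (z - w))"
          by (rule mult_left_mono) simp
        then show ?thesis by (simp add: norm_mult mult_ac flip: right_diff_distrib)
      qed
      show "of_real \<epsilon> * G \<epsilon> t (of_real u) \<in> \<real>" for t u
        unfolding G_def N_def N2_def exp_comb_of_real by (auto intro!: Reals_mult Reals_divide Reals_add)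
      show ?thesis if "\<And>z. z \<in> R 1 \<Longrightarrow> U 0 z = z"
       "\<And>t z. t \<in> {0..L} \<Longrightarrow> z \<in> R 1 \<Longrightarrow> norm (U t z - z) \<le> 2 * \<bar>\<epsilon>\<bar> * K * L"
       "\<And>t z. t \<in> {0..L} \<Longrightarrow> z \<in> R 1 \<Longrightarrow> ((\<lambda>t. U t z) has_vector_derivative of_real \<epsilon> * G \<epsilon> t (U t z)) (at t within {0..L})"
       "\<And>t. t \<in> {0..L} \<Longrightarrow> U t holomorphic_on R 1"
       "\<And>t u. t \<in> {0..L} \<Longrightarrow> of_real u \<in> R 1 \<Longrightarrow> U t (of_real u) \<in> \<real>" for U
        using that unfolding flow_def by (intro exI[of _ U]) blast
    qed (use small K0 L in auto)
  qed
  define U where "U = (\<lambda>\<epsilon>. SOME U. flow \<epsilon> U)"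
  have U: "flow \<epsilon> (U \<epsilon>)" if "good \<epsilon>" for \<epsilon> using someI_ex[OF ex_flow[OF that]] by (simp add: U_def)
  have memU: "U \<epsilon> t z \<in> R 2" if "good \<epsilon>" "t \<in> {0..L}" "z \<in> R 1" for \<epsilon> t z
  proof -
    have s: "2 * \<bar>\<epsilon>\<bar> * K * L \<le> 1 / 2" using that(1) K0 L by (auto simp: good_def)
    have "norm (U \<epsilon> t z - z) \<le> 2 * \<bar>\<epsilon>\<bar> * K * L"
      using U[OF that(1)] that(2,3) unfolding flow_def by blast
    then show ?thesis using ballR[OF that(3) s] by (auto simp: dist_norm norm_minus_commute)
  qed
  define Z where "Z = (\<lambda>\<epsilon> z. (U \<epsilon> L z - z) / of_real \<epsilon>)"
  define M where "M = (exp_comb I e (\<lambda>i. c i 0 * integral {0..L} (p i)) :: complex \<Rightarrow> complex)"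
  \<comment> \<open>Three errors: replacing the denominator by 1, replacing the coefficients by
    their values at \<epsilon> = 0, and freezing the state at \<open>z\<close>, where
    \<open>2 * K\<close> is the Lipschitz constant of \<open>N 0\<close> and the last factor is the
    largest displacement.\<close>
  define \<delta> where "\<delta> = (\<lambda>\<epsilon>. 2 * \<bar>\<epsilon>\<bar> * K\<^sup>2 + (\<Sum>i\<in>I. \<bar>c i \<epsilon> - c i 0\<bar> * m i * exp (\<bar>e i\<bar> * r))
      + 2 * K * (2 * \<bar>\<epsilon>\<bar> * K * L))"
  have cb0: "cb 0" by (simp add: cb_def)
  have near: "norm (Z \<epsilon> z - M z) \<le> \<delta> \<epsilon> * L" if g: "good \<epsilon>" and z: "z \<in> R 1" for \<epsilon> z
  proof -
    have e0: "\<epsilon> \<noteq> 0" using g by (simp add: good_def)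
    \<comment> \<open>The gap to the first-order prediction; its derivative is \<epsilon> times the
      difference that \<delta> bounds, so the bound survives the division by \<epsilon>.\<close>
    define h where "h = (\<lambda>t. U \<epsilon> t z - of_real \<epsilon> * integral {0..t} (\<lambda>s. N 0 s z))"
    have cont0: "continuous_on {0..L} (\<lambda>s. N 0 s z)"
      by (rule continuous_on_compose2[OF contN(1), of _ "\<lambda>s. (s, z)", simplified]) (auto intro!: continuous_intros)
    have dh: "(h has_vector_derivative of_real \<epsilon> * G \<epsilon> t (U \<epsilon> t z) - of_real \<epsilon> * N 0 t z) (at t within {0..L})"
      if t: "t \<in> {0..L}" for t
      unfolding h_def
      by (intro has_vector_derivative_diff has_vector_derivative_mult_right integral_has_vector_derivative cont0 t)
         (use U[OF g] t z in \<open>auto simp: flow_def\<close>)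
    have "norm (h L - h 0) \<le> (\<bar>\<epsilon>\<bar> * \<delta> \<epsilon>) * L"
    proof (rule norm_diff_le_of_vector_derivative[OF dh])
      fix t assume t: "t \<in> {0..L}"
      define w where "w = U \<epsilon> t z"
      have w: "w \<in> R 2" "w \<in> R 3" "z \<in> R 2" using memU[OF g t z] R12 R23 z by (auto simp: w_def)
      have "norm (N 0 t w - N 0 t z) \<le> K / (1 / 2) * norm (w - z)"
        by (rule lipschitz_of_bounded_holomorphic[OF holN(1) _ convR[of 2] _ _ w(1) w(3), where T = "R 3"])
           (use NK(1)[OF cb0 t] ballR[of _ 2 "1/2"] in auto)
      also have "\<dots> \<le> 2 * K * (2 * \<bar>\<epsilon>\<bar> * K * L)"
      proof -
        have "norm (w - z) \<le> 2 * \<bar>\<epsilon>\<bar> * K * L"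
          using U[OF g] t z unfolding flow_def w_def by blast
        from mult_left_mono[OF this, of "2 * K"] show ?thesis using K0 by simp
      qed
      finally have 3: "norm (N 0 t w - N 0 t z) \<le> 2 * K * (2 * \<bar>\<epsilon>\<bar> * K * L)" .
      have 2: "norm (N \<epsilon> t w - N 0 t w) \<le> (\<Sum>i\<in>I. \<bar>c i \<epsilon> - c i 0\<bar> * m i * exp (\<bar>e i\<bar> * r))"
        unfolding N_def exp_comb_diff
        by (rule norm_exp_comb_le[OF _ reR[OF w(2)]])
           (use m t in \<open>auto simp: abs_mult mn0 simp flip: left_diff_distrib intro!: mult_left_mono\<close>)
      have "norm (G \<epsilon> t w - N 0 t z) \<le> norm (G \<epsilon> t w - N \<epsilon> t w) + norm (N \<epsilon> t w - N 0 t w) + norm (N 0 t w - N 0 t z)"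
        using norm_triangle_ineq[of "(G \<epsilon> t w - N \<epsilon> t w) + (N \<epsilon> t w - N 0 t w)" "N 0 t w - N 0 t z"]
          norm_triangle_ineq[of "G \<epsilon> t w - N \<epsilon> t w" "N \<epsilon> t w - N 0 t w"] by simp
      then have "norm (G \<epsilon> t w - N 0 t z) \<le> \<delta> \<epsilon>"
        using GN[OF g t w(2)] 2 3 by (simp add: \<delta>_def)
      then have "\<bar>\<epsilon>\<bar> * norm (G \<epsilon> t w - N 0 t z) \<le> \<bar>\<epsilon>\<bar> * \<delta> \<epsilon>" by (intro mult_left_mono) auto
      then show "norm (of_real \<epsilon> * G \<epsilon> t (U \<epsilon> t z) - of_real \<epsilon> * N 0 t z) \<le> \<bar>\<epsilon>\<bar> * \<delta> \<epsilon>"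
        unfolding w_def by (simp add: norm_mult flip: right_diff_distrib)
    qed (use L in auto)
    moreover have "integral {0..L} (\<lambda>s. N 0 s z) = M z"
    proof -
      have ii: "(\<lambda>s. complex_of_real (c i 0 * p i s)) integrable_on {0..L}" if "i \<in> I" for i
        using p[OF that] by (intro integrable_continuous_real continuous_intros)
      have "integral {0..L} (\<lambda>s. of_real (c i 0 * p i s) * exp (of_real (e i) * z))
          = of_real (c i 0 * integral {0..L} (p i)) * exp (of_real (e i) * z)" if i: "i \<in> I" for i
      proof -
        have "p i integrable_on {0..L}" using p[OF i] by (rule integrable_continuous_real)
        from integrable_integral[OF this]
        have "((\<lambda>s. complex_of_real (c i 0 * p i s)) has_integral of_real (c i 0 * integral {0..L} (p i))) {0..L}"
          by (intro has_integral_of_real has_integral_mult_right)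
        then show ?thesis by (intro integral_unique has_integral_mult_left)
      qed
      then show ?thesis unfolding N_def M_def exp_comb_def
        by (subst integral_sum) (auto intro!: sum.cong integrable_on_mult_left ii[unfolded of_real_mult] I)
    qed
    moreover have "U \<epsilon> 0 z = z" using U[OF g] z unfolding flow_def by blast
    ultimately have "norm (U \<epsilon> L z - z - of_real \<epsilon> * M z) \<le> \<bar>\<epsilon>\<bar> * (\<delta> \<epsilon> * L)"
      by (simp add: h_def algebra_simps)
    also have "U \<epsilon> L z - z - of_real \<epsilon> * M z = of_real \<epsilon> * (Z \<epsilon> z - M z)"
      using e0 by (simp add: Z_def field_simps)
    finally show ?thesis using e0 by (simp add: norm_mult)
  qed
  have "(\<delta> \<longlongrightarrow> 2 * \<bar>0\<bar> * K\<^sup>2 + (\<Sum>i\<in>I. \<bar>c i 0 - c i 0\<bar> * m i * exp (\<bar>e i\<bar> * r))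
      + 2 * K * (2 * \<bar>0\<bar> * K * L)) (at 0)"
    unfolding \<delta>_def using c by (intro tendsto_intros) (auto simp: isCont_def)
  then have "((\<lambda>\<epsilon>. \<delta> \<epsilon> * L) \<longlongrightarrow> 0) (at 0)" by (intro tendsto_mult_left_zero) simp
  then have lim: "uniform_limit (R 1) Z M (at 0)"
  proof (intro uniform_limitI)
    fix x :: real assume "x > 0" "((\<lambda>\<epsilon>. \<delta> \<epsilon> * L) \<longlongrightarrow> 0) (at 0)"
    then have "\<forall>\<^sub>F \<epsilon> in at 0. \<delta> \<epsilon> * L < x" by (auto dest: order_tendstoD)
    with ev_good show "\<forall>\<^sub>F \<epsilon> in at 0. \<forall>z\<in>R 1. dist (Z \<epsilon> z) (M z) < x"
      by eventually_elim (use near in \<open>force simp: dist_norm\<close>)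
  qed
  have hol: "\<forall>\<^sub>F \<epsilon> in at 0. Z \<epsilon> holomorphic_on R 1"
    using ev_good
  proof eventually_elim
    case (elim \<epsilon>)
    have "U \<epsilon> L holomorphic_on R 1" using U[OF elim] L unfolding flow_def by auto
    moreover have "\<epsilon> \<noteq> 0" using elim by (simp add: good_def)
    ultimately show ?case unfolding Z_def by (intro holomorphic_intros) auto
  qed
  have sol: "\<forall>\<^sub>F \<epsilon> in at 0. \<forall>u\<in>{a..b}. \<exists>V. V 0 = u \<and> V L = u + \<epsilon> * Re (Z \<epsilon> (of_real u)) \<and>
       (\<forall>t\<in>{0..L}. den \<epsilon> t (V t) > 0 \<and>
          (V has_real_derivative \<epsilon> * exp_comb I e (\<lambda>i. c i \<epsilon> * p i t) (V t) / den \<epsilon> t (V t))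
            (at t within {0..L}))"
    using ev_good
  proof eventually_elim
    case g: (elim \<epsilon>)
    show ?case
    proof
      fix u assume "u \<in> {a..b}"
      then have u: "of_real u \<in> R 1" by (auto simp: R_def)
      define V where "V = (\<lambda>t. Re (U \<epsilon> t (of_real u)))"
      have UV: "U \<epsilon> t (of_real u) = of_real (V t)" if "t \<in> {0..L}" for t
      proof -
        have "U \<epsilon> t (of_real u) \<in> \<real>" using U[OF g] that u unfolding flow_def by blast
        then show ?thesis by (simp add: V_def)
      qed
      have e0: "\<epsilon> \<noteq> 0" using g by (simp add: good_def)
      have "V 0 = u" using U[OF g] u unfolding flow_def V_def by auto
      moreover have "V L = u + \<epsilon> * Re (Z \<epsilon> (of_real u))"
        using UV[of L] L e0 by (simp add: Z_def Re_divide_of_real V_def)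
      moreover have "den \<epsilon> t (V t) > 0 \<and>
          (V has_real_derivative \<epsilon> * exp_comb I e (\<lambda>i. c i \<epsilon> * p i t) (V t) / den \<epsilon> t (V t)) (at t within {0..L})"
        if t: "t \<in> {0..L}" for t
      proof
        have R3: "of_real (V t) \<in> R 3" using memU[OF g t u] R23 UV[OF t] by simp
        have "of_real \<epsilon> * N2 \<epsilon> t (of_real (V t)) = (of_real (\<epsilon> * exp_comb I e (\<lambda>i. c i \<epsilon> * q i t) (V t)) :: complex)"
          by (simp add: N2_def exp_comb_of_real)
        then have "\<bar>\<epsilon> * exp_comb I e (\<lambda>i. c i \<epsilon> * q i t) (V t)\<bar> \<le> \<bar>\<epsilon>\<bar> * K"
          using den_ge(2)[OF g t R3] by (metis norm_of_real)
        also have "\<dots> \<le> 1 / 2" using g by (simp add: good_def)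
        finally have "\<bar>\<epsilon> * exp_comb I e (\<lambda>i. c i \<epsilon> * q i t) (V t)\<bar> \<le> 1 / 2" .
        then show "den \<epsilon> t (V t) > 0" by (simp add: den_def abs_le_iff)
        have "((\<lambda>t. U \<epsilon> t (of_real u)) has_vector_derivative of_real \<epsilon> * G \<epsilon> t (U \<epsilon> t (of_real u))) (at t within {0..L})"
          using U[OF g] t u unfolding flow_def by blast
        from bounded_linear.has_vector_derivative[OF bounded_linear_Re this]
        have "(V has_vector_derivative Re (of_real \<epsilon> * G \<epsilon> t (of_real (V t)))) (at t within {0..L})"
          unfolding V_def[symmetric] UV[OF t] .
        moreover have "of_real \<epsilon> * G \<epsilon> t (of_real (V t)) = of_real (\<epsilon> * exp_comb I e (\<lambda>i. c i \<epsilon> * p i t) (V t) / den \<epsilon> t (V t))"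
          by (simp add: G_def N_def N2_def exp_comb_of_real den_def)
        ultimately show "(V has_real_derivative \<epsilon> * exp_comb I e (\<lambda>i. c i \<epsilon> * p i t) (V t) / den \<epsilon> t (V t)) (at t within {0..L})"
          by (simp add: has_real_derivative_iff_has_vector_derivative)
      qed
      ultimately show "\<exists>V. V 0 = u \<and> V L = u + \<epsilon> * Re (Z \<epsilon> (of_real u)) \<and>
       (\<forall>t\<in>{0..L}. den \<epsilon> t (V t) > 0 \<and>
          (V has_real_derivative \<epsilon> * exp_comb I e (\<lambda>i. c i \<epsilon> * p i t) (V t) / den \<epsilon> t (V t))
            (at t within {0..L}))" by blast
    qed
  qed
  have "complex_of_real ` {a..b} \<subseteq> R 1" by (auto simp: R_def)
  then show ?thesis using openR[of 1] lim hol sol unfolding M_def by blast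
qed

section \<open>Planar fields and weighted polar coordinates\<close>

text \<open>Polynomial fields need not be globally Lipschitz; since two solutions over a compact
  time interval lie in a common ball, this form suffices for uniqueness.\<close>

definition lipschitz_on_bounded :: "('a::real_normed_vector \<Rightarrow> 'b::real_normed_vector) \<Rightarrow> bool" where
  "lipschitz_on_bounded X \<longleftrightarrow>
     (\<forall>R. \<exists>C\<ge>0. \<forall>p\<in>cball 0 R. \<forall>q\<in>cball 0 R. norm (X p - X q) \<le> C * norm (p - q))"

lemma lipschitz_on_boundedE:
  assumes "lipschitz_on_bounded X"
  obtains C where "C \<ge> 0" "\<And>p q. norm p \<le> R \<Longrightarrow> norm q \<le> R \<Longrightarrow> norm (X p - X q) \<le> C * norm (p - q)"
  using assms unfolding lipschitz_on_bounded_def by (auto simp: Ball_def) metis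

lemma lipschitz_on_bounded_real_polynomial_function:
  fixes f :: "'a::real_normed_vector \<Rightarrow> real"
  assumes "real_polynomial_function f"
  shows "lipschitz_on_bounded f"
  using assms
proof (induction rule: real_polynomial_function.induct)
  case (linear f)
  then interpret bounded_linear f .
  obtain K where K: "\<And>x. norm (f x) \<le> norm x * K" "K \<ge> 0" using nonneg_bounded by blast
  show ?case unfolding lipschitz_on_bounded_def
    using K(1)[of "_ - _"] K(2) by (intro allI exI[of _ K]) (auto simp: diff mult.commute)
next
  case (const c)
  show ?case by (auto simp: lipschitz_on_bounded_def)
next
  case (add f g)
  show ?case unfolding lipschitz_on_bounded_def
  proof
    fix R
    obtain C where C: "C \<ge> 0" "\<And>p q. norm p \<le> R \<Longrightarrow> norm q \<le> R \<Longrightarrow> norm (f p - f q) \<le> C * norm (p - q)"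
      by (rule lipschitz_on_boundedE[OF add.IH(1), of R]) blast
    obtain D where D: "D \<ge> 0" "\<And>p q. norm p \<le> R \<Longrightarrow> norm q \<le> R \<Longrightarrow> norm (g p - g q) \<le> D * norm (p - q)"
      by (rule lipschitz_on_boundedE[OF add.IH(2), of R]) blast
    have "norm (f p + g p - (f q + g q)) \<le> (C + D) * norm (p - q)" if "norm p \<le> R" "norm q \<le> R" for p q
      using C(2)[OF that] D(2)[OF that] by (simp add: algebra_simps)
    then show "\<exists>C\<ge>0. \<forall>p\<in>cball 0 R. \<forall>q\<in>cball 0 R. norm (f p + g p - (f q + g q)) \<le> C * norm (p - q)"
      using C(1) D(1) by (intro exI[of _ "C + D"]) auto
  qed
next
  case (mult f g)
  show ?case unfolding lipschitz_on_bounded_def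
  proof
    fix R
    obtain C where C: "C \<ge> 0" "\<And>p q. norm p \<le> R \<Longrightarrow> norm q \<le> R \<Longrightarrow> norm (f p - f q) \<le> C * norm (p - q)"
      by (rule lipschitz_on_boundedE[OF mult.IH(1), of R]) blast
    obtain D where D: "D \<ge> 0" "\<And>p q. norm p \<le> R \<Longrightarrow> norm q \<le> R \<Longrightarrow> norm (g p - g q) \<le> D * norm (p - q)"
      by (rule lipschitz_on_boundedE[OF mult.IH(2), of R]) blast
    define E where "E = \<bar>f 0\<bar> + C * \<bar>R\<bar>"
    define E' where "E' = \<bar>g 0\<bar> + D * \<bar>R\<bar>"
    have bf: "\<bar>f p\<bar> \<le> E" "\<bar>g p\<bar> \<le> E'" if "norm p \<le> R" for p
    proof -
      have "norm (0::'a) \<le> R" using that norm_ge_zero[of p] by (simp del: norm_ge_zero)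
      moreover have "C * norm p \<le> C * \<bar>R\<bar>" "D * norm p \<le> D * \<bar>R\<bar>"
        using that C(1) D(1) by (auto intro!: mult_left_mono)
      ultimately show "\<bar>f p\<bar> \<le> E" "\<bar>g p\<bar> \<le> E'"
        using C(2)[of p 0] D(2)[of p 0] that by (auto simp: E_def E'_def)
    qed
    have EE: "E \<ge> 0" "E' \<ge> 0" using C D by (auto simp: E_def E'_def)
    have "norm (f p * g p - f q * g q) \<le> (E * D + E' * C) * norm (p - q)"
      if pq: "norm p \<le> R" "norm q \<le> R" for p q
    proof -
      have "f p * g p - f q * g q = f p * (g p - g q) + g q * (f p - f q)" by (simp add: algebra_simps)
      also have "norm \<dots> \<le> \<bar>f p\<bar> * \<bar>g p - g q\<bar> + \<bar>g q\<bar> * \<bar>f p - f q\<bar>"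
        by (metis abs_mult abs_triangle_ineq real_norm_def)
      also have "\<dots> \<le> E * (D * norm (p - q)) + E' * (C * norm (p - q))"
        using bf[OF pq(1)] bf[OF pq(2)] C(2)[OF pq] D(2)[OF pq] EE
        by (intro add_mono mult_mono) auto
      finally show ?thesis by (simp add: algebra_simps)
    qed
    then show "\<exists>C\<ge>0. \<forall>p\<in>cball 0 R. \<forall>q\<in>cball 0 R. norm (f p * g p - f q * g q) \<le> C * norm (p - q)"
      using C(1) D(1) EE by (intro exI[of _ "E * D + E' * C"]) auto
  qed
qed

lemma lipschitz_on_bounded_Pair:
  assumes "lipschitz_on_bounded f" "lipschitz_on_bounded g"
  shows "lipschitz_on_bounded (\<lambda>p. (f p, g p))"
  unfolding lipschitz_on_bounded_def
proof
  fix R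
  obtain C where C: "C \<ge> 0" "\<And>p q. norm p \<le> R \<Longrightarrow> norm q \<le> R \<Longrightarrow> norm (f p - f q) \<le> C * norm (p - q)"
    by (rule lipschitz_on_boundedE[OF assms(1), of R]) blast
  obtain D where D: "D \<ge> 0" "\<And>p q. norm p \<le> R \<Longrightarrow> norm q \<le> R \<Longrightarrow> norm (g p - g q) \<le> D * norm (p - q)"
    by (rule lipschitz_on_boundedE[OF assms(2), of R]) blast
  have "norm ((f p, g p) - (f q, g q)) \<le> (C + D) * norm (p - q)" if "norm p \<le> R" "norm q \<le> R" for p q
    using C(2)[OF that] D(2)[OF that] norm_Pair_le[of "f p - f q" "g p - g q"]
    by (simp add: algebra_simps)
  then show "\<exists>C\<ge>0. \<forall>p\<in>cball 0 R. \<forall>q\<in>cball 0 R. norm ((f p, g p) - (f q, g q)) \<le> C * norm (p - q)"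
    using C(1) D(1) by (intro exI[of _ "C + D"]) auto
qed

lemma real_polynomial_function_poly2:
  "real_polynomial_function (\<lambda>p. poly2 n c (fst p) (snd p))"
  unfolding poly2_def
  by (intro real_polynomial_function_sum real_polynomial_function.intros real_polynomial_function_power
      bounded_linear_fst bounded_linear_snd) auto

lemma lipschitz_on_bounded_planar_field:
  assumes "polynomial2 f" "polynomial2 g"
  shows "lipschitz_on_bounded (planar_field f g)"
proof -
  obtain n c m d where "\<And>x y. f x y = poly2 n c x y" "\<And>x y. g x y = poly2 m d x y"
    using assms unfolding polynomial2_def by blast
  then have "planar_field f g = (\<lambda>p. (poly2 n c (fst p) (snd p), poly2 m d (fst p) (snd p)))"
    by (auto simp: planar_field_def)
  then show ?thesis
    by (simp add: lipschitz_on_bounded_Pair lipschitz_on_bounded_real_polynomial_function real_polynomial_function_poly2)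
qed

lemma continuous_on_poly2 [continuous_intros]:
  assumes "continuous_on A x" "continuous_on A y"
  shows "continuous_on A (\<lambda>t. poly2 n c (x t) (y t))"
  unfolding poly2_def by (intro continuous_intros assms)

lemma continuous_on_polynomial2:
  assumes "polynomial2 f" "continuous_on A x" "continuous_on A y"
  shows "continuous_on A (\<lambda>t. f (x t) (y t))"
proof -
  obtain n c where "\<And>x y. f x y = poly2 n c x y" using assms unfolding polynomial2_def by blast
  then show ?thesis using continuous_on_poly2[OF assms(2,3)] by simp
qed

lemma continuous_on_planar_field:
  assumes "polynomial2 f" "polynomial2 g"
  shows "continuous_on A (planar_field f g)"
  unfolding planar_field_def split_beta
  by (intro continuous_on_Pair continuous_on_polynomial2[OF assms(1)] continuous_on_polynomial2[OF assms(2)]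
      continuous_intros)

section \<open>Solutions, their uniqueness, and the uniqueness of the first return\<close>

lemma solution_on_subset: "solution_on X I \<gamma> \<Longrightarrow> J \<subseteq> I \<Longrightarrow> solution_on X J \<gamma>"
  unfolding solution_on_def by (meson has_vector_derivative_within_subset subsetD)

lemma solution_on_continuous_on: "solution_on X I \<gamma> \<Longrightarrow> continuous_on I \<gamma>"
  unfolding solution_on_def continuous_on_eq_continuous_within
  by (blast intro: has_vector_derivative_continuous)

lemma solution_on_shift:
  assumes "solution_on X UNIV \<gamma>"
  shows "solution_on X UNIV (\<lambda>t. \<gamma> (t + s))"
  unfolding solution_on_def
proof
  fix t
  have "(\<gamma> \<circ> (\<lambda>t. t + s) has_vector_derivative 1 *\<^sub>R X (\<gamma> (t + s))) (at t)"
    by (rule vector_diff_chain_at) (use assms in \<open>auto simp: solution_on_def intro!: derivative_eq_intros\<close>)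
  then show "((\<lambda>t. \<gamma> (t + s)) has_vector_derivative X (\<gamma> (t + s))) (at t)" by (simp add: o_def)
qed

lemma solution_on_reflect:
  assumes "solution_on X UNIV \<gamma>"
  shows "solution_on (\<lambda>p. - X p) UNIV (\<lambda>t. \<gamma> (- t))"
  unfolding solution_on_def
proof
  fix t
  have "(\<gamma> \<circ> uminus has_vector_derivative (- 1) *\<^sub>R X (\<gamma> (- t))) (at t)"
    by (rule vector_diff_chain_at) (use assms in \<open>auto simp: solution_on_def intro!: derivative_eq_intros\<close>)
  then show "((\<lambda>t. \<gamma> (- t)) has_vector_derivative - X (\<gamma> (- t))) (at t)" by (simp add: o_def)
qed

text \<open>Gronwall in differential form: if \<open>C\<close> is a Lipschitz constant on a ball
  containing both solutions, their squared distance times exp(-2Ct) is nonincreasing and starts at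
  0.\<close>

lemma solution_unique:
  assumes X: "lipschitz_on_bounded X"
    and sol: "solution_on X {0..T} \<gamma>1" "solution_on X {0..T} \<gamma>2" and 0: "\<gamma>1 0 = \<gamma>2 0"
    and t: "t \<in> {0..T}"
  shows "\<gamma>1 t = \<gamma>2 t"
proof -
  have cont: "continuous_on {0..T} \<gamma>1" "continuous_on {0..T} \<gamma>2"
    using sol solution_on_continuous_on by auto
  have "\<exists>R. \<forall>s\<in>{0..T}. norm (\<gamma> s) \<le> R" if "continuous_on {0..T} \<gamma>" for \<gamma> :: "real \<Rightarrow> real \<times> real"
    using compact_imp_bounded[OF compact_continuous_image[OF that compact_Icc]] by (auto simp: bounded_iff)
  note bdd = this
  obtain R1 where "\<And>s. s \<in> {0..T} \<Longrightarrow> norm (\<gamma>1 s) \<le> R1" using bdd[OF cont(1)] by blast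
  moreover obtain R2 where "\<And>s. s \<in> {0..T} \<Longrightarrow> norm (\<gamma>2 s) \<le> R2" using bdd[OF cont(2)] by blast
  ultimately have R: "norm (\<gamma>1 s) \<le> max R1 R2" "norm (\<gamma>2 s) \<le> max R1 R2" if "s \<in> {0..T}" for s
    using that by (auto simp: le_max_iff_disj)
  obtain C where C: "C \<ge> 0" "\<And>p q. norm p \<le> max R1 R2 \<Longrightarrow> norm q \<le> max R1 R2 \<Longrightarrow> norm (X p - X q) \<le> C * norm (p - q)"
    by (rule lipschitz_on_boundedE[OF X, of "max R1 R2"]) blast
  define \<Delta> where "\<Delta> = (\<lambda>s. \<gamma>1 s - \<gamma>2 s)"
  define w where "w = (\<lambda>s. exp (- (2 * C) * s) * (\<Delta> s \<bullet> \<Delta> s))"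
  have contw: "continuous_on {0..T} w"
    unfolding w_def \<Delta>_def by (intro continuous_intros cont)
  have "w t \<le> w 0"
  proof (cases "t = 0")
    case False
    then have t0: "0 < t" using t by auto
    have der: "\<exists>y. (w has_real_derivative y) (at s) \<and> y \<le> 0" if s: "0 < s" "s < t" for s
    proof -
      have sT: "s \<in> {0..T}" "s \<in> interior {0..T}" using t s by auto
      have at: "at s within {0..T} = at s" using sT(2) by (rule at_within_interior)
      have d: "(\<Delta> has_vector_derivative X (\<gamma>1 s) - X (\<gamma>2 s)) (at s)"
        unfolding \<Delta>_def
        using sol(1)[unfolded solution_on_def, rule_format, OF sT(1)]
          sol(2)[unfolded solution_on_def, rule_format, OF sT(1)]
        unfolding at by (rule has_vector_derivative_diff)
      then have d': "((\<lambda>s. \<Delta> s \<bullet> \<Delta> s) has_real_derivative 2 * (\<Delta> s \<bullet> (X (\<gamma>1 s) - X (\<gamma>2 s)))) (at s)"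
        unfolding has_vector_derivative_def has_field_derivative_def
        by (auto intro!: derivative_eq_intros simp: inner_commute fun_eq_iff)
      have dw: "(w has_real_derivative exp (- (2 * C) * s) * (2 * (\<Delta> s \<bullet> (X (\<gamma>1 s) - X (\<gamma>2 s))) - 2 * C * (\<Delta> s \<bullet> \<Delta> s))) (at s)"
        unfolding w_def by (rule derivative_eq_intros d' refl | simp add: algebra_simps)+
      have "\<Delta> s \<bullet> (X (\<gamma>1 s) - X (\<gamma>2 s)) \<le> C * (\<Delta> s \<bullet> \<Delta> s)"
      proof -
        have "\<Delta> s \<bullet> (X (\<gamma>1 s) - X (\<gamma>2 s)) \<le> norm (\<Delta> s) * norm (X (\<gamma>1 s) - X (\<gamma>2 s))"
          by (rule norm_cauchy_schwarz)
        also have "\<dots> \<le> norm (\<Delta> s) * (C * norm (\<Delta> s))"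
          unfolding \<Delta>_def using C(2)[OF R[OF sT(1)]] by (intro mult_left_mono) auto
        finally show ?thesis by (simp add: dot_square_norm power2_eq_square mult_ac)
      qed
      then have "exp (- (2 * C) * s) * (2 * (\<Delta> s \<bullet> (X (\<gamma>1 s) - X (\<gamma>2 s))) - 2 * C * (\<Delta> s \<bullet> \<Delta> s)) \<le> 0"
        by (simp add: mult_le_0_iff)
      with dw show ?thesis by blast
    qed
    show ?thesis
    proof (rule DERIV_nonpos_imp_decreasing_open[OF _ der])
      show "continuous_on {0..t} w" using contw by (rule continuous_on_subset) (use t in auto)
    qed (use t0 in auto)
  qed simp
  then have "\<Delta> t \<bullet> \<Delta> t \<le> 0" using 0 by (simp add: w_def \<Delta>_def mult_le_0_iff)
  then have "\<Delta> t \<bullet> \<Delta> t = 0" using inner_ge_zero[of "\<Delta> t"] by linarith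
  then have "\<Delta> t = 0" by simp
  then show ?thesis by (simp add: \<Delta>_def)
qed

text \<open>By uniqueness the two trajectories agree as long as both are defined, so the earlier
  arrival would be a forbidden crossing of the half-axis at an interior time of the later
  one.\<close>

lemma first_return_unique:
  assumes X: "lipschitz_on_bounded X" and r: "first_return X x x1" "first_return X x x2"
  shows "x1 = x2"
proof -
  have le: "T2 \<le> T1"
    if 1: "T1 > 0" "solution_on X {0..T1} \<gamma>1" "\<gamma>1 0 = (x, 0)" "\<gamma>1 T1 = (a, 0)" "a > 0"
    and 2: "T2 > 0" "solution_on X {0..T2} \<gamma>2" "\<gamma>2 0 = (x, 0)" "\<forall>t\<in>{0<..<T2}. \<gamma>2 t \<notin> {0<..} \<times> {0}"
    for T1 T2 \<gamma>1 \<gamma>2 a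
  proof (rule ccontr)
    assume "\<not> T2 \<le> T1"
    then have "\<gamma>2 T1 = \<gamma>1 T1"
      using solution_unique[OF X solution_on_subset[OF 2(2)] 1(2), of T1] 1 2 by auto
    moreover have "T1 \<in> {0<..<T2}" using 1 \<open>\<not> T2 \<le> T1\<close> by auto
    then have "\<gamma>2 T1 \<notin> {0<..} \<times> {0}" by (rule bspec[OF 2(4)])
    ultimately show False using 1(4,5) by simp
  qed
  obtain \<gamma>1 T1 where 1: "T1 > 0" "solution_on X {0..T1} \<gamma>1" "\<gamma>1 0 = (x, 0)" "\<gamma>1 T1 = (x1, 0)"
      "\<forall>t\<in>{0<..<T1}. \<gamma>1 t \<notin> {0<..} \<times> {0}" "x1 > 0"
    using r(1) unfolding first_return_def by (elim conjE exE) (rule that)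
  obtain \<gamma>2 T2 where 2: "T2 > 0" "solution_on X {0..T2} \<gamma>2" "\<gamma>2 0 = (x, 0)" "\<gamma>2 T2 = (x2, 0)"
      "\<forall>t\<in>{0<..<T2}. \<gamma>2 t \<notin> {0<..} \<times> {0}" "x2 > 0"
    using r(2) unfolding first_return_def by (elim conjE exE) (rule that)
  have "T1 = T2" using le[OF 1(1-4,6) 2(1-3,5)] le[OF 2(1-4,6) 1(1-3,5)] by simp
  then show ?thesis using solution_unique[OF X 1(2), of \<gamma>2 T1] 1 2 by auto
qed

lemma return_map_eqI:
  "lipschitz_on_bounded X \<Longrightarrow> first_return X x x' \<Longrightarrow> return_map X x = x'"
  unfolding return_map_def using first_return_unique by blast

text \<open>\<tau> is the derivative of time with respect to the curve parameter. Time is its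
  integral, an increasing function, and composing \<open>p\<close> with the inverse gives the
  solution. The last conclusion, that interior times come from interior parameters, serves the
  no-crossing clause of \<open>first_return\<close>.\<close>

lemma time_reparametrization:
  fixes p :: "real \<Rightarrow> real \<times> real"
  assumes L: "L > 0" and \<tau>: "continuous_on {0..L} \<tau>" "\<And>\<phi>. \<phi> \<in> {0..L} \<Longrightarrow> \<tau> \<phi> > 0"
    and p: "\<And>\<phi>. \<phi> \<in> {0..L} \<Longrightarrow> (p has_vector_derivative \<tau> \<phi> *\<^sub>R X (p \<phi>)) (at \<phi> within {0..L})"
  obtains \<gamma> T where "T > 0" "solution_on X {0..T} \<gamma>" "\<gamma> 0 = p 0" "\<gamma> T = p L"
    "\<And>t. t \<in> {0<..<T} \<Longrightarrow> \<gamma> t \<in> p ` {0<..<L}"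
proof -
  \<comment> \<open>The constant extension beyond both ends lets the inverse function theorem, which
    needs an open interval, be applied at 0 and \<open>L\<close> as well.\<close>
  define \<tau>' where "\<tau>' = (\<lambda>\<phi>. \<tau> (max 0 (min L \<phi>)))"
  have \<tau>'pos: "\<tau>' \<phi> > 0" for \<phi> using \<tau>(2) L by (auto simp: \<tau>'_def)
  have cont: "continuous_on UNIV \<tau>'"
    unfolding \<tau>'_def by (rule continuous_on_compose2[OF \<tau>(1)]) (use L in \<open>auto intro!: continuous_intros\<close>)
  define s where "s = (\<lambda>\<phi>. integral {-1..\<phi>} \<tau>' - integral {-1..0} \<tau>')"
  let ?S = "{-1<..<L + 1}"
  have ds: "(s has_real_derivative \<tau>' \<phi>) (at \<phi>)" if "\<phi> \<in> ?S" for \<phi>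
  proof -
    have "((\<lambda>\<phi>. integral {-1..\<phi>} \<tau>') has_real_derivative \<tau>' \<phi>) (at \<phi> within {-1..L + 1})"
      using that by (intro integral_has_real_derivative continuous_on_subset[OF cont]) auto
    moreover have "at \<phi> within {-1..L + 1} = at \<phi>" using that by (intro at_within_interior) auto
    ultimately show ?thesis unfolding s_def by (auto intro!: derivative_eq_intros)
  qed
  have mono: "s x < s y" if "x \<in> ?S" "y \<in> ?S" "x < y" for x y
  proof (rule DERIV_pos_imp_increasing[OF that(3)])
    fix z assume "x \<le> z" "z \<le> y"
    then show "\<exists>d. (s has_real_derivative d) (at z) \<and> d > 0"
      using ds[of z] \<tau>'pos[of z] that(1,2) by auto
  qed
  have inj: "inj_on s ?S"
  proof (rule inj_onI)
    fix x y assume "x \<in> ?S" "y \<in> ?S" "s x = s y"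
    then show "x = y" using mono[of x y] mono[of y x] by (cases x y rule: linorder_cases) auto
  qed
  define h where "h = inv_into ?S s"
  have hs: "h (s x) = x" if "x \<in> ?S" for x unfolding h_def using inj that by (rule inv_into_f_f)
  have conts: "continuous_on ?S s" using ds by (meson DERIV_isCont continuous_at_imp_continuous_on)
  define T where "T = s L"
  have s0: "s 0 = 0" by (simp add: s_def)
  have T: "T > 0" using mono[of 0 L] L s0 by (simp add: T_def)
  have surj: "\<exists>\<phi>\<in>{0..L}. s \<phi> = t" if "t \<in> {0..T}" for t
  proof -
    have "continuous_on {0..L} s" by (rule continuous_on_subset[OF conts]) auto
    then show ?thesis using IVT'[of s 0 t L] that L s0 by (auto simp: T_def)
  qed
  have hmem: "h t \<in> {0..L}" "s (h t) = t" if "t \<in> {0..T}" for t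
    using surj[OF that] hs by auto
  have dh: "(h has_real_derivative inverse (\<tau>' (h t))) (at t)" if t: "t \<in> {0..T}" for t
  proof -
    obtain \<phi> where \<phi>: "\<phi> \<in> {0..L}" "s \<phi> = t" using surj[OF t] by blast
    then have \<phi>S: "\<phi> \<in> ?S" by auto
    have "(h has_field_derivative inverse (\<tau>' \<phi>)) (at (s \<phi>))"
      by (rule has_field_derivative_inverse_strong[OF ds[OF \<phi>S] _ _ \<phi>S conts hs])
         (use \<tau>'pos[of \<phi>] in auto)
    then show ?thesis using \<phi> hs[OF \<phi>S] by auto
  qed
  show ?thesis
  proof
    show "T > 0" by fact
    show "solution_on X {0..T} (\<lambda>t. p (h t))"
      unfolding solution_on_def
    proof
      fix t assume t: "t \<in> {0..T}"
      have "(p \<circ> h has_vector_derivative inverse (\<tau>' (h t)) *\<^sub>R (\<tau> (h t) *\<^sub>R X (p (h t)))) (at t within {0..T})"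
      proof (rule vector_diff_chain_within)
        show "(h has_vector_derivative inverse (\<tau>' (h t))) (at t within {0..T})"
          using dh[OF t] by (simp add: has_real_derivative_iff_has_vector_derivative has_vector_derivative_at_within)
        show "(p has_vector_derivative \<tau> (h t) *\<^sub>R X (p (h t))) (at (h t) within h ` {0..T})"
          by (rule has_vector_derivative_within_subset[OF p]) (use hmem t in auto)
      qed
      moreover have "\<tau>' (h t) = \<tau> (h t)" using hmem[OF t] by (simp add: \<tau>'_def)
      moreover have "\<tau> (h t) \<noteq> 0" using \<tau>(2)[OF hmem(1)[OF t]] by simp
      ultimately show "((\<lambda>t. p (h t)) has_vector_derivative X (p (h t))) (at t within {0..T})"
        by (simp add: o_def)
    qed
    show "p (h 0) = p 0" "p (h T) = p L" using hs[of 0] hs[of L] L s0 by (simp_all add: T_def)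
    show "p (h t) \<in> p ` {0<..<L}" if "t \<in> {0<..<T}" for t
    proof (rule imageI)
      have "h t \<in> {0..L}" "s (h t) = t" using hmem[of t] that by auto
      moreover from this have "h t \<noteq> 0" "h t \<noteq> L" using that s0 by (auto simp: T_def)
      ultimately show "h t \<in> {0<..<L}" by auto
    qed
  qed
qed

text \<open>A shift of \<open>v\<close> is the weighted dilation with factor exp(v). The sign
  \<sigma> reverses the orientation of the angle when necessary, so that it increases along the
  orbits of the center.\<close>

definition weighted_polar :: "real \<Rightarrow> real \<Rightarrow> real \<Rightarrow> real \<Rightarrow> real \<Rightarrow> real \<times> real" where
  "weighted_polar \<alpha> \<beta> \<sigma> v \<phi> = (exp (\<alpha> * v) * cos \<phi>, exp (\<beta> * v) * (\<sigma> * sin \<phi>))"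

text \<open>Solving the chain rule for the polar velocities gives \<open>den / D\<close> for the
  angle and the displayed numerator over \<open>D\<close> for \<open>v\<close>, where
  \<open>D\<close> is, up to the sign \<sigma>, the determinant of the rescaled coordinate change.
  Their quotient is the slope in the hypothesis, and \<open>\<tau> = D / den\<close> is time per
  angle. A solution over one full turn is thus an orbit back to the half-axis.\<close>

lemma first_return_of_polar_solution:
  fixes X :: "real \<times> real \<Rightarrow> real \<times> real" and v :: "real \<Rightarrow> real"
  assumes ab: "\<alpha> > 0" "\<beta> > 0" and \<sigma>: "\<sigma>\<^sup>2 = 1" and X: "continuous_on UNIV X"
  defines "pt \<equiv> \<lambda>\<phi>. weighted_polar \<alpha> \<beta> \<sigma> (v \<phi>) \<phi>"
  defines "F \<equiv> \<lambda>\<phi>. exp (- \<alpha> * v \<phi>) * fst (X (pt \<phi>))"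
    and "G \<equiv> \<lambda>\<phi>. exp (- \<beta> * v \<phi>) * snd (X (pt \<phi>))"
  defines "den \<equiv> \<lambda>\<phi>. \<sigma> * (\<alpha> * cos \<phi> * G \<phi> - \<beta> * (\<sigma> * sin \<phi>) * F \<phi>)"
  assumes pos: "\<And>\<phi>. \<phi> \<in> {0..2 * pi} \<Longrightarrow> den \<phi> > 0"
    and v: "\<And>\<phi>. \<phi> \<in> {0..2 * pi} \<Longrightarrow>
      (v has_real_derivative (cos \<phi> * F \<phi> + \<sigma> * sin \<phi> * G \<phi>) / den \<phi>) (at \<phi> within {0..2 * pi})"
  shows "first_return X (exp (\<alpha> * v 0)) (exp (\<alpha> * v (2 * pi)))"
proof -
  have contv: "continuous_on {0..2 * pi} v" using v by (rule DERIV_continuous_on)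
  have contpt: "continuous_on {0..2 * pi} pt"
    unfolding pt_def weighted_polar_def by (intro continuous_intros contv)
  define D where "D = (\<lambda>\<phi>. \<alpha> * (cos \<phi>)\<^sup>2 + \<beta> * (sin \<phi>)\<^sup>2)"
  have Dpos: "D \<phi> > 0" for \<phi>
  proof -
    have "cos \<phi> \<noteq> 0 \<or> sin \<phi> \<noteq> 0" by (metis cos_zero_iff_int sin_zero_iff_int sin_zero_abs_cos_one abs_zero zero_neq_one)
    then show ?thesis unfolding D_def using ab by (auto intro: add_pos_nonneg add_nonneg_pos)
  qed
  define \<tau> where "\<tau> = (\<lambda>\<phi>. D \<phi> / den \<phi>)"
  have contX: "continuous_on {0..2 * pi} (\<lambda>\<phi>. X (pt \<phi>))"
    by (rule continuous_on_compose2[OF X contpt]) auto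
  have den0: "den \<phi> \<noteq> 0" if "\<phi> \<in> {0..2 * pi}" for \<phi> using pos[OF that] by simp
  have "continuous_on {0..2 * pi} den"
    unfolding den_def F_def G_def by (intro continuous_intros contX contv)
  then have cont\<tau>: "continuous_on {0..2 * pi} \<tau>"
    unfolding \<tau>_def D_def by (intro continuous_intros) (use den0 in auto)
  have dpt: "(pt has_vector_derivative \<tau> \<phi> *\<^sub>R X (pt \<phi>)) (at \<phi> within {0..2 * pi})"
    if \<phi>: "\<phi> \<in> {0..2 * pi}" for \<phi>
  proof -
    define v' where "v' = (cos \<phi> * F \<phi> + \<sigma> * sin \<phi> * G \<phi>) / den \<phi>"
    have dn: "den \<phi> \<noteq> 0" using pos[OF \<phi>] by simp
    have dv: "(v has_real_derivative v') (at \<phi> within {0..2 * pi})" using v[OF \<phi>] by (simp add: v'_def)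
    have 1: "((\<lambda>\<phi>. exp (\<alpha> * v \<phi>) * cos \<phi>) has_real_derivative exp (\<alpha> * v \<phi>) * (\<alpha> * v' * cos \<phi> - sin \<phi>)) (at \<phi> within {0..2 * pi})"
      by (rule derivative_eq_intros dv refl | simp add: algebra_simps)+
    have 2: "((\<lambda>\<phi>. exp (\<beta> * v \<phi>) * (\<sigma> * sin \<phi>)) has_real_derivative exp (\<beta> * v \<phi>) * (\<beta> * v' * (\<sigma> * sin \<phi>) + \<sigma> * cos \<phi>)) (at \<phi> within {0..2 * pi})"
      by (rule derivative_eq_intros dv refl | simp add: algebra_simps)+
    have \<sigma>\<sigma>: "\<sigma> * (\<sigma> * x) = x" for x using \<sigma> by (simp add: power2_eq_square flip: mult.assoc)
    have vd: "v' * den \<phi> = cos \<phi> * F \<phi> + \<sigma> * sin \<phi> * G \<phi>" using dn by (simp add: v'_def)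
    have dd: "den \<phi> = \<sigma> * \<alpha> * cos \<phi> * G \<phi> - \<beta> * sin \<phi> * F \<phi>"
      unfolding den_def using \<sigma>\<sigma> by (simp add: algebra_simps)
    have e1: "(\<alpha> * v' * cos \<phi> - sin \<phi>) * den \<phi> = D \<phi> * F \<phi>"
    proof -
      have "(\<alpha> * v' * cos \<phi> - sin \<phi>) * den \<phi> = \<alpha> * cos \<phi> * (v' * den \<phi>) - sin \<phi> * den \<phi>"
        by (simp add: algebra_simps)
      also have "\<dots> = \<alpha> * cos \<phi> * (cos \<phi> * F \<phi> + \<sigma> * sin \<phi> * G \<phi>)
          - sin \<phi> * (\<sigma> * \<alpha> * cos \<phi> * G \<phi> - \<beta> * sin \<phi> * F \<phi>)"
        unfolding vd by (simp only: dd)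
      also have "\<dots> = D \<phi> * F \<phi>" by (simp add: D_def algebra_simps power2_eq_square)
      finally show ?thesis .
    qed
    have e2: "(\<beta> * v' * (\<sigma> * sin \<phi>) + \<sigma> * cos \<phi>) * den \<phi> = D \<phi> * G \<phi>"
    proof -
      have "(\<beta> * v' * (\<sigma> * sin \<phi>) + \<sigma> * cos \<phi>) * den \<phi> = \<beta> * \<sigma> * sin \<phi> * (v' * den \<phi>) + \<sigma> * cos \<phi> * den \<phi>"
        by (simp add: algebra_simps)
      also have "\<dots> = \<beta> * \<sigma> * sin \<phi> * (cos \<phi> * F \<phi> + \<sigma> * sin \<phi> * G \<phi>)
          + \<sigma> * cos \<phi> * (\<sigma> * \<alpha> * cos \<phi> * G \<phi> - \<beta> * sin \<phi> * F \<phi>)"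
        unfolding vd by (simp only: dd)
      also have "\<dots> = D \<phi> * G \<phi>" by (simp add: D_def algebra_simps power2_eq_square \<sigma>\<sigma>)
      finally show ?thesis .
    qed
    have c1: "exp (\<alpha> * v \<phi>) * (\<alpha> * v' * cos \<phi> - sin \<phi>) = \<tau> \<phi> * fst (X (pt \<phi>))"
    proof -
      have "\<alpha> * v' * cos \<phi> - sin \<phi> = \<tau> \<phi> * F \<phi>" using e1 dn by (simp add: \<tau>_def field_simps)
      then show ?thesis by (simp add: F_def exp_minus)
    qed
    have c2: "exp (\<beta> * v \<phi>) * (\<beta> * v' * (\<sigma> * sin \<phi>) + \<sigma> * cos \<phi>) = \<tau> \<phi> * snd (X (pt \<phi>))"
    proof -
      have "\<beta> * v' * (\<sigma> * sin \<phi>) + \<sigma> * cos \<phi> = \<tau> \<phi> * G \<phi>" using e2 dn by (simp add: \<tau>_def field_simps)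
      then show ?thesis by (simp add: G_def exp_minus)
    qed
    have "(pt has_vector_derivative (\<tau> \<phi> * fst (X (pt \<phi>)), \<tau> \<phi> * snd (X (pt \<phi>)))) (at \<phi> within {0..2 * pi})"
      using 1 2 unfolding c1 c2 pt_def weighted_polar_def has_real_derivative_iff_has_vector_derivative
      by (intro has_vector_derivative_Pair)
    then show ?thesis by (simp add: scaleR_prod_def)
  qed
  obtain \<gamma> T where \<gamma>: "T > 0" "solution_on X {0..T} \<gamma>" "\<gamma> 0 = pt 0" "\<gamma> T = pt (2 * pi)"
    "\<And>t. t \<in> {0<..<T} \<Longrightarrow> \<gamma> t \<in> pt ` {0<..<2 * pi}"
    by (rule time_reparametrization[of "2 * pi" \<tau> pt X, OF _ cont\<tau> _ dpt])
       (use Dpos pos in \<open>auto simp: \<tau>_def\<close>)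
  \<comment> \<open>Inside a full turn the sine vanishes only at \<pi>, where the cosine is
    negative.\<close>
  have off: "pt \<phi> \<notin> {0<..} \<times> {0}" if "\<phi> \<in> {0<..<2 * pi}" for \<phi>
  proof
    assume "pt \<phi> \<in> {0<..} \<times> {0}"
    then have 1: "sin \<phi> = 0" "cos \<phi> > 0" using \<sigma> by (auto simp: pt_def weighted_polar_def zero_less_mult_iff)
    then obtain k :: int where k: "\<phi> = of_int k * pi" using sin_zero_iff_int2 by blast
    then have "k > 0" "k < 2" using that by (auto simp: zero_less_mult_iff)
    then have "\<phi> = pi" using k by (simp add: order.antisym)
    then show False using 1 by simp
  qed
  have "\<gamma> t \<notin> {0<..} \<times> {0}" if t: "t \<in> {0<..<T}" for t
  proof -
    obtain \<phi> where "\<phi> \<in> {0<..<2 * pi}" "\<gamma> t = pt \<phi>" using \<gamma>(5)[OF t] by (elim imageE) (rule that)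
    then show ?thesis using off[of \<phi>] by simp
  qed
  moreover have "pt 0 = (exp (\<alpha> * v 0), 0)" "pt (2 * pi) = (exp (\<alpha> * v (2 * pi)), 0)"
    by (simp_all add: pt_def weighted_polar_def)
  ultimately show ?thesis unfolding first_return_def using \<gamma>(1-4)
    by (intro conjI exI[of _ \<gamma>] exI[of _ T] ballI) simp_all
qed

section \<open>Weight-homogeneous centers\<close>

lemma weight_homogeneous_exp:
  assumes "weight_homogeneous \<alpha> \<beta> \<omega> f g"
  shows "f (exp (\<alpha> * v) * x) (exp (\<beta> * v) * y) = exp ((\<omega> + \<alpha>) * v) * f x y"
    and "g (exp (\<alpha> * v) * x) (exp (\<beta> * v) * y) = exp ((\<omega> + \<beta>) * v) * g x y"
proof -
  have e: "exp v powr a = exp (a * v)" for a by (simp add: powr_def)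
  have "f (exp v powr \<alpha> * x) (exp v powr \<beta> * y) = exp v powr (\<omega> + \<alpha>) * f x y \<and>
    g (exp v powr \<alpha> * x) (exp v powr \<beta> * y) = exp v powr (\<omega> + \<beta>) * g x y"
    using assms unfolding weight_homogeneous_def by simp
  then show "f (exp (\<alpha> * v) * x) (exp (\<beta> * v) * y) = exp ((\<omega> + \<alpha>) * v) * f x y"
    and "g (exp (\<alpha> * v) * x) (exp (\<beta> * v) * y) = exp ((\<omega> + \<beta>) * v) * g x y"
    unfolding e by auto
qed

section \<open>Periodic orbits, time reversal and what a center excludes\<close>

lemma periodic_int_multiple:
  fixes \<gamma> :: "real \<Rightarrow> 'a"
  assumes per: "\<And>t. \<gamma> (t + T) = \<gamma> t"
  shows "\<gamma> (t + of_int n * T) = \<gamma> t"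
proof (induction n rule: int_induct[where k = 0])
  case (step1 i)
  then show ?case using per[of "t + of_int i * T"] by (simp add: algebra_simps)
next
  case (step2 i)
  then show ?case using per[of "t + of_int (i - 1) * T"] by (simp add: algebra_simps)
qed simp

lemma periodic_orbit_compact:
  assumes "periodic_orbit X C"
  shows "compact C"
proof -
  obtain \<gamma> T where \<gamma>: "T > 0" "solution_on X UNIV \<gamma>" "\<And>t. \<gamma> (t + T) = \<gamma> t" "C = range \<gamma>"
    using assms unfolding periodic_orbit_def by auto
  have "\<gamma> t \<in> \<gamma> ` {0..T}" for t
  proof -
    define n where "n = - \<lfloor>t / T\<rfloor>"
    have "of_int \<lfloor>t / T\<rfloor> * T \<le> t"
      using of_int_floor_le[of "t / T"] unfolding pos_le_divide_eq[OF \<gamma>(1)] .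
    moreover have "t / T \<le> of_int \<lfloor>t / T\<rfloor> + 1" by linarith
    then have "t \<le> (of_int \<lfloor>t / T\<rfloor> + 1) * T" unfolding pos_divide_le_eq[OF \<gamma>(1)] .
    ultimately have "t + of_int n * T \<in> {0..T}" by (simp add: n_def algebra_simps)
    moreover have "\<gamma> (t + of_int n * T) = \<gamma> t" by (rule periodic_int_multiple[of \<gamma> T t n]) (rule \<gamma>(3))
    ultimately show ?thesis by (metis imageI)
  qed
  then have "C = \<gamma> ` {0..T}" using \<gamma>(4) by blast
  moreover have "continuous_on {0..T} \<gamma>"
    using solution_on_continuous_on[OF \<gamma>(2)] by (rule continuous_on_subset) simp
  ultimately show ?thesis by (simp add: compact_continuous_image)
qed

lemma periodic_orbit_reflect:
  assumes "periodic_orbit X C"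
  shows "periodic_orbit (\<lambda>p. - X p) C"
proof -
  obtain \<gamma> T t0 where \<gamma>: "T > 0" "solution_on X UNIV \<gamma>" "\<And>t. \<gamma> (t + T) = \<gamma> t" "\<gamma> t0 \<noteq> \<gamma> 0" "C = range \<gamma>"
    using assms unfolding periodic_orbit_def by auto
  have "\<gamma> (- (t + T)) = \<gamma> (- t)" for t using \<gamma>(3)[of "- (t + T)"] by simp
  moreover have "range (\<lambda>t. \<gamma> (- t)) = range \<gamma>"
    by (metis image_image surj_uminus)
  ultimately show ?thesis unfolding periodic_orbit_def
    using \<gamma> solution_on_reflect[OF \<gamma>(2)]
    by (intro exI[of _ "\<lambda>t. \<gamma> (- t)"] exI[of _ T] conjI exI[of _ "- t0"]) auto
qed

lemma center_at_origin_reflect: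
  assumes "center_at_origin X"
  shows "center_at_origin (\<lambda>p. - X p)"
proof -
  obtain U where U: "X (0, 0) = (0, 0)" "open U" "(0, 0) \<in> U"
    "\<And>p. p \<in> U - {(0, 0)} \<Longrightarrow> \<exists>C. periodic_orbit X C \<and> p \<in> C \<and> C \<subseteq> U - {(0, 0)}"
    using assms unfolding center_at_origin_def by auto
  have "\<forall>p\<in>U - {(0, 0)}. \<exists>C. periodic_orbit (\<lambda>p. - X p) C \<and> p \<in> C \<and> C \<subseteq> U - {(0, 0)}"
    using U(4) periodic_orbit_reflect by blast
  then show ?thesis unfolding center_at_origin_def
    by (intro conjI exI[of _ U]) (simp_all only: U(1-3) uminus_Pair minus_zero)
qed

lemma periodic_orbit_through:
  assumes "periodic_orbit X C" "p \<in> C"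
  obtains \<gamma> T where "T > 0" "solution_on X UNIV \<gamma>" "\<forall>t. \<gamma> (t + T) = \<gamma> t" "\<gamma> 0 = p"
    "C = range \<gamma>" "\<exists>t. \<gamma> t \<noteq> p"
proof -
  obtain \<gamma> T t0 where \<gamma>: "T > 0" "solution_on X UNIV \<gamma>" "\<And>t. \<gamma> (t + T) = \<gamma> t" "\<gamma> t0 \<noteq> \<gamma> 0" "C = range \<gamma>"
    using assms unfolding periodic_orbit_def by auto
  obtain s where s: "p = \<gamma> s" using assms(2) \<gamma>(5) by auto
  show ?thesis
  proof
    show "solution_on X UNIV (\<lambda>t. \<gamma> (t + s))" using solution_on_shift[OF \<gamma>(2)] .
    have "\<gamma> (t + T + s) = \<gamma> (t + s)" for t using \<gamma>(3)[of "t + s"] by (simp add: algebra_simps)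
    then show "\<forall>t. \<gamma> (t + T + s) = \<gamma> (t + s)" by blast
    show "C = range (\<lambda>t. \<gamma> (t + s))"
    proof -
      have "\<gamma> t \<in> range (\<lambda>t. \<gamma> (t + s))" for t by (rule range_eqI[of _ _ "t - s"]) simp
      then show ?thesis unfolding \<gamma>(5) by blast
    qed
    have "\<gamma> (0 - s + s) \<noteq> p \<or> \<gamma> (t0 - s + s) \<noteq> p" using \<gamma>(4) by auto
    then show "\<exists>t. \<gamma> (t + s) \<noteq> p" by blast
  qed (use \<gamma>(1) s in auto)
qed

text \<open>The equations for \<open>k\<close> say that the field is tangent to the weighted ray
  through \<open>(c, s)\<close>, where the motion reduces to v' = k exp(\<omega> v). The sign
  condition on \<open>\<omega> * k\<close> excludes blow-up in forward time. The orbit through a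
  point of the ray near the origin must be periodic, but \<open>v\<close> is strictly monotone
  unless \<open>k = 0\<close>; and \<open>k = 0\<close> makes the orbit constant, which a periodic
  orbit is not.\<close>

lemma no_contracting_invariant_ray:
  assumes X: "lipschitz_on_bounded (planar_field f g)" and ab: "\<alpha> > 0" "\<beta> > 0"
    and wh: "weight_homogeneous \<alpha> \<beta> \<omega> f g" and center: "center_at_origin (planar_field f g)"
    and cs: "c \<noteq> 0 \<or> s \<noteq> 0" and k: "f c s = \<alpha> * c * k" "g c s = \<beta> * s * k" "\<omega> * k \<le> 0"
  shows False
proof -
  let ?X = "planar_field f g"
  obtain U where U: "open U" "(0, 0) \<in> U"
    "\<And>p. p \<in> U - {(0, 0)} \<Longrightarrow> \<exists>C. periodic_orbit ?X C \<and> p \<in> C \<and> C \<subseteq> U - {(0, 0)}"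
    using center unfolding center_at_origin_def by auto
  have "((\<lambda>v. (exp (\<alpha> * v) * c, exp (\<beta> * v) * s)) \<longlongrightarrow> (0 * c, 0 * s)) at_bot"
    using ab by (intro tendsto_intros filterlim_compose[OF exp_at_bot]
        filterlim_tendsto_pos_mult_at_bot[OF tendsto_const] filterlim_ident)
  then have "\<forall>\<^sub>F v in at_bot. (exp (\<alpha> * v) * c, exp (\<beta> * v) * s) \<in> U"
    using U by (intro topological_tendstoD) auto
  then obtain v0 where v0: "(exp (\<alpha> * v0) * c, exp (\<beta> * v0) * s) \<in> U"
    by (auto simp: eventually_at_bot_linorder)
  \<comment> \<open>The explicit solution of v' = k exp(\<omega> v) starting at \<open>v0\<close>:
    for \<omega> \<noteq> 0 the quantity exp(-\<omega> v) is affine in time.\<close>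
  define v where "v = (\<lambda>t. if \<omega> = 0 then v0 + k * t else - ln (exp (- \<omega> * v0) - \<omega> * k * t) / \<omega>)"
  define p where "p = (\<lambda>t. (exp (\<alpha> * v t) * c, exp (\<beta> * v t) * s))"
  have vv: "v 0 = v0" by (simp add: v_def)
  have arg: "exp (- \<omega> * v0) - \<omega> * k * t > 0" if "t \<ge> 0" for t
    using mult_nonpos_nonneg[OF k(3) that] exp_gt_zero[of "- \<omega> * v0"] by linarith
  have dv: "(v has_real_derivative k * exp (\<omega> * v t)) (at t)" if "t \<ge> 0" for t
  proof (cases "\<omega> = 0")
    case True
    then show ?thesis unfolding v_def by (auto intro!: derivative_eq_intros)
  next
    case False
    have "exp (\<omega> * v t) = inverse (exp (- \<omega> * v0) - \<omega> * k * t)"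
      using False arg[OF that] by (simp add: v_def exp_minus)
    moreover have "((\<lambda>t. - ln (exp (- \<omega> * v0) - \<omega> * k * t) / \<omega>) has_real_derivative
        k * inverse (exp (- \<omega> * v0) - \<omega> * k * t)) (at t)"
      using False arg[OF that] by (auto intro!: derivative_eq_intros simp: field_simps)
    ultimately show ?thesis using False by (simp add: v_def)
  qed
  have sol: "solution_on ?X {0..T} p" for T
    unfolding solution_on_def
  proof
    fix t assume "t \<in> {0..T}"
    then have d: "(v has_real_derivative k * exp (\<omega> * v t)) (at t within {0..T})"
      using dv[of t] by (auto intro: has_field_derivative_at_within)
    have 1: "((\<lambda>t. exp (\<alpha> * v t) * c) has_real_derivative f (exp (\<alpha> * v t) * c) (exp (\<beta> * v t) * s)) (at t within {0..T})"
      unfolding weight_homogeneous_exp[OF wh] k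
      by (rule derivative_eq_intros d refl | simp add: algebra_simps exp_add)+
    have 2: "((\<lambda>t. exp (\<beta> * v t) * s) has_real_derivative g (exp (\<alpha> * v t) * c) (exp (\<beta> * v t) * s)) (at t within {0..T})"
      unfolding weight_homogeneous_exp[OF wh] k
      by (rule derivative_eq_intros d refl | simp add: algebra_simps exp_add)+
    show "(p has_vector_derivative ?X (p t)) (at t within {0..T})"
      using 1 2 unfolding p_def planar_field_def has_real_derivative_iff_has_vector_derivative
      by (simp add: has_vector_derivative_Pair)
  qed
  have "p 0 \<in> U - {(0, 0)}" using v0 cs by (auto simp: p_def vv)
  then obtain C where C: "periodic_orbit ?X C" "p 0 \<in> C" using U(3) by blast
  obtain \<gamma> T where \<gamma>: "T > 0" "solution_on ?X UNIV \<gamma>" "\<forall>t. \<gamma> (t + T) = \<gamma> t" "\<gamma> 0 = p 0"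
    "C = range \<gamma>" "\<exists>t. \<gamma> t \<noteq> p 0"
    by (rule periodic_orbit_through[OF C]) (rule that)
  have eq: "\<gamma> t = p t" if "t \<ge> 0" for t
    using solution_unique[OF X solution_on_subset[OF \<gamma>(2)] sol \<gamma>(4), of t t] that by auto
  have "p T = p 0" using eq[of T] \<gamma>(3)[rule_format, of 0] \<gamma>(1,4) by simp
  then have "v T = v0" using cs by (auto simp: p_def vv) (use ab in auto)
  then have "k = 0"
  proof (cases "\<omega> = 0")
    case False
    then have "ln (exp (- \<omega> * v0) - \<omega> * k * T) = - \<omega> * v0"
      using \<open>v T = v0\<close> by (simp add: v_def field_simps)
    then have "exp (- \<omega> * v0) - \<omega> * k * T = exp (- \<omega> * v0)"
      using arg[of T] \<gamma>(1) by (metis exp_ln less_imp_le)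
    then show ?thesis using False \<gamma>(1) by auto
  qed (use \<gamma>(1) \<open>v T = v0\<close> in \<open>auto simp: v_def\<close>)
  then have "v t = v0" for t by (simp add: v_def)
  then have const: "\<gamma> t = p 0" if "t \<ge> 0" for t using eq[OF that] by (simp add: p_def)
  have "\<gamma> t = p 0" for t
  proof -
    \<comment> \<open>Agreement with \<open>p\<close> is known for t \<ge> 0 only; adding enough
      periods carries negative times there.\<close>
    define n where "n = \<lceil>\<bar>t\<bar> / T\<rceil>"
    have "\<bar>t\<bar> / T \<le> of_int n" unfolding n_def by (rule le_of_int_ceiling)
    then have "t + of_int n * T \<ge> 0" using \<gamma>(1) by (simp add: field_simps abs_le_iff)
    from const[OF this] show ?thesis using periodic_int_multiple[of \<gamma> T t n] \<gamma>(3) by simp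
  qed
  then show False using \<gamma>(6) by blast
qed

text \<open>If the expression vanishes, the field at \<open>(c, s)\<close> is a multiple
  \<open>k\<close> of the tangent (\<alpha> c, \<beta> s) of the weighted ray. When
  \<open>\<omega> * k > 0\<close>, reversing time replaces \<open>k\<close> by \<open>- k\<close>
  and keeps the center.\<close>

lemma angular_speed_nonzero:
  assumes fg: "polynomial2 f" "polynomial2 g" and ab: "\<alpha> > 0" "\<beta> > 0"
    and wh: "weight_homogeneous \<alpha> \<beta> \<omega> f g" and center: "center_at_origin (planar_field f g)"
    and cs: "c \<noteq> 0 \<or> s \<noteq> 0"
  shows "\<alpha> * c * g c s - \<beta> * s * f c s \<noteq> 0"
proof
  assume 0: "\<alpha> * c * g c s - \<beta> * s * f c s = 0"
  have "\<exists>k. f c s = \<alpha> * c * k \<and> g c s = \<beta> * s * k"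
  proof (cases "c = 0")
    case False
    then show ?thesis using 0 ab by (intro exI[of _ "f c s / (\<alpha> * c)"]) (auto simp: field_simps)
  next
    case True
    then show ?thesis using 0 ab cs by (intro exI[of _ "g c s / (\<beta> * s)"]) auto
  qed
  then obtain k where k: "f c s = \<alpha> * c * k" "g c s = \<beta> * s * k" by blast
  note X = lipschitz_on_bounded_planar_field[OF fg]
  show False
  proof (cases "\<omega> * k \<le> 0")
    case True
    then show False by (rule no_contracting_invariant_ray[OF X ab wh center cs k])
  next
    case False
    have eq: "planar_field (\<lambda>x y. - f x y) (\<lambda>x y. - g x y) = (\<lambda>p. - planar_field f g p)"
      by (auto simp: planar_field_def)
    have X': "lipschitz_on_bounded (planar_field (\<lambda>x y. - f x y) (\<lambda>x y. - g x y))"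
      using X unfolding eq lipschitz_on_bounded_def by (simp add: norm_minus_commute)
    have wh': "weight_homogeneous \<alpha> \<beta> \<omega> (\<lambda>x y. - f x y) (\<lambda>x y. - g x y)"
      using wh unfolding weight_homogeneous_def by simp
    have center': "center_at_origin (planar_field (\<lambda>x y. - f x y) (\<lambda>x y. - g x y))"
      unfolding eq by (rule center_at_origin_reflect[OF center])
    show False
      by (rule no_contracting_invariant_ray[OF X' ab wh' center' cs, of "- k"]) (use k False in auto)
  qed
qed

text \<open>A continuous function without zeros has constant sign on the connected line; a negative
  sign is absorbed by passing to the opposite angle, that is, by \<sigma> = -1.\<close>

lemma angular_speed_sign:
  assumes fg: "polynomial2 f" "polynomial2 g" and ab: "\<alpha> > 0" "\<beta> > 0"
    and wh: "weight_homogeneous \<alpha> \<beta> \<omega> f g" and center: "center_at_origin (planar_field f g)"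
  obtains \<sigma> :: real where "\<sigma>\<^sup>2 = 1"
    "\<And>\<phi>. \<sigma> * (\<alpha> * cos \<phi> * g (cos \<phi>) (\<sigma> * sin \<phi>) - \<beta> * (\<sigma> * sin \<phi>) * f (cos \<phi>) (\<sigma> * sin \<phi>)) > 0"
proof -
  define b where "b = (\<lambda>\<phi>. \<alpha> * cos \<phi> * g (cos \<phi>) (sin \<phi>) - \<beta> * sin \<phi> * f (cos \<phi>) (sin \<phi>))"
  have nz: "b \<phi> \<noteq> 0" for \<phi>
  proof -
    have "cos \<phi> \<noteq> 0 \<or> sin \<phi> \<noteq> 0" using sin_zero_abs_cos_one[of \<phi>] by force
    then show ?thesis unfolding b_def by (rule angular_speed_nonzero[OF fg ab wh center])
  qed
  have contb: "continuous_on A b" for A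
    unfolding b_def
    by (intro continuous_intros continuous_on_polynomial2[OF fg(1)] continuous_on_polynomial2[OF fg(2)])
  have "connected (range b)" by (rule connected_continuous_image[OF contb connected_UNIV])
  then have sign: "(\<forall>\<phi>. b \<phi> > 0) \<or> (\<forall>\<phi>. b \<phi> < 0)"
  proof -
    have "False" if "b x \<le> 0" "b y \<ge> 0" for x y
      using connectedD_interval[OF \<open>connected (range b)\<close>, of "b x" "b y" 0] that nz by (metis rangeI imageE)
    then show ?thesis by (meson not_less)
  qed
  show ?thesis
  proof (cases "\<forall>\<phi>. b \<phi> > 0")
    case True
    then show ?thesis by (intro that[of 1]) (auto simp: b_def)
  next
    case False
    then have neg: "b (- \<phi>) < 0" for \<phi> using sign by blast
    show ?thesis
    proof (rule that[of "- 1"])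
      show "- 1 * (\<alpha> * cos \<phi> * g (cos \<phi>) (- 1 * sin \<phi>) - \<beta> * (- 1 * sin \<phi>) * f (cos \<phi>) (- 1 * sin \<phi>)) > 0" for \<phi>
        using neg[of \<phi>] unfolding b_def by simp
    qed simp
  qed
qed

lemma first_return_in_periodic_orbit:
  assumes X: "lipschitz_on_bounded X" and C: "periodic_orbit X C" "(x, 0) \<in> C" and r: "first_return X x x'"
  shows "(x', 0) \<in> C"
proof -
  obtain \<gamma> T where \<gamma>: "T > 0" "solution_on X UNIV \<gamma>" "\<forall>t. \<gamma> (t + T) = \<gamma> t" "\<gamma> 0 = (x, 0)" "C = range \<gamma>" "\<exists>t. \<gamma> t \<noteq> (x, 0)"
    by (rule periodic_orbit_through[OF C]) (rule that)
  obtain \<delta> S where \<delta>: "S > 0" "solution_on X {0..S} \<delta>" "\<delta> 0 = (x, 0)" "\<delta> S = (x', 0)"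
    using r unfolding first_return_def by (elim conjE exE) (rule that)
  have "\<gamma> S = \<delta> S"
    using solution_unique[OF X solution_on_subset[OF \<gamma>(2) subset_UNIV] \<delta>(2), of S] \<gamma>(4) \<delta>(1,3) by simp
  then show ?thesis using \<delta>(4) \<gamma>(5) by (metis rangeI)
qed

text \<open>Iterating the return from a point of a periodic orbit near the origin puts a geometric
  sequence on that orbit. The orbit is compact and misses the origin, so the sequence can neither be
  unbounded nor tend to 0.\<close>

lemma center_return_factor:
  assumes X: "lipschitz_on_bounded X" and center: "center_at_origin X" and q: "q > 0"
    and ret: "\<And>x. x > 0 \<Longrightarrow> first_return X x (x * q)"
  shows "q = 1"
proof -
  obtain U where U: "open U" "(0, 0) \<in> U"
    "\<And>p. p \<in> U - {(0, 0)} \<Longrightarrow> \<exists>C. periodic_orbit X C \<and> p \<in> C \<and> C \<subseteq> U - {(0, 0)}"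
    using center unfolding center_at_origin_def by auto
  obtain e where e: "e > 0" "ball (0, 0) e \<subseteq> U" using U(1,2) open_contains_ball by blast
  have "(e / 2, 0) \<in> U" using e by (intro subsetD[OF e(2)]) (simp add: dist_Pair_Pair)
  then obtain C where C: "periodic_orbit X C" "(e / 2, 0) \<in> C" "(0, 0) \<notin> C"
    using U(3)[of "(e / 2, 0)"] e(1) by auto
  have inC: "(e / 2 * q ^ n, 0) \<in> C" for n
  proof (induction n)
    case (Suc n)
    have "first_return X (e / 2 * q ^ n) (e / 2 * q ^ n * q)" using e(1) q by (intro ret) simp
    from first_return_in_periodic_orbit[OF X C(1) Suc this] show ?case by (simp add: mult_ac)
  qed (use C in simp)
  have comp: "compact C" by (rule periodic_orbit_compact[OF C(1)])
  have "\<not> q > 1"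
  proof
    assume "q > 1"
    obtain R where R: "\<And>p. p \<in> C \<Longrightarrow> norm p \<le> R" using compact_imp_bounded[OF comp] by (auto simp: bounded_iff)
    obtain n where "q ^ n > R / (e / 2)" using real_arch_pow[OF \<open>q > 1\<close>] by blast
    then have "e / 2 * q ^ n > R" using e(1) by (simp add: field_simps)
    then show False using R[OF inC[of n]] e(1) q by (simp add: norm_Pair)
  qed
  moreover have "\<not> q < 1"
  proof
    assume "q < 1"
    then have lim: "(\<lambda>n. (e / 2 * q ^ n, 0::real)) \<longlonglongrightarrow> (e / 2 * 0, 0)"
      using q by (intro tendsto_intros LIMSEQ_realpow_zero) auto
    have "(e / 2 * 0, 0::real) \<in> C"
      by (rule closed_sequentially[OF compact_imp_closed[OF comp] inC lim])
    then show False using C(3) by simp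
  qed
  ultimately show ?thesis by simp
qed

section \<open>The return map to first order\<close>

definition deg_indices :: "nat \<Rightarrow> (nat \<times> nat) set" where
  "deg_indices d = (SIGMA i:{..d}. {..d - i})"

lemma finite_deg_indices [simp]: "finite (deg_indices d)"
  by (simp add: deg_indices_def)

lemma card_deg_indices: "2 * card (deg_indices d) = (d + 1) * (d + 2)"
proof (induction d)
  case 0
  show ?case by (simp add: deg_indices_def)
next
  case (Suc d)
  have "card (deg_indices n) = (\<Sum>i\<le>n. Suc (n - i))" for n
    unfolding deg_indices_def by (subst card_SigmaI) auto
  then have "card (deg_indices (Suc d)) = Suc (Suc d) + card (deg_indices d)"
    by (simp add: sum.atMost_Suc_shift del: sum.atMost_Suc)
  then show ?case using Suc by simp
qed

lemma poly2_weighted: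
  "exp (\<kappa> * v) * poly2 d c (exp (\<alpha> * v) * x) (exp (\<beta> * v) * y) =
   (\<Sum>(i, j)\<in>deg_indices d. c i j * (x ^ i * y ^ j * exp ((real i * \<alpha> + real j * \<beta> + \<kappa>) * v)))"
proof -
  have "exp (\<kappa> * v) * (c i j * (exp (\<alpha> * v) * x) ^ i * (exp (\<beta> * v) * y) ^ j)
      = c i j * (x ^ i * y ^ j * exp ((real i * \<alpha> + real j * \<beta> + \<kappa>) * v))" for i j
    by (simp add: power_mult_distrib distrib_right exp_add mult.assoc flip: exp_of_nat_mult)
  then show ?thesis
    unfolding poly2_def deg_indices_def
    by (simp only: sum_distrib_left) (subst sum.Sigma, auto)
qed

text \<open>\<open>Inl\<close> stands for a monomial of \<open>Q\<close>, in the first equation, and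
  \<open>Inr\<close> for one of \<open>P\<close>, in the second; the subtracted term is the weighted
  degree of the unperturbed component in that equation.\<close>

definition weight_exponent :: "real \<Rightarrow> real \<Rightarrow> real \<Rightarrow> (nat \<times> nat) + (nat \<times> nat) \<Rightarrow> real" where
  "weight_exponent \<alpha> \<beta> \<omega> k = (case k of
      Inl (i, j) \<Rightarrow> real i * \<alpha> + real j * \<beta> - (\<omega> + \<alpha>)
    | Inr (i, j) \<Rightarrow> real i * \<alpha> + real j * \<beta> - (\<omega> + \<beta>))"

text \<open>
  The monomial \<^term>\<open>x ^ i * y ^ j\<close> of \<^term>\<open>Q\<close> and the monomial \<^term>\<open>x ^ (i - 1) * y ^ (j + 1)\<close> of
  \<^term>\<open>P\<close> contribute the same exponent. This coincidence is where the bound comes from.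
\<close>

lemma card_weight_exponents:
  "2 * card (weight_exponent \<alpha> \<beta> \<omega> ` (deg_indices d <+> deg_indices d)) \<le> (d + 1) * (d + 4)"
proof -
  \<comment> \<open>A common parametrization: the monomial \<open>(i, j)\<close> of \<open>Q\<close>
    goes to \<open>(i, Suc j)\<close> and that of \<open>P\<close> to \<open>(Suc i, j)\<close>.
    Both have degree at most \<open>d + 1\<close> and neither is \<open>(0, 0)\<close>, which is why
    this pair is removed and one is subtracted from the count.\<close>
  define h where "h = (\<lambda>(i, j). (real i - 1) * \<alpha> + (real j - 1) * \<beta> - \<omega>)"
  let ?T = "deg_indices (Suc d) - {(0, 0)}"
  have "weight_exponent \<alpha> \<beta> \<omega> ` (deg_indices d <+> deg_indices d) \<subseteq> h ` ?T"
  proof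
    fix k assume "k \<in> weight_exponent \<alpha> \<beta> \<omega> ` (deg_indices d <+> deg_indices d)"
    then obtain i j where ij: "(i, j) \<in> deg_indices d"
      and k: "k = weight_exponent \<alpha> \<beta> \<omega> (Inl (i, j)) \<or> k = weight_exponent \<alpha> \<beta> \<omega> (Inr (i, j))"
      by auto
    have "k = h (i, Suc j) \<or> k = h (Suc i, j)"
      using k by (auto simp: h_def weight_exponent_def algebra_simps)
    moreover have "(i, Suc j) \<in> ?T" "(Suc i, j) \<in> ?T" using ij by (auto simp: deg_indices_def)
    ultimately show "k \<in> h ` ?T" by blast
  qed
  then have "card (weight_exponent \<alpha> \<beta> \<omega> ` (deg_indices d <+> deg_indices d)) \<le> card (h ` ?T)"
    by (intro card_mono) auto
  also have "\<dots> \<le> card ?T" by (intro card_image_le) auto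
  also have "\<dots> = card (deg_indices (Suc d)) - 1"
    by (subst card_Diff_singleton) (auto simp: deg_indices_def)
  finally have "2 * card (weight_exponent \<alpha> \<beta> \<omega> ` (deg_indices d <+> deg_indices d)) \<le> 2 * card (deg_indices (Suc d)) - 2"
    by linarith
  also have "\<dots> = (d + 1) * (d + 4)" unfolding card_deg_indices by (simp add: algebra_simps)
  finally show ?thesis .
qed

text \<open>Collecting equal exponents turns a sum over the monomials of both polynomials into one
  over distinct exponents; this is where the coincidences lower the bound.\<close>

lemma exp_comb_eq_exp_sum:
  assumes "finite I"
  shows "exp_comb I e c = exp_sum (e ` I) (\<lambda>k. \<Sum>i\<in>{i\<in>I. e i = k}. c i)"
proof
  fix z :: complex
  have "exp_comb I e c z = (\<Sum>k\<in>e ` I. \<Sum>i\<in>{i\<in>I. e i = k}. of_real (c i) * exp (of_real (e i) * z))"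
    unfolding exp_comb_def by (rule sum.image_gen[OF assms])
  also have "\<dots> = exp_sum (e ` I) (\<lambda>k. \<Sum>i\<in>{i\<in>I. e i = k}. c i) z"
    unfolding exp_sum_def by (auto intro!: sum.cong simp: sum_distrib_right)
  finally show "exp_comb I e c z = exp_sum (e ` I) (\<lambda>k. \<Sum>i\<in>{i\<in>I. e i = k}. c i) z" .
qed

lemma analytic_poly2_familyE:
  assumes "analytic_poly2_family d P"
  obtains c where "\<forall>i j. isCont (c i j) 0" "\<forall>\<^sub>F \<epsilon> in at 0. \<forall>x y. P x y \<epsilon> = poly2 d (\<lambda>i j. c i j \<epsilon>) x y"
proof -
  obtain c where c: "\<And>i j. \<exists>F. (c i j :: real \<Rightarrow> real) has_fps_expansion F"
    "\<forall>\<^sub>F \<epsilon> in nhds 0. \<forall>x y. P x y \<epsilon> = poly2 d (\<lambda>i j. c i j \<epsilon>) x y"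
    using assms unfolding analytic_poly2_family_def by blast
  show ?thesis
  proof
    have "isCont (c i j) 0" for i j
    proof -
      obtain F where "c i j has_fps_expansion F" using c(1) by blast
      then show ?thesis by (rule has_fps_expansion_imp_continuous)
    qed
    then show "\<forall>i j. isCont (c i j) 0" by blast
    show "\<forall>\<^sub>F \<epsilon> in at 0. \<forall>x y. P x y \<epsilon> = poly2 d (\<lambda>i j. c i j \<epsilon>) x y"
      using c(2) by (auto simp: eventually_at_filter elim: eventually_mono)
  qed
qed

text \<open>Subtracting the unperturbed slope from the perturbed one leaves exactly \<epsilon> times
  a numerator linear in the perturbation, over 1 plus \<epsilon> times another linear term: the
  shape required by \<open>perturbed_exponential_flow\<close>.\<close>

lemma perturbed_quotient:
  fixes A B a b \<epsilon> :: real
  assumes "B > 0" "1 + \<epsilon> * (b / B) > 0"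
  shows "A / B + \<epsilon> * ((a * B - A * b) / B\<^sup>2) / (1 + \<epsilon> * (b / B)) = (A + \<epsilon> * a) / (B + \<epsilon> * b)" "B + \<epsilon> * b > 0"
proof -
  have eq: "1 + \<epsilon> * (b / B) = (B + \<epsilon> * b) / B" using assms(1) by (simp add: field_simps)
  show pos: "B + \<epsilon> * b > 0" using assms unfolding eq by (simp add: zero_less_divide_iff)
  have "A / B + \<epsilon> * (n / B\<^sup>2) / (y / B) = (A * y + \<epsilon> * n) / (B * y)" if "y > 0" for n y
    using assms(1) that by (simp add: field_simps power2_eq_square)
  from this[OF pos] have "A / B + \<epsilon> * ((a * B - A * b) / B\<^sup>2) / (1 + \<epsilon> * (b / B))
      = (A * (B + \<epsilon> * b) + \<epsilon> * (a * B - A * b)) / (B * (B + \<epsilon> * b))"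
    unfolding eq .
  also have "A * (B + \<epsilon> * b) + \<epsilon> * (a * B - A * b) = B * (A + \<epsilon> * a)" by (simp add: algebra_simps)
  finally show "A / B + \<epsilon> * ((a * B - A * b) / B\<^sup>2) / (1 + \<epsilon> * (b / B)) = (A + \<epsilon> * a) / (B + \<epsilon> * b)"
    using assms(1) by simp
qed

text \<open>The coefficients \<open>m\<close> are chosen before the interval \<open>{a..b}\<close>:
  a coefficient found nonzero from the Melnikov function at one point then serves for every compact
  set. In the coordinate u = ln(x)/\<alpha> the return map is
  \<open>u + \<epsilon> * Re (Z \<epsilon> u)\<close>.\<close>

lemma return_map_expansion:
  assumes fg: "polynomial2 f" "polynomial2 g" and ab: "\<alpha> > 0" "\<beta> > 0"
    and wh: "weight_homogeneous \<alpha> \<beta> \<omega> f g" and center: "center_at_origin (planar_field f g)"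
    and PQ: "analytic_poly2_family d P" "analytic_poly2_family d Q"
  defines "\<Lambda> \<equiv> weight_exponent \<alpha> \<beta> \<omega> ` (deg_indices d <+> deg_indices d)"
  shows "\<exists>m. \<forall>a b. \<exists>S Z. open S \<and> complex_of_real ` {a..b} \<subseteq> S \<and>
    (\<forall>\<^sub>F \<epsilon> in at 0. Z \<epsilon> holomorphic_on S) \<and> uniform_limit S Z (exp_sum \<Lambda> m) (at 0) \<and>
    (\<forall>\<^sub>F \<epsilon> in at 0. lipschitz_on_bounded (perturbed_field f g P Q \<epsilon>) \<and>
      (\<forall>u\<in>{a..b}. first_return (perturbed_field f g P Q \<epsilon>)
         (exp (\<alpha> * u)) (exp (\<alpha> * (u + \<epsilon> * Re (Z \<epsilon> (of_real u)))))))"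
proof -
  obtain cP where cP: "\<forall>i j. isCont (cP i j) 0" "\<forall>\<^sub>F \<epsilon> in at 0. \<forall>x y. P x y \<epsilon> = poly2 d (\<lambda>i j. cP i j \<epsilon>) x y"
    by (rule analytic_poly2_familyE[OF PQ(1)]) (rule that)
  obtain cQ where cQ: "\<forall>i j. isCont (cQ i j) 0" "\<forall>\<^sub>F \<epsilon> in at 0. \<forall>x y. Q x y \<epsilon> = poly2 d (\<lambda>i j. cQ i j \<epsilon>) x y"
    by (rule analytic_poly2_familyE[OF PQ(2)]) (rule that)
  obtain \<sigma> where \<sigma>: "\<sigma>\<^sup>2 = 1"
    "\<And>\<phi>. \<sigma> * (\<alpha> * cos \<phi> * g (cos \<phi>) (\<sigma> * sin \<phi>) - \<beta> * (\<sigma> * sin \<phi>) * f (cos \<phi>) (\<sigma> * sin \<phi>)) > 0"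
    by (rule angular_speed_sign[OF fg ab wh center]) (rule that)
  define s where "s = (\<lambda>\<phi>. \<sigma> * sin \<phi>)"
  define f' where "f' = (\<lambda>\<phi>. f (cos \<phi>) (s \<phi>))"
  define g' where "g' = (\<lambda>\<phi>. g (cos \<phi>) (s \<phi>))"
  define A where "A = (\<lambda>\<phi>. cos \<phi> * f' \<phi> + s \<phi> * g' \<phi>)"
  define B where "B = (\<lambda>\<phi>. \<sigma> * (\<alpha> * cos \<phi> * g' \<phi> - \<beta> * s \<phi> * f' \<phi>))"
  define H where "H = (\<lambda>\<phi>. integral {0..\<phi>} (\<lambda>\<phi>. A \<phi> / B \<phi>))"
  have Bpos: "B \<phi> > 0" for \<phi> using \<sigma>(2)[of \<phi>] by (simp add: B_def f'_def g'_def s_def)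
  have conts: "continuous_on T s" for T unfolding s_def by (intro continuous_intros)
  have cont': "continuous_on T f'" "continuous_on T g'" for T
    unfolding f'_def g'_def
    by (intro continuous_on_polynomial2[OF fg(1)] continuous_on_polynomial2[OF fg(2)] conts continuous_intros)+
  have contAB: "continuous_on T A" "continuous_on T B" for T
    unfolding A_def B_def by (intro continuous_intros cont' conts)+
  have B0: "B \<phi> \<noteq> 0" for \<phi> using Bpos[of \<phi>] by simp
  have contq: "continuous_on T (\<lambda>\<phi>. A \<phi> / B \<phi>)" for T
    by (intro continuous_on_divide contAB) (use B0 in auto)
  have dH: "(H has_real_derivative A \<phi> / B \<phi>) (at \<phi> within {0..2 * pi})" if "\<phi> \<in> {0..2 * pi}" for \<phi>
    unfolding H_def by (rule integral_has_real_derivative[OF contq that])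
  have H0: "H 0 = 0" by (simp add: H_def)
  have homog: "exp (- \<alpha> * v) * f (exp (\<alpha> * v) * cos \<phi>) (exp (\<beta> * v) * s \<phi>) = exp (\<omega> * v) * f' \<phi>"
    "exp (- \<beta> * v) * g (exp (\<alpha> * v) * cos \<phi>) (exp (\<beta> * v) * s \<phi>) = exp (\<omega> * v) * g' \<phi>" for v \<phi>
    unfolding weight_homogeneous_exp[OF wh] f'_def g'_def
    by (simp_all add: distrib_right exp_add exp_minus)
  \<comment> \<open>Homogeneity gives both components the common factor exp(\<omega> v), which
    cancels in the slope. Hence \<open>u + H\<close> solves the polar equation for every
    \<open>u\<close>, and the unperturbed return is multiplication by a constant, which the center
    forces to be 1.\<close>
  have unperturbed: "first_return (planar_field f g) x (x * exp (\<alpha> * H (2 * pi)))" if "x > 0" for x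
  proof -
    define u where "u = ln x / \<alpha>"
    define v where "v = (\<lambda>\<phi>. u + H \<phi>)"
    have fld: "fst (planar_field f g (weighted_polar \<alpha> \<beta> \<sigma> (v \<phi>) \<phi>)) = f (exp (\<alpha> * v \<phi>) * cos \<phi>) (exp (\<beta> * v \<phi>) * s \<phi>)"
      "snd (planar_field f g (weighted_polar \<alpha> \<beta> \<sigma> (v \<phi>) \<phi>)) = g (exp (\<alpha> * v \<phi>) * cos \<phi>) (exp (\<beta> * v \<phi>) * s \<phi>)" for \<phi>
      by (simp_all add: planar_field_def weighted_polar_def s_def)
    have den: "\<sigma> * (\<alpha> * cos \<phi> * (exp (\<omega> * v \<phi>) * g' \<phi>) - \<beta> * (\<sigma> * sin \<phi>) * (exp (\<omega> * v \<phi>) * f' \<phi>)) = exp (\<omega> * v \<phi>) * B \<phi>" for \<phi>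
      by (simp add: B_def s_def algebra_simps)
    have num: "cos \<phi> * (exp (\<omega> * v \<phi>) * f' \<phi>) + \<sigma> * sin \<phi> * (exp (\<omega> * v \<phi>) * g' \<phi>) = exp (\<omega> * v \<phi>) * A \<phi>" for \<phi>
      by (simp add: A_def s_def algebra_simps)
    have "first_return (planar_field f g) (exp (\<alpha> * v 0)) (exp (\<alpha> * v (2 * pi)))"
    proof (rule first_return_of_polar_solution[OF ab \<sigma>(1) continuous_on_planar_field[OF fg]], goal_cases)
      case (1 \<phi>)
      show ?case unfolding fld homog den using Bpos[of \<phi>] by simp
    next
      case (2 \<phi>)
      show ?case unfolding fld homog den num
        using dH[OF 2] by (auto simp: v_def intro!: derivative_eq_intros)
    qed
    moreover have "exp (\<alpha> * u) = x" using that ab by (simp add: u_def)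
    ultimately show ?thesis by (simp add: v_def H0 distrib_left exp_add)
  qed
  have "exp (\<alpha> * H (2 * pi)) = 1"
    by (rule center_return_factor[OF lipschitz_on_bounded_planar_field[OF fg] center _ unperturbed]) auto
  then have H1: "H (2 * pi) = 0" using ab by simp

  let ?I = "deg_indices d <+> deg_indices d"
  define e where "e = weight_exponent \<alpha> \<beta> \<omega>"
  define c where "c = (\<lambda>k. case k of Inl (i, j) \<Rightarrow> cQ i j | Inr (i, j) \<Rightarrow> cP i j)"
  \<comment> \<open>The factor \<open>exp (e k * H \<phi>)\<close> comes from v = u + H: it moves
    into the angular coefficient and leaves \<open>exp (e k * u)\<close> alone.\<close>
  define w where "w = (\<lambda>k \<phi>. (case k of Inl (i, j) \<Rightarrow> cos \<phi> ^ i * s \<phi> ^ j | Inr (i, j) \<Rightarrow> cos \<phi> ^ i * s \<phi> ^ j) * exp (e k * H \<phi>))"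
  \<comment> \<open>\<open>a'\<close> and \<open>b'\<close> are the weights with which the two
    components of the perturbation enter the radial numerator \<open>A\<close> and the angular
    denominator \<open>B\<close>. The minus signs for \<open>Inr\<close> reflect that
    \<open>P\<close> enters the second equation with a minus.\<close>
  define a' where "a' = (\<lambda>k \<phi>. case k of Inl (i::nat, j::nat) \<Rightarrow> cos \<phi> | Inr (i::nat, j::nat) \<Rightarrow> - s \<phi>)"
  define b' where "b' = (\<lambda>k \<phi>. case k of Inl (i::nat, j::nat) \<Rightarrow> - \<sigma> * \<beta> * s \<phi> | Inr (i::nat, j::nat) \<Rightarrow> - \<sigma> * \<alpha> * cos \<phi>)"
  define p where "p = (\<lambda>k \<phi>. w k \<phi> * ((a' k \<phi> * B \<phi> - A \<phi> * b' k \<phi>) / (B \<phi>)\<^sup>2))"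
  define q where "q = (\<lambda>k \<phi>. w k \<phi> * (b' k \<phi> / B \<phi>))"
  have contH: "continuous_on {0..2 * pi} H" using dH by (rule DERIV_continuous_on)
  have contw: "continuous_on {0..2 * pi} (w k)" for k
    unfolding w_def by (cases k) (auto split: prod.splits intro!: continuous_intros conts contH)
  have conta: "continuous_on {0..2 * pi} (a' k)" "continuous_on {0..2 * pi} (b' k)" for k
    unfolding a'_def b'_def by (cases k; auto split: prod.splits intro!: continuous_intros conts)+
  have contp: "continuous_on {0..2 * pi} (p k)" "continuous_on {0..2 * pi} (q k)" for k
    unfolding p_def q_def by (intro continuous_intros contw conta contAB; use B0 in simp)+
  have contc: "isCont (c k) 0" for k
    unfolding c_def using cP cQ by (cases k) (auto split: prod.splits)
  define m where "m = (\<lambda>k. \<Sum>i\<in>{i\<in>?I. e i = k}. c i 0 * integral {0..2 * pi} (p i))"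
  have lim_eq: "exp_comb ?I e (\<lambda>i. c i 0 * integral {0..2 * pi} (p i)) = exp_sum \<Lambda> m"
    unfolding \<Lambda>_def e_def[symmetric] m_def by (rule exp_comb_eq_exp_sum) simp

  show ?thesis
  proof (intro exI[of _ m] allI)
    fix a b :: real
    obtain S Z where SZ: "open S" "complex_of_real ` {a..b} \<subseteq> S"
      "\<forall>\<^sub>F \<epsilon> in at 0. Z \<epsilon> holomorphic_on S" "uniform_limit S Z (exp_sum \<Lambda> m) (at 0)"
      "\<forall>\<^sub>F \<epsilon> in at 0. \<forall>u\<in>{a..b}. \<exists>V. V 0 = u \<and> V (2 * pi) = u + \<epsilon> * Re (Z \<epsilon> (of_real u)) \<and>
       (\<forall>\<phi>\<in>{0..2 * pi}. 1 + \<epsilon> * exp_comb ?I e (\<lambda>i. c i \<epsilon> * q i \<phi>) (V \<phi>) > 0 \<and>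
          (V has_real_derivative \<epsilon> * exp_comb ?I e (\<lambda>i. c i \<epsilon> * p i \<phi>) (V \<phi>) /
             (1 + \<epsilon> * exp_comb ?I e (\<lambda>i. c i \<epsilon> * q i \<phi>) (V \<phi>))) (at \<phi> within {0..2 * pi}))"
    proof -
      have fin: "finite ?I" "2 * pi \<ge> 0" by auto
      show thesis
        using perturbed_exponential_flow[where e = e and c = c and p = p and q = q and a = a and b = b, OF fin contc contp]
        unfolding lim_eq by (elim exE conjE) (rule that)
    qed
    have "\<forall>\<^sub>F \<epsilon> in at 0. lipschitz_on_bounded (perturbed_field f g P Q \<epsilon>) \<and>
      (\<forall>u\<in>{a..b}. first_return (perturbed_field f g P Q \<epsilon>)
         (exp (\<alpha> * u)) (exp (\<alpha> * (u + \<epsilon> * Re (Z \<epsilon> (of_real u))))))"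
      using cP(2) cQ(2) SZ(5)
    proof eventually_elim
      case (elim \<epsilon>)
      let ?X = "perturbed_field f g P Q \<epsilon>"
      note PQeq = elim(1)[rule_format] elim(2)[rule_format]
      obtain n1 c1 where f: "\<And>x y. f x y = poly2 n1 c1 x y" using fg(1) unfolding polynomial2_def by blast
      obtain n2 c2 where g: "\<And>x y. g x y = poly2 n2 c2 x y" using fg(2) unfolding polynomial2_def by blast
      have Xeq: "?X = (\<lambda>p. (poly2 n1 c1 (fst p) (snd p) + \<epsilon> * poly2 d (\<lambda>i j. cQ i j \<epsilon>) (fst p) (snd p),
           poly2 n2 c2 (fst p) (snd p) - \<epsilon> * poly2 d (\<lambda>i j. cP i j \<epsilon>) (fst p) (snd p)))"
        by (auto simp: perturbed_field_def planar_field_def f g PQeq)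
      have lipX: "lipschitz_on_bounded ?X"
        unfolding Xeq
        by (intro lipschitz_on_bounded_Pair lipschitz_on_bounded_real_polynomial_function
            real_polynomial_function.intros(2-4) real_polynomial_function_diff real_polynomial_function_poly2)
      have contX: "continuous_on UNIV ?X"
        unfolding Xeq by (intro continuous_intros)
      have "first_return ?X (exp (\<alpha> * u)) (exp (\<alpha> * (u + \<epsilon> * Re (Z \<epsilon> (of_real u)))))" if u: "u \<in> {a..b}" for u
      proof -
        obtain V where V: "V 0 = u" "V (2 * pi) = u + \<epsilon> * Re (Z \<epsilon> (of_real u))"
          and sol: "\<forall>\<phi>\<in>{0..2 * pi}. 1 + \<epsilon> * exp_comb ?I e (\<lambda>i. c i \<epsilon> * q i \<phi>) (V \<phi>) > 0 \<and>
            (V has_real_derivative \<epsilon> * exp_comb ?I e (\<lambda>i. c i \<epsilon> * p i \<phi>) (V \<phi>) /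
              (1 + \<epsilon> * exp_comb ?I e (\<lambda>i. c i \<epsilon> * q i \<phi>) (V \<phi>))) (at \<phi> within {0..2 * pi})"
          using bspec[OF elim(3) u] by (elim exE conjE) (rule that)
        define v where "v = (\<lambda>\<phi>. V \<phi> + H \<phi>)"
        define p1 where "p1 = (\<lambda>\<phi>. exp (\<alpha> * v \<phi>) * cos \<phi>)"
        define p2 where "p2 = (\<lambda>\<phi>. exp (\<beta> * v \<phi>) * s \<phi>)"
        define q1 where "q1 = (\<lambda>\<phi>. exp (- (\<omega> + \<alpha>) * v \<phi>) * Q (p1 \<phi>) (p2 \<phi>) \<epsilon>)"
        define q2 where "q2 = (\<lambda>\<phi>. exp (- (\<omega> + \<beta>) * v \<phi>) * P (p1 \<phi>) (p2 \<phi>) \<epsilon>)"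
        \<comment> \<open>\<open>as\<close> and \<open>bs\<close> are the increments of
          \<open>A\<close> and \<open>B\<close>, per unit of \<epsilon>, when \<open>f'\<close>
          becomes \<open>f' + \<epsilon> * q1\<close> and \<open>g'\<close> becomes
          \<open>g' - \<epsilon> * q2\<close>.\<close>
        define as where "as = (\<lambda>\<phi>. cos \<phi> * q1 \<phi> - s \<phi> * q2 \<phi>)"
        define bs where "bs = (\<lambda>\<phi>. - \<sigma> * \<beta> * s \<phi> * q1 \<phi> - \<sigma> * \<alpha> * cos \<phi> * q2 \<phi>)"
        have wexp: "w k \<phi> * exp (e k * V \<phi>) =
            (case k of Inl (i, j) \<Rightarrow> cos \<phi> ^ i * s \<phi> ^ j | Inr (i, j) \<Rightarrow> cos \<phi> ^ i * s \<phi> ^ j) * exp (e k * v \<phi>)" for k \<phi>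
          by (simp add: w_def v_def distrib_left exp_add mult_ac)
        have q1: "q1 \<phi> = (\<Sum>k\<in>deg_indices d. c (Inl k) \<epsilon> * (w (Inl k) \<phi> * exp (e (Inl k) * V \<phi>)))" for \<phi>
          unfolding q1_def PQeq p1_def p2_def poly2_weighted wexp
          by (intro sum.cong refl) (simp add: c_def e_def weight_exponent_def split_beta del: minus_add_distrib)
        have q2: "q2 \<phi> = (\<Sum>k\<in>deg_indices d. c (Inr k) \<epsilon> * (w (Inr k) \<phi> * exp (e (Inr k) * V \<phi>)))" for \<phi>
          unfolding q2_def PQeq p1_def p2_def poly2_weighted wexp
          by (intro sum.cong refl) (simp add: c_def e_def weight_exponent_def split_beta del: minus_add_distrib)
        have comb: "exp_comb ?I e (\<lambda>k. c k \<epsilon> * (w k \<phi> * r k)) (V \<phi>) =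
            (\<Sum>k\<in>deg_indices d. c (Inl k) \<epsilon> * (w (Inl k) \<phi> * exp (e (Inl k) * V \<phi>)) * r (Inl k)) +
            (\<Sum>k\<in>deg_indices d. c (Inr k) \<epsilon> * (w (Inr k) \<phi> * exp (e (Inr k) * V \<phi>)) * r (Inr k))" for r \<phi>
          unfolding exp_comb_def by (simp add: sum.Plus mult_ac)
        have combp: "exp_comb ?I e (\<lambda>k. c k \<epsilon> * p k \<phi>) (V \<phi>) = (as \<phi> * B \<phi> - A \<phi> * bs \<phi>) / (B \<phi>)\<^sup>2" for \<phi>
        proof -
          have "exp_comb ?I e (\<lambda>k. c k \<epsilon> * p k \<phi>) (V \<phi>) =
              q1 \<phi> * ((cos \<phi> * B \<phi> - A \<phi> * (- \<sigma> * \<beta> * s \<phi>)) / (B \<phi>)\<^sup>2) +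
              q2 \<phi> * ((- s \<phi> * B \<phi> - A \<phi> * (- \<sigma> * \<alpha> * cos \<phi>)) / (B \<phi>)\<^sup>2)"
            unfolding p_def comb q1 q2 sum_distrib_right by (simp add: a'_def b'_def split_beta)
          also have "\<dots> = (as \<phi> * B \<phi> - A \<phi> * bs \<phi>) / (B \<phi>)\<^sup>2"
            by (simp add: as_def bs_def algebra_simps diff_divide_distrib add_divide_distrib)
          finally show ?thesis .
        qed
        have combq: "exp_comb ?I e (\<lambda>k. c k \<epsilon> * q k \<phi>) (V \<phi>) = bs \<phi> / B \<phi>" for \<phi>
        proof -
          have "exp_comb ?I e (\<lambda>k. c k \<epsilon> * q k \<phi>) (V \<phi>) =
              q1 \<phi> * ((- \<sigma> * \<beta> * s \<phi>) / B \<phi>) + q2 \<phi> * ((- \<sigma> * \<alpha> * cos \<phi>) / B \<phi>)"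
            unfolding q_def comb q1 q2 sum_distrib_right by (simp add: b'_def split_beta)
          also have "\<dots> = bs \<phi> / B \<phi>"
            by (simp add: bs_def algebra_simps diff_divide_distrib)
          finally show ?thesis .
        qed
        have fld: "exp (- \<alpha> * v \<phi>) * fst (?X (weighted_polar \<alpha> \<beta> \<sigma> (v \<phi>) \<phi>)) = exp (\<omega> * v \<phi>) * (f' \<phi> + \<epsilon> * q1 \<phi>)"
          "exp (- \<beta> * v \<phi>) * snd (?X (weighted_polar \<alpha> \<beta> \<sigma> (v \<phi>) \<phi>)) = exp (\<omega> * v \<phi>) * (g' \<phi> - \<epsilon> * q2 \<phi>)" for \<phi>
        proof -
          have ee: "exp (- \<alpha> * v \<phi>) = exp (\<omega> * v \<phi>) * exp (- (\<omega> + \<alpha>) * v \<phi>)"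
            "exp (- \<beta> * v \<phi>) = exp (\<omega> * v \<phi>) * exp (- (\<omega> + \<beta>) * v \<phi>)"
            by (simp_all add: algebra_simps flip: exp_add)
          have "exp (- \<alpha> * v \<phi>) * fst (?X (weighted_polar \<alpha> \<beta> \<sigma> (v \<phi>) \<phi>)) =
              exp (- \<alpha> * v \<phi>) * f (p1 \<phi>) (p2 \<phi>) + \<epsilon> * (exp (- \<alpha> * v \<phi>) * Q (p1 \<phi>) (p2 \<phi>) \<epsilon>)"
            by (simp add: perturbed_field_def planar_field_def weighted_polar_def p1_def p2_def s_def algebra_simps)
          also have "exp (- \<alpha> * v \<phi>) * Q (p1 \<phi>) (p2 \<phi>) \<epsilon> = exp (\<omega> * v \<phi>) * q1 \<phi>"
            unfolding q1_def ee(1) by (simp only: mult.assoc)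
          finally show "exp (- \<alpha> * v \<phi>) * fst (?X (weighted_polar \<alpha> \<beta> \<sigma> (v \<phi>) \<phi>)) = exp (\<omega> * v \<phi>) * (f' \<phi> + \<epsilon> * q1 \<phi>)"
            unfolding p1_def p2_def homog by (simp add: algebra_simps)
          have "exp (- \<beta> * v \<phi>) * snd (?X (weighted_polar \<alpha> \<beta> \<sigma> (v \<phi>) \<phi>)) =
              exp (- \<beta> * v \<phi>) * g (p1 \<phi>) (p2 \<phi>) - \<epsilon> * (exp (- \<beta> * v \<phi>) * P (p1 \<phi>) (p2 \<phi>) \<epsilon>)"
            by (simp add: perturbed_field_def planar_field_def weighted_polar_def p1_def p2_def s_def algebra_simps)
          also have "exp (- \<beta> * v \<phi>) * P (p1 \<phi>) (p2 \<phi>) \<epsilon> = exp (\<omega> * v \<phi>) * q2 \<phi>"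
            unfolding q2_def ee(2) by (simp only: mult.assoc)
          finally show "exp (- \<beta> * v \<phi>) * snd (?X (weighted_polar \<alpha> \<beta> \<sigma> (v \<phi>) \<phi>)) = exp (\<omega> * v \<phi>) * (g' \<phi> - \<epsilon> * q2 \<phi>)"
            unfolding p1_def p2_def homog by (simp add: algebra_simps)
        qed
        have den: "\<sigma> * (\<alpha> * cos \<phi> * (exp (\<omega> * v \<phi>) * (g' \<phi> - \<epsilon> * q2 \<phi>)) - \<beta> * (\<sigma> * sin \<phi>) * (exp (\<omega> * v \<phi>) * (f' \<phi> + \<epsilon> * q1 \<phi>)))
            = exp (\<omega> * v \<phi>) * (B \<phi> + \<epsilon> * bs \<phi>)" for \<phi>
          by (simp add: B_def bs_def s_def algebra_simps)
        have num: "cos \<phi> * (exp (\<omega> * v \<phi>) * (f' \<phi> + \<epsilon> * q1 \<phi>)) + \<sigma> * sin \<phi> * (exp (\<omega> * v \<phi>) * (g' \<phi> - \<epsilon> * q2 \<phi>))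
            = exp (\<omega> * v \<phi>) * (A \<phi> + \<epsilon> * as \<phi>)" for \<phi>
          by (simp add: A_def as_def s_def algebra_simps)
        have pos: "1 + \<epsilon> * (bs \<phi> / B \<phi>) > 0" if "\<phi> \<in> {0..2 * pi}" for \<phi>
          using bspec[OF sol that, THEN conjunct1] unfolding combq .
        have dv: "(v has_real_derivative (A \<phi> + \<epsilon> * as \<phi>) / (B \<phi> + \<epsilon> * bs \<phi>)) (at \<phi> within {0..2 * pi})"
          if \<phi>: "\<phi> \<in> {0..2 * pi}" for \<phi>
        proof -
          have "(v has_real_derivative \<epsilon> * ((as \<phi> * B \<phi> - A \<phi> * bs \<phi>) / (B \<phi>)\<^sup>2) / (1 + \<epsilon> * (bs \<phi> / B \<phi>)) + A \<phi> / B \<phi>)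
              (at \<phi> within {0..2 * pi})"
            unfolding v_def using bspec[OF sol \<phi>, THEN conjunct2] dH[OF \<phi>] unfolding combp combq by (rule DERIV_add)
          then show ?thesis
            using perturbed_quotient(1)[OF Bpos[of \<phi>] pos[OF \<phi>], of "A \<phi>" "as \<phi>"] by (simp only: add.commute)
        qed
        have "first_return ?X (exp (\<alpha> * v 0)) (exp (\<alpha> * v (2 * pi)))"
        proof (rule first_return_of_polar_solution[OF ab \<sigma>(1) contX], goal_cases)
          case (1 \<phi>)
          show ?case unfolding fld den using perturbed_quotient(2)[OF Bpos[of \<phi>] pos[OF 1]] by simp
        next
          case (2 \<phi>)
          show ?case unfolding fld den num using dv[OF 2] by simp
        qed
        \<comment> \<open>Because \<open>H\<close> vanishes at both ends of the turn, the return in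
          \<open>v\<close> is the return in \<open>u\<close>.\<close>
        then show ?thesis by (simp add: v_def V H0 H1)
      qed
      then show ?case using lipX by blast
    qed
    then show "\<exists>S Z. open S \<and> complex_of_real ` {a..b} \<subseteq> S \<and>
      (\<forall>\<^sub>F \<epsilon> in at 0. Z \<epsilon> holomorphic_on S) \<and> uniform_limit S Z (exp_sum \<Lambda> m) (at 0) \<and>
      (\<forall>\<^sub>F \<epsilon> in at 0. lipschitz_on_bounded (perturbed_field f g P Q \<epsilon>) \<and>
        (\<forall>u\<in>{a..b}. first_return (perturbed_field f g P Q \<epsilon>)
           (exp (\<alpha> * u)) (exp (\<alpha> * (u + \<epsilon> * Re (Z \<epsilon> (of_real u)))))))"
      using SZ(1-4) by blast
  qed
qed

section \<open>From the return map to the Melnikov function and the bound\<close>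

lemma abs_exp_minus_one_le: "\<bar>exp y - 1\<bar> \<le> \<bar>y\<bar> * exp \<bar>y\<bar>" for y :: real
proof (cases "y \<ge> 0")
  case True
  have "exp y * (1 - exp (- y)) \<le> exp y * y"
    using exp_ge_add_one_self[of "- y"] by (intro mult_left_mono) auto
  then have "exp y - 1 \<le> exp y * y" by (simp add: right_diff_distrib flip: exp_add)
  then show ?thesis using True by (simp add: mult.commute)
next
  case False
  have "1 - exp y \<le> - y" using exp_ge_add_one_self[of y] by linarith
  also have "- y \<le> - y * exp (- y)" using False mult_left_mono[of 1 "exp (- y)" "- y"] by simp
  finally show ?thesis using False by (simp add: abs_if)
qed

lemma melnikov1_eqI:
  assumes "(\<lambda>\<epsilon>. return_map (X \<epsilon>) x - (x + \<epsilon> * m)) \<in> o[at 0](\<lambda>\<epsilon>. \<epsilon>)"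
  shows "melnikov1 X x = m"
  unfolding melnikov1_def
proof (rule the_equality, rule assms)
  fix m' assume "(\<lambda>\<epsilon>. return_map (X \<epsilon>) x - (x + \<epsilon> * m')) \<in> o[at 0](\<lambda>\<epsilon>. \<epsilon>)"
  from sum_in_smallo(2)[OF assms this]
  have "(\<lambda>\<epsilon>. \<epsilon> * (m' - m)) \<in> o[at 0](\<lambda>\<epsilon>. \<epsilon>)" by (simp add: algebra_simps)
  then have "((\<lambda>\<epsilon>. \<epsilon> * (m' - m) / \<epsilon>) \<longlongrightarrow> 0) (at 0)" by (rule smalloD_tendsto)
  moreover have "\<forall>\<^sub>F \<epsilon> in at 0. \<epsilon> * (m' - m) / \<epsilon> = m' - m" by (auto simp: eventually_at_filter)
  ultimately have "((\<lambda>\<epsilon>::real. m' - m) \<longlongrightarrow> 0) (at 0)" by (rule Lim_transform_eventually)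
  then have "m' - m = 0" by (simp add: tendsto_const_iff)
  then show "m' = m" by simp
qed

text \<open>Read contrapositively: a nonzero Melnikov value prevents the rescaled displacement from
  tending to 0, so its limiting exponential sum has a nonzero coefficient.\<close>

lemma melnikov1_eq_0:
  assumes ret: "\<forall>\<^sub>F \<epsilon> in at 0. return_map (X \<epsilon>) x = x * exp (\<epsilon> * z \<epsilon>)" and z: "(z \<longlongrightarrow> 0) (at 0)"
  shows "melnikov1 X x = 0"
proof (rule melnikov1_eqI, rule smalloI_tendsto)
  have "((\<lambda>\<epsilon>. \<bar>x\<bar> * (\<bar>z \<epsilon>\<bar> * exp \<bar>\<epsilon> * z \<epsilon>\<bar>)) \<longlongrightarrow> \<bar>x\<bar> * (\<bar>0\<bar> * exp \<bar>0 * 0\<bar>)) (at 0)"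
    by (intro tendsto_intros z)
  then have lim: "((\<lambda>\<epsilon>. \<bar>x\<bar> * (\<bar>z \<epsilon>\<bar> * exp \<bar>\<epsilon> * z \<epsilon>\<bar>)) \<longlongrightarrow> 0) (at 0)" by simp
  show "((\<lambda>\<epsilon>. (return_map (X \<epsilon>) x - (x + \<epsilon> * 0)) / \<epsilon>) \<longlongrightarrow> 0) (at 0)"
  proof (rule Lim_null_comparison[OF _ lim])
    have "\<forall>\<^sub>F \<epsilon> in at (0::real). \<epsilon> \<noteq> 0" by (simp add: eventually_at_filter)
    with ret show "\<forall>\<^sub>F \<epsilon> in at 0. norm ((return_map (X \<epsilon>) x - (x + \<epsilon> * 0)) / \<epsilon>) \<le> \<bar>x\<bar> * (\<bar>z \<epsilon>\<bar> * exp \<bar>\<epsilon> * z \<epsilon>\<bar>)"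
    proof eventually_elim
      case (elim \<epsilon>)
      have "\<bar>x * exp (\<epsilon> * z \<epsilon>) - x\<bar> = \<bar>x\<bar> * \<bar>exp (\<epsilon> * z \<epsilon>) - 1\<bar>"
        by (simp add: algebra_simps flip: abs_mult)
      also have "\<dots> \<le> \<bar>x\<bar> * (\<bar>\<epsilon> * z \<epsilon>\<bar> * exp \<bar>\<epsilon> * z \<epsilon>\<bar>)"
        by (intro mult_left_mono abs_exp_minus_one_le) simp
      finally show ?case using elim by (simp add: abs_mult pos_divide_le_eq mult_ac)
    qed
  qed
  show "\<forall>\<^sub>F \<epsilon> in at (0::real). \<epsilon> \<noteq> 0" by (simp add: eventually_at_filter)
qed

theorem theorem1:
  fixes f g :: "real \<Rightarrow> real \<Rightarrow> real"
    and P Q :: "real \<Rightarrow> real \<Rightarrow> real \<Rightarrow> real"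
    and \<alpha> \<beta> \<omega> :: real
    and d :: nat
  assumes "polynomial2 f" and "polynomial2 g"
    and "\<alpha> > 0" and "\<beta> > 0"
    and "weight_homogeneous \<alpha> \<beta> \<omega> f g"
    and "center_at_origin (planar_field f g)"
    and "analytic_poly2_family d P" and "analytic_poly2_family d Q"
    and "\<exists>x>0. melnikov1 (perturbed_field f g P Q) x \<noteq> 0"
  shows "\<forall>K. compact K \<and> K \<subseteq> {0<..} \<longrightarrow>
    (\<exists>\<epsilon>0>0. \<forall>\<epsilon>. 0 < \<bar>\<epsilon>\<bar> \<and> \<bar>\<epsilon>\<bar> < \<epsilon>0 \<longrightarrow>
      finite {x\<in>K. first_return (perturbed_field f g P Q \<epsilon>) x x \<and>
                   (\<exists>C. limit_cycle (perturbed_field f g P Q \<epsilon>) C \<and> (x, 0) \<in> C)} \<and>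
      real (card {x\<in>K. first_return (perturbed_field f g P Q \<epsilon>) x x \<and>
                   (\<exists>C. limit_cycle (perturbed_field f g P Q \<epsilon>) C \<and> (x, 0) \<in> C)})
        \<le> (real d + 1) * (real d + 4) / 2 - 1)"
proof (intro allI impI)
  fix K :: "real set" assume K: "compact K \<and> K \<subseteq> {0<..}"
  let ?X = "perturbed_field f g P Q"
  define \<Lambda> where "\<Lambda> = weight_exponent \<alpha> \<beta> \<omega> ` (deg_indices d <+> deg_indices d)"
  have fin\<Lambda>: "finite \<Lambda>" by (simp add: \<Lambda>_def)
  have card\<Lambda>: "2 * card \<Lambda> \<le> (d + 1) * (d + 4)" unfolding \<Lambda>_def by (rule card_weight_exponents)
  obtain m where m: "\<forall>a b. \<exists>S Z. open S \<and> complex_of_real ` {a..b} \<subseteq> S \<and>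
    (\<forall>\<^sub>F \<epsilon> in at 0. Z \<epsilon> holomorphic_on S) \<and> uniform_limit S Z (exp_sum \<Lambda> m) (at 0) \<and>
    (\<forall>\<^sub>F \<epsilon> in at 0. lipschitz_on_bounded (?X \<epsilon>) \<and>
      (\<forall>u\<in>{a..b}. first_return (?X \<epsilon>) (exp (\<alpha> * u)) (exp (\<alpha> * (u + \<epsilon> * Re (Z \<epsilon> (of_real u)))))))"
    using return_map_expansion[OF assms(1-8)] unfolding \<Lambda>_def[symmetric] by (elim exE) (rule that)
  have "\<exists>k0\<in>\<Lambda>. m k0 \<noteq> 0"
  proof (rule ccontr)
    assume "\<not> (\<exists>k0\<in>\<Lambda>. m k0 \<noteq> 0)"
    then have zero: "exp_sum \<Lambda> m z = 0" for z by (simp add: exp_sum_def)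
    have "melnikov1 ?X x = 0" if "x > 0" for x
    proof -
      define u where "u = ln x / \<alpha>"
      have xu: "exp (\<alpha> * u) = x" using that assms(3) by (simp add: u_def)
      \<comment> \<open>A single point is treated as the degenerate interval \<open>{u..u}\<close>,
        with the coefficients \<open>m\<close> already fixed.\<close>
      obtain S Z where SZ: "open S" "complex_of_real ` {u..u} \<subseteq> S" "\<forall>\<^sub>F \<epsilon> in at 0. Z \<epsilon> holomorphic_on S"
        "uniform_limit S Z (exp_sum \<Lambda> m) (at 0)"
        "\<forall>\<^sub>F \<epsilon> in at 0. lipschitz_on_bounded (?X \<epsilon>) \<and>
          (\<forall>v\<in>{u..u}. first_return (?X \<epsilon>) (exp (\<alpha> * v)) (exp (\<alpha> * (v + \<epsilon> * Re (Z \<epsilon> (of_real v))))))"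
        using m[rule_format, of u u] by (elim exE conjE) (rule that)
      show ?thesis
      proof (rule melnikov1_eq_0)
        show "\<forall>\<^sub>F \<epsilon> in at 0. return_map (?X \<epsilon>) x = x * exp (\<epsilon> * (\<alpha> * Re (Z \<epsilon> (of_real u))))"
          using SZ(5)
        proof eventually_elim
          case (elim \<epsilon>)
          then have "return_map (?X \<epsilon>) (exp (\<alpha> * u)) = exp (\<alpha> * (u + \<epsilon> * Re (Z \<epsilon> (of_real u))))"
            by (intro return_map_eqI) auto
          also have "\<dots> = exp (\<alpha> * u) * exp (\<epsilon> * (\<alpha> * Re (Z \<epsilon> (of_real u))))"
            by (simp add: distrib_left mult_ac flip: exp_add)
          finally show ?case unfolding xu .
        qed
        have "((\<lambda>\<epsilon>. Z \<epsilon> (of_real u)) \<longlongrightarrow> exp_sum \<Lambda> m (of_real u)) (at 0)"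
          by (rule tendsto_uniform_limitI[OF SZ(4)]) (use SZ(2) in auto)
        then have "((\<lambda>\<epsilon>. \<alpha> * Re (Z \<epsilon> (of_real u))) \<longlongrightarrow> \<alpha> * Re 0) (at 0)"
          unfolding zero by (intro tendsto_intros)
        then show "((\<lambda>\<epsilon>. \<alpha> * Re (Z \<epsilon> (of_real u))) \<longlongrightarrow> 0) (at 0)" by simp
      qed
    qed
    then show False using assms(9) by blast
  qed
  then obtain k0 where k0: "k0 \<in> \<Lambda>" "m k0 \<noteq> 0" by blast

  \<comment> \<open>Compactness inside the open half-axis bounds ln(x)/\<alpha> on both sides, away
    from the origin and from infinity, so one interval \<open>{- R..R}\<close> and one range of
    \<epsilon> serve for all of \<open>K\<close>.\<close>
  have "continuous_on K (\<lambda>x. ln x / \<alpha>)" using K assms(3) by (intro continuous_intros) auto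
  then have "bounded ((\<lambda>x. ln x / \<alpha>) ` K)" using K by (intro compact_imp_bounded compact_continuous_image) auto
  then obtain R where R: "\<forall>y\<in>(\<lambda>x. ln x / \<alpha>) ` K. norm y \<le> R" unfolding bounded_iff by blast
  have Ku: "ln x / \<alpha> \<in> {- R..R}" "exp (\<alpha> * (ln x / \<alpha>)) = x" if "x \<in> K" for x
    using R that K assms(3) by (auto simp: abs_le_iff)
  obtain S Z where SZ: "open S" "complex_of_real ` {- R..R} \<subseteq> S" "\<forall>\<^sub>F \<epsilon> in at 0. Z \<epsilon> holomorphic_on S"
    "uniform_limit S Z (exp_sum \<Lambda> m) (at 0)"
    "\<forall>\<^sub>F \<epsilon> in at 0. lipschitz_on_bounded (?X \<epsilon>) \<and>
      (\<forall>u\<in>{- R..R}. first_return (?X \<epsilon>) (exp (\<alpha> * u)) (exp (\<alpha> * (u + \<epsilon> * Re (Z \<epsilon> (of_real u))))))"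
    using m[rule_format, of "- R" R] by (elim exE conjE) (rule that)
  have few: "\<forall>\<^sub>F \<epsilon> in at 0. \<forall>Y. finite Y \<longrightarrow> Y \<subseteq> {- R..R} \<longrightarrow> (\<forall>u\<in>Y. Re (Z \<epsilon> (of_real u)) = 0) \<longrightarrow>
           card Y \<noteq> card \<Lambda>"
    by (rule eventually_few_zeros_near_exp_sum[OF SZ(1,2) uniform_limit_on_subset[OF SZ(4)] SZ(3) fin\<Lambda> k0])
  have "\<forall>\<^sub>F \<epsilon> in at (0::real). \<epsilon> \<noteq> 0" by (simp add: eventually_at_filter)
  with few SZ(5) have "\<forall>\<^sub>F \<epsilon> in at 0.
      finite {x\<in>K. first_return (?X \<epsilon>) x x \<and> (\<exists>C. limit_cycle (?X \<epsilon>) C \<and> (x, 0) \<in> C)} \<and>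
      real (card {x\<in>K. first_return (?X \<epsilon>) x x \<and> (\<exists>C. limit_cycle (?X \<epsilon>) C \<and> (x, 0) \<in> C)})
        \<le> (real d + 1) * (real d + 4) / 2 - 1"
  proof eventually_elim
    case (elim \<epsilon>)
    define F where "F = {x\<in>K. first_return (?X \<epsilon>) x x \<and> (\<exists>C. limit_cycle (?X \<epsilon>) C \<and> (x, 0) \<in> C)}"
    have zero: "Re (Z \<epsilon> (of_real (ln x / \<alpha>))) = 0" if "x \<in> F" for x
    proof -
      define u where "u = ln x / \<alpha>"
      have x: "x \<in> K" "first_return (?X \<epsilon>) x x" using that by (auto simp: F_def)
      have u: "u \<in> {- R..R}" "exp (\<alpha> * u) = x" using Ku[OF x(1)] by (simp_all add: u_def)
      have "first_return (?X \<epsilon>) x (exp (\<alpha> * (u + \<epsilon> * Re (Z \<epsilon> (of_real u)))))"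
        using elim(2) u by auto
      then have "exp (\<alpha> * u) = exp (\<alpha> * (u + \<epsilon> * Re (Z \<epsilon> (of_real u))))"
        using first_return_unique[of "?X \<epsilon>" x x] elim(2) x(2) u(2) by auto
      then have "Re (Z \<epsilon> (of_real u)) = 0" using elim(3) assms(3) by simp
      then show ?thesis unfolding u_def .
    qed
    have inj: "inj_on (\<lambda>x. ln x / \<alpha>) F"
      by (rule inj_on_inverseI[where g = "\<lambda>u. exp (\<alpha> * u)"]) (use Ku(2) in \<open>auto simp: F_def\<close>)
    \<comment> \<open>\<open>few\<close> forbids zero sets of size exactly
      \<open>card \<Lambda>\<close>. Any larger or infinite set of fixed points would contain a
      subset of that size, which gives both finiteness and the strict inequality.\<close>
    have no: "card Y \<noteq> card \<Lambda>" if Y: "finite Y" "Y \<subseteq> F" for Y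
    proof -
      have "card ((\<lambda>x. ln x / \<alpha>) ` Y) \<noteq> card \<Lambda>"
      proof (rule elim(1)[rule_format])
        show "(\<lambda>x. ln x / \<alpha>) ` Y \<subseteq> {- R..R}"
          using Y(2) Ku(1) unfolding F_def by blast
        fix u assume "u \<in> (\<lambda>x. ln x / \<alpha>) ` Y"
        then obtain x where "u = ln x / \<alpha>" "x \<in> F" using Y(2) by blast
        then show "Re (Z \<epsilon> (of_real u)) = 0" using zero by blast
      qed (use Y(1) in simp)
      then show ?thesis using card_image[OF inj_on_subset[OF inj Y(2)]] by simp
    qed
    have finF: "finite F"
      using infinite_arbitrarily_large[of F "card \<Lambda>"] no by blast
    have "card F < card \<Lambda>"
    proof (rule ccontr)
      assume "\<not> card F < card \<Lambda>"
      then obtain Y where "Y \<subseteq> F" "card Y = card \<Lambda>" "finite Y"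
        using obtain_subset_with_card_n[of "card \<Lambda>" F] by (metis not_less)
      then show False using no by blast
    qed
    \<comment> \<open>The strict inequality supplies the -1; \<open>k0\<close> in \<Lambda> makes
      the right-hand side nonnegative.\<close>
    then have "real (card F) \<le> real (card \<Lambda>) - 1" by linarith
    moreover have "real (2 * card \<Lambda>) \<le> real ((d + 1) * (d + 4))" using card\<Lambda> by (simp only: of_nat_le_iff)
    ultimately show ?case using finF unfolding F_def by (simp add: field_simps)
  qed
  then show "\<exists>\<epsilon>0>0. \<forall>\<epsilon>. 0 < \<bar>\<epsilon>\<bar> \<and> \<bar>\<epsilon>\<bar> < \<epsilon>0 \<longrightarrow>
      finite {x\<in>K. first_return (perturbed_field f g P Q \<epsilon>) x x \<and>
                   (\<exists>C. limit_cycle (perturbed_field f g P Q \<epsilon>) C \<and> (x, 0) \<in> C)} \<and>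
      real (card {x\<in>K. first_return (perturbed_field f g P Q \<epsilon>) x x \<and>
                   (\<exists>C. limit_cycle (perturbed_field f g P Q \<epsilon>) C \<and> (x, 0) \<in> C)})
        \<le> (real d + 1) * (real d + 4) / 2 - 1"
    unfolding eventually_at by (auto simp: dist_real_def)
qed

end
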